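(* Let $\tau$ be an analytic expanding circle map, let $C_\tau f=f\circ\tau$ be the associated Koopman operator, and let $\tau'_{\min}=\min_{z\in\mathbb{T}}|\tau'(z)|$ and $\tau'_{\max}=\max_{z\in\mathbb{T}}|\tau'(z)|$. Then the following holds. (1) There exists a Hilbert space $\mathcal{H}$ (of the form $\mathcal{H}=H^2(A_r^c)$ for some $r\in(0,1)$) such that $C_\tau$ is a well-defined compact operator from $\mathcal{H}$ to $\mathcal{H}$. In particular, its spectrum $\operatorname{spec}(C_\tau)$ is either a finite set or a sequence converging to zero together with zero itself, and each non-zero spectral point is an eigenvalue of finite algebraic multiplicity. (2) The space $\mathcal{H}$ in (1) can be taken such that moreover the following holds. Let $\alpha\in\mathbb{R}$, and suppose that for every $n\in\mathbb{N}$ the number $m=m(n)\in\mathbb{N}$ is chosen such that $$m\ge(\tau'_{\min}+\tau'_{\max})\,n .$$ For $n\in\mathbb{N}$ let $M_n$ be the $(2n-1)\times(2n-1)$ EDMD matrix of $\tau$ built from the observables $\psi_l(z)=z^l$, $-(n-1)\le l\le n-1$, and the phase space points $z^{(j)}=e^{2\pi i j/m+i\alpha}$, $0\le j\le m-1$, with $m=m(n)$. Then: (a) Any convergent sequence $(\lambda_n)_{n\in\mathbb{N}}$ with $\lambda_n\in\operatorname{spec}(M_n)$ converges to a spectral point of $C_\tau$. (b) Conversely, for any $\lambda\in\operatorname{spec}(C_\tau)$ there is a sequence $(\lambda_n)_{n\in\mathbb{N}}$ with $\lambda_n\in\operatorname{spec}(M_n)$ such that $\lambda_n\to\lambda$ as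 $n\to\infty$. Moreover, $|\lambda-\lambda_n|=O(e^{-an})$ as $n\to\infty$ for some $a>0$. (c) Suppose $\lambda\in\operatorname{spec}(C_\tau)$ is non-zero and $(\lambda_n)_{n\in\mathbb{N}}$ denotes the approximating sequence of eigenvalues of $M_n$ given in (b). If, for each $n$, $\xi_n=(\xi_{n,-n+1},\ldots,\xi_{n,0},\ldots,\xi_{n,n-1})^T\in\mathbb{C}^{2n-1}$ is a generalised eigenvector of the transpose $M_n^T$ corresponding to the eigenvalue $\lambda_n$, then setting $$h_n(z)=C\sum_{|k|<n}\xi_{n,k}z^k ,$$ where $C=C_n$ is a constant chosen so that $\|h_n\|_{\mathcal{H}}=1$, yields a sequence of Laurent polynomials with $$\|\mathcal{P}h_n-h_n\|_{\mathcal{H}}=O(e^{-bn})\quad\text{as }n\to\infty$$ for some $b>0$, where $\mathcal{P}$ is the spectral projection associated to the eigenvalue $\lambda$ of $C_\tau$.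
   Context: $\mathbb{T}=\{z\in\mathbb{C}:|z|=1\}$ and, for $r\in(0,1)$, $A_r=\{z\in\mathbb{C}: r<|z|<r^{-1}\}$. An analytic expanding circle map is a map $\tau:\mathbb{T}\to\mathbb{T}$ which has an analytic extension to some annulus $A_r$, $r\in(0,1)$, and satisfies $\min_{z\in\mathbb{T}}|\tau'(z)|>1$. EDMD matrix: given observables $\psi_{-n+1},\dots,\psi_{n-1}$ and points $z^{(0)},\dots,z^{(m-1)}$, put, for $k,l\in\{-n+1,\dots,n-1\}$, $$G_{k,l}=\frac1m\sum_{j=0}^{m-1}\psi_k(\tau(z^{(j)}))\overline{\psi_l(z^{(j)})},\qquad H_{k,l}=\frac1m\sum_{j=0}^{m-1}\psi_k(z^{(j)})\overline{\psi_l(z^{(j)})},$$ and $M_n=GH^{-1}$. Hilbert space: for a Laurent polynomial $f$ (finite linear combination of $z^n$, $n\in\mathbb{Z}$) let $c_n(f)=\frac1{2\pi}\int_0^{2\pi}f(e^{it})e^{-int}\,dt$. For $r\in(0,1)$, $H^2(A_r^c)$ is the completion of the space of Laurent polynomials with respect to the norm $\|f\|=\sqrt{\sum_{n\in\mathbb{Z}}|c_n(f)|^2r^{2|n|}}$; it contains $L^2(\mathbb{T})$. The operator $C_\tau$ is defined on Laurent polynomials $f$ by $C_\tau f=f\circ\tau$ (viewed as a function on $\mathbb{T}$, hence as an element of $L^2(\mathbb{T})\subset H^2(A_r^c)$) and on all of $H^2(A_r^c)$ by continuous extension. A generalised eigenvector of a matrix $A$ for an eigenvalue $\mu$ is a non-zero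 vector in $\ker((\mu I-A)^\nu)$ for some $\nu\in\mathbb{N}$. The spectral projection associated to a non-zero eigenvalue $\lambda$ of a compact operator is the Riesz projection $\frac1{2\pi i}\int_\gamma(\zeta I-C_\tau)^{-1}d\zeta$, with $\gamma$ a small circle around $\lambda$ enclosing no other spectral point. *)

theory Defs
  imports "HOL-Complex_Analysis.Complex_Analysis" "Jordan_Normal_Form.Spectral_Radius"
begin

unbundle no vec_syntax

section \<open>Analytic expanding circle maps\<close>

definition annulus :: "real \<Rightarrow> complex set" where
  "annulus r = {z. r < cmod z \<and> cmod z < inverse r}"

text \<open>The derivative of \<open>\<tau>\<close> is taken along the unit circle, so that it depends only on the
  values of \<open>\<tau>\<close> there; by \<open>circle_deriv_eq\<close> below it is the derivative of any analytic extension.\<close>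

definition circle_deriv :: "(complex \<Rightarrow> complex) \<Rightarrow> complex \<Rightarrow> complex" where
  "circle_deriv \<tau> z = (THE D. (\<tau> has_field_derivative D) (at z within sphere 0 1))"

definition circle_deriv_min :: "(complex \<Rightarrow> complex) \<Rightarrow> real" where
  "circle_deriv_min \<tau> = (INF z\<in>sphere 0 1. cmod (circle_deriv \<tau> z))"

definition circle_deriv_max :: "(complex \<Rightarrow> complex) \<Rightarrow> real" where
  "circle_deriv_max \<tau> = (SUP z\<in>sphere 0 1. cmod (circle_deriv \<tau> z))"

definition expanding_circle_map :: "(complex \<Rightarrow> complex) \<Rightarrow> bool" where
  "expanding_circle_map \<tau> \<longleftrightarrow>
     \<tau> \<in> sphere 0 1 \<rightarrow> sphere 0 1 \<and>
     (\<exists>r g. 0 < r \<and> r < 1 \<and> g holomorphic_on annulus r \<and> (\<forall>z\<in>sphere 0 1. g z = \<tau> z)) \<and>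
     1 < circle_deriv_min \<tau>"

lemma open_annulus: "open (annulus r)"
  unfolding annulus_def by (intro open_Collect_conj open_Collect_less continuous_intros)

lemma sphere_subset_annulus: "0 < r \<Longrightarrow> r < 1 \<Longrightarrow> sphere 0 1 \<subseteq> annulus r"
  by (auto simp: annulus_def one_less_inverse_iff)

lemma circle_deriv_eq:
  assumes r: "0 < r" "r < 1" and g: "g holomorphic_on annulus r"
    and eq: "\<And>z. z \<in> sphere 0 1 \<Longrightarrow> g z = \<tau> z" and z: "z \<in> sphere 0 1"
  shows "circle_deriv \<tau> z = deriv g z"
proof -
  have "(g has_field_derivative deriv g z) (at z)"
    using holomorphic_derivI[OF g open_annulus] sphere_subset_annulus[OF r] z by blast
  then have "(g has_field_derivative deriv g z) (at z within sphere 0 1)"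
    by (rule has_field_derivative_at_within)
  then have D: "(\<tau> has_field_derivative deriv g z) (at z within sphere 0 1)"
    using has_field_derivative_transform_within[of g _ z "sphere 0 1" 1 \<tau>] z eq by auto
  have "z islimpt sphere 0 (1::real)"
  proof (rule connected_imp_perfect)
    show "connected (sphere 0 1 :: complex set)" by (rule connected_sphere) simp
    show "z \<in> sphere 0 1" by (rule z)
    show "sphere 0 1 \<noteq> {x}" for x :: complex
    proof
      assume "sphere 0 1 = {x}"
      moreover have "1 \<in> sphere (0::complex) 1" "-1 \<in> sphere (0::complex) 1" by auto
      ultimately have "(1::complex) = -1" by simp
      then show False by simp
    qed
  qed
  then have "at z within sphere 0 1 \<noteq> bot"
    by (simp add: trivial_limit_within)
  then show ?thesis
    unfolding circle_deriv_def using D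
    by (intro the_equality) (auto simp: has_field_derivative_iff intro: tendsto_unique)
qed


section \<open>EDMD matrices\<close>

text \<open>Rows and columns are indexed by \<open>0, \<dots>, 2n - 2\<close>; the position \<open>i\<close> stands for the
  observable with index \<open>i - (n - 1)\<close>.\<close>

definition obs_index :: "nat \<Rightarrow> nat \<Rightarrow> int" where
  "obs_index n i = int i - (int n - 1)"

definition edmd_G ::
  "(complex \<Rightarrow> complex) \<Rightarrow> (int \<Rightarrow> complex \<Rightarrow> complex) \<Rightarrow> nat \<Rightarrow> nat \<Rightarrow> (nat \<Rightarrow> complex) \<Rightarrow> complex mat" where
  "edmd_G \<tau> \<psi> n m z = Matrix.mat (2 * n - 1) (2 * n - 1)
     (\<lambda>(k, l). (1 / of_nat m) *
        (\<Sum>j<m. \<psi> (obs_index n k) (\<tau> (z j)) * cnj (\<psi> (obs_index n l) (z j))))"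

definition edmd_H ::
  "(int \<Rightarrow> complex \<Rightarrow> complex) \<Rightarrow> nat \<Rightarrow> nat \<Rightarrow> (nat \<Rightarrow> complex) \<Rightarrow> complex mat" where
  "edmd_H \<psi> n m z = Matrix.mat (2 * n - 1) (2 * n - 1)
     (\<lambda>(k, l). (1 / of_nat m) *
        (\<Sum>j<m. \<psi> (obs_index n k) (z j) * cnj (\<psi> (obs_index n l) (z j))))"

definition edmd_matrix ::
  "(complex \<Rightarrow> complex) \<Rightarrow> (int \<Rightarrow> complex \<Rightarrow> complex) \<Rightarrow> nat \<Rightarrow> nat \<Rightarrow> (nat \<Rightarrow> complex) \<Rightarrow> complex mat" where
  "edmd_matrix \<tau> \<psi> n m z = edmd_G \<tau> \<psi> n m z * the (mat_inverse (edmd_H \<psi> n m z))"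

definition gen_eigenvector :: "complex mat \<Rightarrow> complex Matrix.vec \<Rightarrow> complex \<Rightarrow> bool" where
  "gen_eigenvector A v \<mu> \<longleftrightarrow>
     v \<in> carrier_vec (dim_row A) \<and> v \<noteq> 0\<^sub>v (dim_row A) \<and>
     (\<exists>\<nu>. ((\<mu> \<cdot>\<^sub>m 1\<^sub>m (dim_row A) - A) ^\<^sub>m \<nu>) *\<^sub>v v = 0\<^sub>v (dim_row A))"

text \<open>The Laurent polynomial with coefficient vector \<open>v\<close>, indexed as above.\<close>

definition laurent_of_vec :: "nat \<Rightarrow> complex Matrix.vec \<Rightarrow> complex \<Rightarrow> complex" where
  "laurent_of_vec n v z = (\<Sum>k | \<bar>k\<bar> < int n. v $ nat (k + (int n - 1)) * z powi k)"


section \<open>The Hilbert space of square-summable bi-infinite sequences\<close>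

typedef ell2 = "{x :: int \<Rightarrow> complex. (\<lambda>n. (cmod (x n))\<^sup>2) summable_on UNIV}"
  morphisms ell2_nth Abs_ell2
  by (rule exI[of _ "\<lambda>_. 0"]) simp

setup_lifting type_definition_ell2

lemma ell2_sum_bound: "(cmod (a + b))\<^sup>2 \<le> 2 * (cmod a)\<^sup>2 + 2 * (cmod b)\<^sup>2"
proof -
  have "(cmod (a + b))\<^sup>2 \<le> (cmod a + cmod b)\<^sup>2"
    by (intro power_mono norm_triangle_ineq) auto
  also have "\<dots> \<le> 2 * (cmod a)\<^sup>2 + 2 * (cmod b)\<^sup>2"
    using zero_le_power2[of "cmod a - cmod b"] by (simp add: power2_eq_square algebra_simps)
  finally show ?thesis .
qed

lemma ell2_add_summable:
  assumes "(\<lambda>n::int. (cmod (x n))\<^sup>2) summable_on UNIV" "(\<lambda>n. (cmod (y n))\<^sup>2) summable_on UNIV"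
  shows "(\<lambda>n. (cmod (x n + y n))\<^sup>2) summable_on UNIV"
  by (rule summable_on_comparison_test[where f = "\<lambda>n. 2 * (cmod (x n))\<^sup>2 + 2 * (cmod (y n))\<^sup>2"])
     (auto intro!: summable_on_add summable_on_cmult_right assms ell2_sum_bound)

lemma ell2_scale_summable:
  assumes "(\<lambda>n::int. (cmod (x n))\<^sup>2) summable_on UNIV"
  shows "(\<lambda>n. (cmod (c * x n))\<^sup>2) summable_on UNIV"
  using summable_on_cmult_right[OF assms, of "(cmod c)\<^sup>2"] by (simp add: norm_mult power_mult_distrib)

lemma ell2_inner_summable:
  assumes "(\<lambda>n::int. (cmod (x n))\<^sup>2) summable_on UNIV" "(\<lambda>n. (cmod (y n))\<^sup>2) summable_on UNIV"
  shows "(\<lambda>n. inner (x n) (y n)) summable_on UNIV"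
proof -
  have "(\<lambda>n. norm (inner (x n) (y n))) summable_on UNIV"
  proof (rule summable_on_comparison_test[where f = "\<lambda>n. (cmod (x n))\<^sup>2 + (cmod (y n))\<^sup>2"])
    show "(\<lambda>n. (cmod (x n))\<^sup>2 + (cmod (y n))\<^sup>2) summable_on UNIV"
      by (intro summable_on_add assms)
    fix n
    have "norm (inner (x n) (y n)) \<le> cmod (x n) * cmod (y n)"
      by (simp add: Cauchy_Schwarz_ineq2)
    also have "\<dots> \<le> (cmod (x n))\<^sup>2 + (cmod (y n))\<^sup>2"
      using zero_le_power2[of "cmod (x n) - cmod (y n)"] mult_nonneg_nonneg[OF norm_ge_zero[of "x n"] norm_ge_zero[of "y n"]]
      unfolding power2_diff by linarith
    finally show "norm (inner (x n) (y n)) \<le> (cmod (x n))\<^sup>2 + (cmod (y n))\<^sup>2" .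
  qed auto
  then show ?thesis by (rule abs_summable_summable)
qed

instantiation ell2 :: real_inner
begin

lift_definition zero_ell2 :: ell2 is "\<lambda>_. 0" by simp
lift_definition plus_ell2 :: "ell2 \<Rightarrow> ell2 \<Rightarrow> ell2" is "\<lambda>x y n. x n + y n"
  by (rule ell2_add_summable)
lift_definition uminus_ell2 :: "ell2 \<Rightarrow> ell2" is "\<lambda>x n. - x n" by simp
lift_definition minus_ell2 :: "ell2 \<Rightarrow> ell2 \<Rightarrow> ell2" is "\<lambda>x y n. x n - y n"
  subgoal for x y using ell2_add_summable[of x "\<lambda>n. - y n"] by simp
  done
lift_definition scaleR_ell2 :: "real \<Rightarrow> ell2 \<Rightarrow> ell2" is "\<lambda>c x n. c *\<^sub>R x n"
  unfolding scaleR_conv_of_real by (rule ell2_scale_summable)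

text \<open>The real inner product is the real part of the complex one; both induce the same norm.\<close>

lift_definition inner_ell2 :: "ell2 \<Rightarrow> ell2 \<Rightarrow> real" is "\<lambda>x y. \<Sum>\<^sub>\<infinity>n. inner (x n) (y n)" .

definition norm_ell2 :: "ell2 \<Rightarrow> real" where "norm_ell2 x = sqrt (inner x x)"
definition sgn_ell2 :: "ell2 \<Rightarrow> ell2" where "sgn_ell2 x = inverse (norm x) *\<^sub>R x"
definition dist_ell2 :: "ell2 \<Rightarrow> ell2 \<Rightarrow> real" where "dist_ell2 x y = norm (x - y)"
definition uniformity_ell2 :: "(ell2 \<times> ell2) filter" where
  "uniformity_ell2 = (INF e\<in>{0<..}. principal {(x, y). dist x y < e})"
definition open_ell2 :: "ell2 set \<Rightarrow> bool" where
  "open_ell2 U = (\<forall>x\<in>U. eventually (\<lambda>(x', y). x' = x \<longrightarrow> y \<in> U) uniformity)"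

instance
proof
  fix x y z :: ell2 and a b :: real
  show "x + y + z = x + (y + z)" by transfer (auto simp: algebra_simps)
  show "x + y = y + x" by transfer (auto simp: algebra_simps)
  show "0 + x = x" by transfer auto
  show "- x + x = 0" by transfer auto
  show "x - y = x + - y" by transfer auto
  show "a *\<^sub>R (x + y) = a *\<^sub>R x + a *\<^sub>R y" by transfer (auto simp: algebra_simps)
  show "(a + b) *\<^sub>R x = a *\<^sub>R x + b *\<^sub>R x" by transfer (auto simp: algebra_simps)
  show "a *\<^sub>R b *\<^sub>R x = (a * b) *\<^sub>R x" by transfer auto
  show "1 *\<^sub>R x = x" by transfer auto
  show "sgn x = inverse (norm x) *\<^sub>R x" by (simp add: sgn_ell2_def)
  show "dist x y = norm (x - y)" by (simp add: dist_ell2_def)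
  show "uniformity = (INF e\<in>{0<..}. principal {(x, y). dist x (y::ell2) < e})"
    by (rule uniformity_ell2_def)
  show "open U = (\<forall>x\<in>U. eventually (\<lambda>(x', y). x' = x \<longrightarrow> y \<in> U) uniformity)" for U :: "ell2 set"
    by (rule open_ell2_def)
  show "inner x y = inner y x" by transfer (simp add: inner_commute)
  show "inner (x + y) z = inner x z + inner y z"
    by transfer (simp add: inner_add_left infsum_add ell2_inner_summable)
  show "inner (a *\<^sub>R x) y = a * inner x y"
    by transfer (simp add: infsum_cmult_right')
  show "0 \<le> inner x x" by transfer (simp add: infsum_nonneg)
  show "inner x x = 0 \<longleftrightarrow> x = 0"
  proof (transfer, safe)
    fix x :: "int \<Rightarrow> complex" assume s: "(\<lambda>n. (cmod (x n))\<^sup>2) summable_on UNIV"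
      and 0: "(\<Sum>\<^sub>\<infinity>n. inner (x n) (x n)) = 0"
    have "inner (x n) (x n) = 0" for n
      by (rule nonneg_infsum_le_0D[of "\<lambda>n. inner (x n) (x n)" UNIV])
         (use 0 ell2_inner_summable[OF s s] in auto)
    then show "x = (\<lambda>_. 0)" by auto
  qed auto
  show "norm x = sqrt (inner x x)" by (rule norm_ell2_def)
qed

end

lemma ell2_nth_summable: "(\<lambda>n. (cmod (ell2_nth x n))\<^sup>2) summable_on UNIV"
  using ell2_nth[of x] by simp

lemma norm_ell2_eq: "norm x = sqrt (\<Sum>\<^sub>\<infinity>n. (cmod (ell2_nth x n))\<^sup>2)"
  unfolding norm_ell2_def by transfer (simp add: power2_norm_eq_inner)

lemma ell2_partial_sum_le:
  assumes "finite F" shows "(\<Sum>n\<in>F. (cmod (ell2_nth x n))\<^sup>2) \<le> (norm x)\<^sup>2"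
proof -
  have "(\<Sum>n\<in>F. (cmod (ell2_nth x n))\<^sup>2) \<le> (\<Sum>\<^sub>\<infinity>n. (cmod (ell2_nth x n))\<^sup>2)"
    by (rule finite_sum_le_infsum) (use assms ell2_nth_summable in auto)
  also have "\<dots> = (norm x)\<^sup>2"
    unfolding norm_ell2_eq by (simp add: infsum_nonneg)
  finally show ?thesis .
qed

lemma ell2_nth_le: "cmod (ell2_nth x n) \<le> norm x"
  by (rule power2_le_imp_le) (use ell2_partial_sum_le[of "{n}" x] in simp_all)

instance ell2 :: banach
proof
  fix X :: "nat \<Rightarrow> ell2" assume X: "Cauchy X"
  have "Cauchy (\<lambda>i. ell2_nth (X i) k)" for k
  proof (rule CauchyI)
    fix e :: real assume "e > 0"
    then obtain N where "\<And>i j. i \<ge> N \<Longrightarrow> j \<ge> N \<Longrightarrow> norm (X i - X j) < e"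
      using X by (meson CauchyD)
    moreover have "norm (ell2_nth (X i) k - ell2_nth (X j) k) \<le> norm (X i - X j)" for i j
      using ell2_nth_le[of "X i - X j" k] by (simp add: minus_ell2.rep_eq)
    ultimately show "\<exists>N. \<forall>i\<ge>N. \<forall>j\<ge>N. norm (ell2_nth (X i) k - ell2_nth (X j) k) < e"
      by (meson le_less_trans)
  qed
  then obtain L where L: "\<And>k. (\<lambda>i. ell2_nth (X i) k) \<longlonglongrightarrow> L k"
    unfolding Cauchy_convergent_iff convergent_def by metis
  have bound: "(\<Sum>k\<in>F. (cmod (ell2_nth (X i) k - L k))\<^sup>2) \<le> e\<^sup>2"
    if F: "finite F" and e: "e > 0" and i: "\<And>j. j \<ge> N \<Longrightarrow> norm (X i - X j) < e" for F e i N
  proof (rule tendsto_upperbound)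
    show "(\<lambda>j. \<Sum>k\<in>F. (cmod (ell2_nth (X i) k - ell2_nth (X j) k))\<^sup>2)
            \<longlonglongrightarrow> (\<Sum>k\<in>F. (cmod (ell2_nth (X i) k - L k))\<^sup>2)"
      by (intro tendsto_intros L)
    show "\<forall>\<^sub>F j in sequentially. (\<Sum>k\<in>F. (cmod (ell2_nth (X i) k - ell2_nth (X j) k))\<^sup>2) \<le> e\<^sup>2"
      unfolding eventually_sequentially
    proof (intro exI allI impI)
      fix j assume "j \<ge> N"
      have "(\<Sum>k\<in>F. (cmod (ell2_nth (X i) k - ell2_nth (X j) k))\<^sup>2) \<le> (norm (X i - X j))\<^sup>2"
        using ell2_partial_sum_le[OF F, of "X i - X j"] by (simp add: minus_ell2.rep_eq)
      also have "\<dots> \<le> e\<^sup>2" using i[OF \<open>j \<ge> N\<close>] by (intro power_mono) auto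
      finally show "(\<Sum>k\<in>F. (cmod (ell2_nth (X i) k - ell2_nth (X j) k))\<^sup>2) \<le> e\<^sup>2" .
    qed
  qed simp
  have diff: "(\<lambda>k. (cmod (ell2_nth (X i) k - L k))\<^sup>2) summable_on UNIV
        \<and> (\<Sum>\<^sub>\<infinity>k. (cmod (ell2_nth (X i) k - L k))\<^sup>2) \<le> e\<^sup>2"
    if e: "e > 0" and i: "\<And>j. j \<ge> N \<Longrightarrow> norm (X i - X j) < e" for e i N
  proof
    show s: "(\<lambda>k. (cmod (ell2_nth (X i) k - L k))\<^sup>2) summable_on UNIV"
      by (rule nonneg_bdd_above_summable_on) (use bound[OF _ e i] in \<open>auto intro!: bdd_aboveI2\<close>)
    show "(\<Sum>\<^sub>\<infinity>k. (cmod (ell2_nth (X i) k - L k))\<^sup>2) \<le> e\<^sup>2"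
      by (rule infsum_le_finite_sums[OF s]) (use bound[OF _ e i] in auto)
  qed
  have one: "(0::real) < 1" by simp
  obtain N1 where N1: "\<And>i j. i \<ge> N1 \<Longrightarrow> j \<ge> N1 \<Longrightarrow> norm (X i - X j) < 1"
    using CauchyD[OF X one] by blast
  have "(\<lambda>k. (cmod (ell2_nth (X N1) k + - (ell2_nth (X N1) k - L k)))\<^sup>2) summable_on UNIV"
    using diff[of 1 N1 N1] N1 ell2_nth_summable[of "X N1"]
    by (intro ell2_add_summable) (auto simp: norm_minus_commute)
  then have sL: "L \<in> {x. (\<lambda>n. (cmod (x n))\<^sup>2) summable_on UNIV}" by simp
  have "X \<longlonglongrightarrow> Abs_ell2 L"
  proof (rule LIMSEQ_I)
    fix e :: real assume "e > 0"
    then obtain N where N: "\<And>i j. i \<ge> N \<Longrightarrow> j \<ge> N \<Longrightarrow> norm (X i - X j) < e / 2"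
      using CauchyD[OF X, of "e / 2"] half_gt_zero[of e] by blast
    have "norm (X i - Abs_ell2 L) < e" if "i \<ge> N" for i
    proof -
      have "(norm (X i - Abs_ell2 L))\<^sup>2 \<le> (e / 2)\<^sup>2"
        using diff[of "e / 2" N i] N[OF that] \<open>e > 0\<close>
        by (simp add: norm_ell2_eq minus_ell2.rep_eq Abs_ell2_inverse[OF sL] infsum_nonneg)
      then show ?thesis using \<open>e > 0\<close> by (simp add: abs_le_square_iff[symmetric])
    qed
    then show "\<exists>N. \<forall>i\<ge>N. norm (X i - Abs_ell2 L) < e" by blast
  qed
  then show "convergent X" by (auto simp: convergent_def)
qed

lift_definition cscale :: "complex \<Rightarrow> ell2 \<Rightarrow> ell2" is "\<lambda>c x n. c * x n"
  by (rule ell2_scale_summable)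

lemma norm_cscale: "norm (cscale c x) = cmod c * norm x"
  unfolding norm_ell2_eq
  by (simp add: cscale.rep_eq norm_mult power_mult_distrib infsum_cmult_right' real_sqrt_mult)

lemma vector_space_cscale: "vector_space cscale"
  by unfold_locales (transfer; auto simp: algebra_simps)+

lemma bounded_linear_cscale: "bounded_linear (cscale c)"
proof (rule bounded_linear_intro[where K = "cmod c"])
  show "cscale c (x + y) = cscale c x + cscale c y" for x y by transfer (auto simp: algebra_simps)
  show "cscale c (a *\<^sub>R x) = a *\<^sub>R cscale c x" for a x by transfer auto
qed (simp add: norm_cscale mult.commute)


section \<open>The completion of the Laurent polynomials\<close>

definition laurent_polys :: "(complex \<Rightarrow> complex) set" where
  "laurent_polys = {f. \<exists>S a. finite (S :: int set) \<and> f = (\<lambda>z. \<Sum>k\<in>S. a k * z powi k)}"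

definition fourier_coeff :: "(complex \<Rightarrow> complex) \<Rightarrow> int \<Rightarrow> complex" where
  "fourier_coeff f n =
     1 / (2 * of_real pi) * integral {0..2 * pi} (\<lambda>t. f (cis t) * cis (- (of_int n * t)))"

definition hardy_norm :: "real \<Rightarrow> (complex \<Rightarrow> complex) \<Rightarrow> real" where
  "hardy_norm r f = sqrt (\<Sum>\<^sub>\<infinity>n. (cmod (fourier_coeff f n))\<^sup>2 * r ^ (2 * nat \<bar>n\<bar>))"

text \<open>The completion \<open>H\<^sup>2(A\<^sub>r\<^sup>c)\<close> of the Laurent polynomials with respect to \<^const>\<open>hardy_norm\<close> is
  realised as the fixed Hilbert space \<^typ>\<open>ell2\<close> together with the canonical map below, which
  depends on \<open>r\<close>: an element with Laurent coefficients \<open>c\<^sub>n\<close> is represented by the sequence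
  \<open>c\<^sub>n r\<^bsup>|n|\<^esup>\<close>. Lemmas \<open>norm_hardy_embed\<close>, \<open>hardy_embed_add\<close>, \<open>hardy_embed_cmult\<close> and
  \<open>hardy_embed_dense\<close> show that this is a completion: on Laurent polynomials the map is linear and
  isometric, with dense range. On functions \<open>f \<circ> \<tau>\<close>, with \<open>f\<close> a Laurent polynomial, it is the
  inclusion of \<open>L\<^sup>2\<close> of the circle into the completion, given by Fourier coefficients.\<close>

definition hardy_embed :: "real \<Rightarrow> (complex \<Rightarrow> complex) \<Rightarrow> ell2" where
  "hardy_embed r f = Abs_ell2 (\<lambda>n. fourier_coeff f n * of_real (r ^ nat \<bar>n\<bar>))"

lemma continuous_on_circle_param:
  assumes "continuous_on (sphere 0 1) f" shows "continuous_on A (\<lambda>t. f (cis t))"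
  by (rule continuous_on_compose2[OF assms]) (auto intro!: continuous_intros)

lemma fourier_integrable:
  assumes "continuous_on (sphere 0 1) f"
  shows "(\<lambda>t. f (cis t) * cis (- (of_int n * t))) integrable_on {0..2 * pi}"
  by (intro integrable_continuous_interval continuous_intros continuous_on_circle_param assms)

lemma fourier_coeff_add:
  assumes "continuous_on (sphere 0 1) f" "continuous_on (sphere 0 1) g"
  shows "fourier_coeff (\<lambda>z. f z + g z) n = fourier_coeff f n + fourier_coeff g n"
  unfolding fourier_coeff_def distrib_right
  by (simp add: Henstock_Kurzweil_Integration.integral_add fourier_integrable assms distrib_left)

lemma fourier_coeff_cmult: "fourier_coeff (\<lambda>z. c * f z) n = c * fourier_coeff f n"
proof -
  have "integral {0..2 * pi} (\<lambda>t. c * f (cis t) * cis (- (of_int n * t)))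
      = c * integral {0..2 * pi} (\<lambda>t. f (cis t) * cis (- (of_int n * t)))"
    by (simp only: mult.assoc integral_mult_right)
  from arg_cong[OF this, of "\<lambda>w. 1 / (2 * of_real pi) * w"] show ?thesis
    unfolding fourier_coeff_def by (subst mult.left_commute)
qed

lemma fourier_coeff_bounded:
  assumes "continuous_on (sphere 0 1) f"
  obtains B where "\<And>n. cmod (fourier_coeff f n) \<le> B"
proof -
  obtain B where B: "\<And>z. z \<in> sphere 0 1 \<Longrightarrow> cmod (f z) \<le> B"
    using compact_imp_bounded[OF compact_continuous_image[OF assms compact_sphere]]
    unfolding bounded_iff by blast
  have "cmod (fourier_coeff f n) \<le> B" for n
  proof -
    have "norm (integral {0..2 * pi} (\<lambda>t. f (cis t) * cis (- (of_int n * t)))) \<le> B * (2 * pi - 0)"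
      by (rule integral_bound)
         (auto simp: norm_mult intro!: B continuous_intros continuous_on_circle_param assms)
    then show ?thesis by (simp add: fourier_coeff_def norm_mult norm_divide field_simps)
  qed
  then show ?thesis by (rule that)
qed

lemma weights_summable:
  fixes r :: real
  assumes "0 < r" "r < 1" shows "(\<lambda>n::int. r ^ (2 * nat \<bar>n\<bar>)) summable_on UNIV"
proof -
  have s: "(\<lambda>n::nat. (r\<^sup>2) ^ n) summable_on UNIV"
    by (rule norm_summable_imp_summable_on)
       (use assms in \<open>auto intro!: summable_geometric simp: abs_square_less_1 norm_power\<close>)
  have "(\<lambda>n::int. (r\<^sup>2) ^ nat \<bar>n\<bar>) summable_on (range int)"
    by (subst summable_on_reindex) (use s in \<open>auto simp: o_def\<close>)
  moreover have "(\<lambda>n::int. (r\<^sup>2) ^ nat \<bar>n\<bar>) summable_on (range (\<lambda>n. - int n))"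
    by (subst summable_on_reindex) (use s in \<open>auto simp: o_def inj_on_def\<close>)
  ultimately have "(\<lambda>n::int. (r\<^sup>2) ^ nat \<bar>n\<bar>) summable_on (range int \<union> range (\<lambda>n. - int n))"
    by (rule summable_on_union)
  moreover have "range int \<union> range (\<lambda>n. - int n) = UNIV"
  proof -
    have "k \<in> range int \<union> range (\<lambda>n. - int n)" for k
      by (cases k rule: int_cases2) auto
    then show ?thesis by auto
  qed
  ultimately show ?thesis by (simp add: power_mult)
qed

lemma hardy_embed_nth:
  assumes "0 < r" "r < 1" "continuous_on (sphere 0 1) f"
  shows "ell2_nth (hardy_embed r f) n = fourier_coeff f n * of_real (r ^ nat \<bar>n\<bar>)"
proof -
  obtain B where B: "\<And>n. cmod (fourier_coeff f n) \<le> B"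
    using fourier_coeff_bounded[OF assms(3)] by blast
  have "(\<lambda>n. (cmod (fourier_coeff f n * of_real (r ^ nat \<bar>n\<bar>)))\<^sup>2) summable_on UNIV"
  proof (rule summable_on_comparison_test[where f = "\<lambda>n. B\<^sup>2 * r ^ (2 * nat \<bar>n\<bar>)"])
    show "(\<lambda>n::int. B\<^sup>2 * r ^ (2 * nat \<bar>n\<bar>)) summable_on UNIV"
      by (intro summable_on_cmult_right weights_summable assms)
    show "(cmod (fourier_coeff f n * of_real (r ^ nat \<bar>n\<bar>)))\<^sup>2 \<le> B\<^sup>2 * r ^ (2 * nat \<bar>n\<bar>)" for n
      using assms(1) power_mono[OF B, of n 2]
      by (simp add: norm_mult norm_power power_mult_distrib power_mult[symmetric] mult.commute
          mult_left_mono)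
  qed auto
  then show ?thesis by (simp add: hardy_embed_def Abs_ell2_inverse)
qed

lemma norm_hardy_embed:
  assumes "0 < r" "r < 1" "continuous_on (sphere 0 1) f"
  shows "norm (hardy_embed r f) = hardy_norm r f"
  using assms(1) unfolding norm_ell2_eq hardy_norm_def hardy_embed_nth[OF assms]
  by (simp add: norm_mult norm_power power_mult_distrib power_mult[symmetric] mult.commute)

lemma hardy_embed_add:
  assumes "0 < r" "r < 1" "continuous_on (sphere 0 1) f" "continuous_on (sphere 0 1) g"
  shows "hardy_embed r (\<lambda>z. f z + g z) = hardy_embed r f + hardy_embed r g"
  using assms
  by (simp add: ell2_nth_inject[symmetric] fun_eq_iff hardy_embed_nth plus_ell2.rep_eq
      continuous_on_add fourier_coeff_add distrib_right)

lemma hardy_embed_cmult: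
  assumes "0 < r" "r < 1" "continuous_on (sphere 0 1) f"
  shows "hardy_embed r (\<lambda>z. c * f z) = cscale c (hardy_embed r f)"
  using assms
  by (simp add: ell2_nth_inject[symmetric] fun_eq_iff hardy_embed_nth cscale.rep_eq
      continuous_on_mult_left fourier_coeff_cmult)

lemma continuous_on_laurent_poly:
  assumes "f \<in> laurent_polys" shows "continuous_on (sphere 0 1) f"
  using assms unfolding laurent_polys_def by (auto intro!: continuous_intros)

lemma exp_deriv:
  fixes c w :: complex
  assumes "c \<noteq> 0"
  shows "((\<lambda>w. exp (\<i> * (c * w)) / (\<i> * c)) has_field_derivative exp (\<i> * (c * w))) (at w)"
proof -
  have "((\<lambda>w. exp (\<i> * (c * w)) / (\<i> * c)) has_field_derivative
          (exp (\<i> * (c * w)) * (\<i> * (c * 1))) / (\<i> * c)) (at w)"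
    by (intro DERIV_cdivide DERIV_fun_exp DERIV_cmult DERIV_ident)
  then show ?thesis using assms by simp
qed

lemma fourier_coeff_laurent_poly:
  assumes S: "finite S"
  shows "fourier_coeff (\<lambda>z. \<Sum>k\<in>S. a k * z powi k) n = (if n \<in> S then a n else 0)"
proof -
  have mono: "fourier_coeff (\<lambda>z. z powi k) n = (if k = n then 1 else 0)" for k
  proof -
    have e: "cis t powi k * cis (- (of_int n * t)) = cis (of_int (k - n) * t)" for t
      by (simp add: cis_power_int cis_mult algebra_simps)
    have "((\<lambda>t. cis (of_int (k - n) * t)) has_integral 0) {0..2 * pi}" if "k \<noteq> n"
    proof -
      let ?c = "of_int (k - n) :: real"
      have c: "?c \<noteq> 0" using that by simp
      have "((\<lambda>t. cis (?c * t)) has_integral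
              (cis (?c * (2 * pi)) / (\<i> * ?c) - cis (?c * 0) / (\<i> * ?c))) {0..2 * pi}"
      proof (rule fundamental_theorem_of_calculus)
        fix t
        have "((\<lambda>w. exp (\<i> * (of_real ?c * w)) / (\<i> * of_real ?c)) has_field_derivative
                exp (\<i> * (of_real ?c * of_real t))) (at (of_real t))"
          by (rule exp_deriv) (use c in simp)
        from has_vector_derivative_real_field[OF this, of "{0..2 * pi}"]
        have "((\<lambda>t. exp (\<i> * (of_real ?c * of_real t)) / (\<i> * of_real ?c)) has_vector_derivative
                exp (\<i> * (of_real ?c * of_real t))) (at t within {0..2 * pi})" .
        then show "((\<lambda>t. cis (?c * t) / (\<i> * ?c)) has_vector_derivative cis (?c * t))
                (at t within {0..2 * pi})"
          by (simp add: cis_conv_exp)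
      qed simp
      moreover have "cis (?c * (2 * pi)) = 1"
        by (rule cis_multiple_2pi[of ?c, unfolded mult.commute[of "2 * pi"]]) simp
      ultimately show ?thesis by simp
    qed
    then show ?thesis
      unfolding fourier_coeff_def e by (cases "k = n") (auto dest: integral_unique simp: scaleR_conv_of_real)
  qed
  show ?thesis using S
  proof (induction S)
    case empty
    show ?case by (simp add: fourier_coeff_def)
  next
    case (insert k S)
    have "fourier_coeff (\<lambda>z. a k * z powi k + (\<Sum>k\<in>S. a k * z powi k)) n
        = a k * fourier_coeff (\<lambda>z. z powi k) n + fourier_coeff (\<lambda>z. \<Sum>k\<in>S. a k * z powi k) n"
      by (subst fourier_coeff_add) (auto intro!: continuous_intros simp: fourier_coeff_cmult)
    then show ?case using insert by (auto simp: mono)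
  qed
qed

lemma hardy_embed_dense:
  assumes r: "0 < r" "r < 1"
  shows "closure (hardy_embed r ` laurent_polys) = UNIV"
proof -
  have "x \<in> closure (hardy_embed r ` laurent_polys)" for x
    unfolding closure_approachable
  proof (intro allI impI)
    fix e :: real assume e: "e > 0"
    let ?s = "\<lambda>n. (cmod (ell2_nth x n))\<^sup>2"
    have "0 < e\<^sup>2 / 2" using e by simp
    from infsum_finite_approximation[OF ell2_nth_summable[of x] this]
    obtain F where F: "finite F" "dist (sum ?s F) (infsum ?s UNIV) \<le> e\<^sup>2 / 2"
      by (elim exE conjE)
    define f where "f = (\<lambda>z. \<Sum>k\<in>F. (ell2_nth x k / of_real (r ^ nat \<bar>k\<bar>)) * z powi k)"
    have f: "f \<in> laurent_polys"
      unfolding f_def laurent_polys_def mem_Collect_eq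
      by (rule exI[of _ F], rule exI[of _ "\<lambda>k. ell2_nth x k / of_real (r ^ nat \<bar>k\<bar>)"])
         (rule conjI[OF F(1) refl])
    have nth: "ell2_nth (hardy_embed r f) n = (if n \<in> F then ell2_nth x n else 0)" for n
      unfolding hardy_embed_nth[OF r continuous_on_laurent_poly[OF f]]
      unfolding f_def fourier_coeff_laurent_poly[OF F(1)] using r by simp
    have "(norm (hardy_embed r f - x))\<^sup>2 = infsum (\<lambda>n. if n \<in> F then 0 else ?s n) UNIV"
      by (simp add: norm_ell2_eq infsum_nonneg minus_ell2.rep_eq nth, intro infsum_cong) auto
    also have "\<dots> = infsum ?s (UNIV - F)"
      by (rule infsum_cong_neutral) auto
    also have "\<dots> = infsum ?s UNIV - sum ?s F"
      using infsum_Diff[OF ell2_nth_summable[of x], of F] F(1) by simp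
    also have "\<dots> \<le> e\<^sup>2 / 2" using F(2) unfolding dist_real_def by linarith
    also have "\<dots> < e\<^sup>2" using e by simp
    finally have "dist (hardy_embed r f) x < e"
      using e by (simp add: dist_norm power_less_imp_less_base)
    then show "\<exists>y\<in>hardy_embed r ` laurent_polys. dist y x < e" using f by blast
  qed
  then show ?thesis by blast
qed


section \<open>Bounded operators\<close>

text \<open>Bounded operators are elements of \<^typ>\<open>ell2 \<Rightarrow>\<^sub>L ell2\<close>, which are only real-linear.\<close>

definition complex_linear_op :: "(ell2 \<Rightarrow>\<^sub>L ell2) \<Rightarrow> bool" where
  "complex_linear_op T \<longleftrightarrow> (\<forall>c x. blinfun_apply T (cscale c x) = cscale c (blinfun_apply T x))"

lift_definition scalar_op :: "complex \<Rightarrow> (ell2 \<Rightarrow>\<^sub>L ell2)" is cscale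
  by (rule bounded_linear_cscale)

definition compact_operator :: "(ell2 \<Rightarrow>\<^sub>L ell2) \<Rightarrow> bool" where
  "compact_operator T \<longleftrightarrow> compact (closure (blinfun_apply T ` cball 0 1))"

definition is_inverse_op :: "(ell2 \<Rightarrow>\<^sub>L ell2) \<Rightarrow> (ell2 \<Rightarrow>\<^sub>L ell2) \<Rightarrow> bool" where
  "is_inverse_op S T \<longleftrightarrow> S o\<^sub>L T = id_blinfun \<and> T o\<^sub>L S = id_blinfun"

definition op_spectrum :: "(ell2 \<Rightarrow>\<^sub>L ell2) \<Rightarrow> complex set" where
  "op_spectrum T = {\<zeta>. \<not> (\<exists>S. is_inverse_op S (scalar_op \<zeta> - T))}"

definition resolvent :: "(ell2 \<Rightarrow>\<^sub>L ell2) \<Rightarrow> complex \<Rightarrow> (ell2 \<Rightarrow>\<^sub>L ell2)" where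
  "resolvent T \<zeta> = (THE S. is_inverse_op S (scalar_op \<zeta> - T))"

definition op_eigenvalue :: "(ell2 \<Rightarrow>\<^sub>L ell2) \<Rightarrow> complex \<Rightarrow> bool" where
  "op_eigenvalue T \<mu> \<longleftrightarrow> (\<exists>x. x \<noteq> 0 \<and> blinfun_apply T x = cscale \<mu> x)"

definition gen_eigenspace :: "(ell2 \<Rightarrow>\<^sub>L ell2) \<Rightarrow> complex \<Rightarrow> ell2 set" where
  "gen_eigenspace T \<mu> = {x. \<exists>\<nu>. (blinfun_apply (scalar_op \<mu> - T) ^^ \<nu>) x = 0}"

definition finite_alg_multiplicity :: "(ell2 \<Rightarrow>\<^sub>L ell2) \<Rightarrow> complex \<Rightarrow> bool" where
  "finite_alg_multiplicity T \<mu> \<longleftrightarrow>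
     (\<exists>B. finite B \<and> gen_eigenspace T \<mu> \<subseteq> Modules.module.span cscale B)"

text \<open>The integral is the one of \<^const>\<open>contour_integral\<close>, for operator-valued integrands. The
  circle encloses no spectral point besides \<open>\<mu>\<close> and does not meet the spectrum.\<close>

definition riesz_projection :: "(ell2 \<Rightarrow>\<^sub>L ell2) \<Rightarrow> complex \<Rightarrow> (ell2 \<Rightarrow>\<^sub>L ell2)" where
  "riesz_projection T \<mu> =
     (let \<rho> = SOME \<rho>. 0 < \<rho> \<and> op_spectrum T \<inter> cball \<mu> \<rho> = {\<mu>};
          \<gamma> = circlepath \<mu> \<rho>
      in scalar_op (1 / (2 * of_real pi * \<i>)) o\<^sub>L
         integral {0..1} (\<lambda>t. scalar_op (vector_derivative \<gamma> (at t within {0..1})) o\<^sub>L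
                              resolvent T (\<gamma> t)))"


section \<open>The Koopman operator\<close>

text \<open>\<open>is_koopman_op r \<tau> K\<close>: the operator \<open>K\<close> is the continuous linear extension of
  \<open>f \<mapsto> f \<circ> \<tau>\<close> from the Laurent polynomials to \<open>H\<^sup>2(A\<^sub>r\<^sup>c)\<close>; there is at most one.\<close>

definition is_koopman_op :: "real \<Rightarrow> (complex \<Rightarrow> complex) \<Rightarrow> (ell2 \<Rightarrow>\<^sub>L ell2) \<Rightarrow> bool" where
  "is_koopman_op r \<tau> K \<longleftrightarrow> complex_linear_op K \<and>
     (\<forall>f\<in>laurent_polys. blinfun_apply K (hardy_embed r f) = hardy_embed r (f \<circ> \<tau>))"

lemma is_koopman_op_unique:
  assumes r: "0 < r" "r < 1" and K: "is_koopman_op r \<tau> K" "is_koopman_op r \<tau> K'"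
  shows "K = K'"
proof (rule blinfun_eqI)
  fix x
  have "closure (hardy_embed r ` laurent_polys) \<subseteq> {x. blinfun_apply K x = blinfun_apply K' x}"
    using K unfolding is_koopman_op_def
    by (intro closure_minimal closed_Collect_eq continuous_intros) auto
  then show "blinfun_apply K x = blinfun_apply K' x" using hardy_embed_dense[OF r] by blast
qed

end

theory Submission
  imports Defs
begin

text \<open>In the normalised Laurent basis of \<open>H\<^sup>2(A\<^sub>r\<^sup>c)\<close> the Koopman operator has the matrix entries
  \<open>c\<^sub>k(\<tau>\<^sup>l) r\<^bsup>|k| - |l|\<^esup>\<close>. To first order, \<open>ln |\<tau>|\<close> grows away from the circle at a rate between
  \<open>\<tau>'\<^sub>m\<^sub>i\<^sub>n > 1\<close> and \<open>\<tau>'\<^sub>m\<^sub>a\<^sub>x\<close>; shifting contours into a thin annulus therefore makes the entries decay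
  exponentially in \<open>|k| + |l|\<close>. In particular the operator is a limit of its finite sections.

  For equidistant points the Gram matrix of the observables is the identity, and the entries of the transposed
  EDMD matrix are trapezoidal sums for the same Fourier coefficients. The lower bound on \<open>m\<close> makes the
  trapezoidal error \<open>O(R\<^bsup>(\<tau>'\<^sub>m\<^sub>a\<^sub>x + \<epsilon> + 1) n - m\<^esup>)\<close> in the weighted norm exponentially small in \<open>n\<close>, so that the
  EDMD matrices, extended by zero, converge to the Koopman operator in operator norm at an exponential rate.

  The rest is perturbation theory. Away from zero the spectrum of \<open>K\<close> is the zero set of a finite determinant
  depending holomorphically on the spectral parameter; those of the approximations converge uniformly, which
  gives convergence of the eigenvalues with an exponential rate. The spectral point zero is approximated since
  the decay of the entries makes the determinant of the EDMD matrix, hence one of its eigenvalues, small. For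
  generalised eigenvectors one compares the resolvents on a circle around the eigenvalue.\<close>


section \<open>Inverses of bounded operators\<close>

text \<open>The bound on \<open>m\<close> acts through one cancellation. With
  \<open>r = 1 / R\<close>, the trapezoidal error of the entry with indices \<open>k\<close>,
  \<open>l\<close> is of order \<open>R\<close> to the power \<open>q |l| + |k| - m\<close>, where
  \<open>q\<close> lies slightly above the maximal derivative. Passing to the weighted norm
  multiplies it by \<open>r\<close> to the power \<open>|k| - |l|\<close>: this removes
  \<open>|k|\<close> and turns \<open>q\<close> into \<open>q + 1\<close>. As
  \<open>|l| < n\<close>, it is enough that \<open>m\<close> exceeds \<open>(q + 1) n\<close> by a
  fixed multiple of \<open>n\<close>, and the minimal derivative exceeds 1 by such a margin.
  Expansion is thus used twice, for the decay of the Koopman matrix and for this margin. The space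
  must be fixed before \<open>\<alpha>\<close> and \<open>m\<close>, so the radius and all constants
  come from the map alone. The perturbation theory asks only for operators that are norm limits of
  their truncations \<open>P K\<close>. Then \<open>K - P K\<close> has no spectrum outside a small
  disc, and the spectrum of \<open>K\<close> there is read off a determinant whose size stays fixed
  while \<open>n\<close> grows. Zero escapes this argument: a matrix extended by zero always has it
  as an operator eigenvalue, which says nothing about the matrix.\<close>

lemma neumann_inverse:
  fixes T :: "'a::banach \<Rightarrow>\<^sub>L 'a"
  assumes T: "norm T < 1"
  obtains S :: "'a \<Rightarrow>\<^sub>L 'a" where "\<And>x. S (x - T x) = x" "\<And>y. S y - T (S y) = y"
proof -
  \<comment> \<open>\<open>x - T x = y\<close> is read as a fixed-point equation. Uniqueness of the
    fixed point then gives linearity of the solution map, with no series to sum.\<close>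
  have ex1: "\<exists>!x. y + T x = x" for y
  proof (rule banach_fix_type[of "norm T"])
    show "\<forall>x z. dist (y + T x) (y + T z) \<le> norm T * dist x z"
      by (simp add: dist_norm norm_blinfun flip: blinfun.diff_right)
  qed (use T in auto)
  define s where "s y = (THE x. y + T x = x)" for y
  have s: "y + T (s y) = s y" for y
    unfolding s_def using theI'[OF ex1[of y]] .
  have uniq: "s y = x" if "y + T x = x" for x y
    using ex1[of y] s[of y] that by blast
  have bound: "norm (s y) \<le> norm y * (1 / (1 - norm T))" for y
  proof -
    have "norm (s y) \<le> norm y + norm (T (s y))"
      using norm_triangle_ineq[of y "T (s y)"] s[of y] by simp
    also have "\<dots> \<le> norm y + norm T * norm (s y)" by (simp add: norm_blinfun)
    finally show ?thesis using T by (simp add: field_simps)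
  qed
  have lin: "bounded_linear s"
  proof (rule bounded_linear_intro[OF _ _ bound])
    show "s (x + y) = s x + s y" for x y
      by (rule uniq) (metis (no_types, lifting) add.assoc add.left_commute blinfun.add_right s)
    show "s (c *\<^sub>R x) = c *\<^sub>R s x" for c x
      by (rule uniq) (metis blinfun.scaleR_right s scaleR_add_right)
  qed
  show ?thesis
  proof (rule that[of "Blinfun s"])
    show "Blinfun s (x - T x) = x" for x
      unfolding bounded_linear_Blinfun_apply[OF lin] by (rule uniq) simp
    show "Blinfun s y - T (Blinfun s y) = y" for y
      unfolding bounded_linear_Blinfun_apply[OF lin] using s[of y] by (simp add: algebra_simps)
  qed
qed

lemma is_inverse_op_iff: "is_inverse_op S T \<longleftrightarrow> (\<forall>x. S (T x) = x) \<and> (\<forall>x. T (S x) = x)"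
proof -
  have "A = B \<longleftrightarrow> (\<forall>x. blinfun_apply A x = blinfun_apply B x)" for A B :: "ell2 \<Rightarrow>\<^sub>L ell2"
    by (auto intro: blinfun_eqI)
  then show ?thesis by (simp add: is_inverse_op_def)
qed

lemma is_inverse_op_unique: "is_inverse_op S T \<Longrightarrow> is_inverse_op S' T \<Longrightarrow> S = S'"
  unfolding is_inverse_op_iff by (intro blinfun_eqI) metis

text \<open>Since \<open>S T' = 1 - V\<close> with \<open>V = - S (T' - T)\<close>, a Neumann
  inverse of \<open>1 - V\<close> followed after \<open>S\<close> inverts \<open>T'\<close>. The
  smallness condition gives \<open>norm V \<le> 1 / 2\<close>, hence the factor 2, and the
  difference estimate comes from \<open>S - S' = S' (T' - T) S\<close>.\<close>

lemma is_inverse_op_perturb: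
  assumes S: "is_inverse_op S T" and small: "norm (T' - T) * norm S \<le> 1 / 2"
  obtains S' where "is_inverse_op S' T'" "norm S' \<le> 2 * norm S"
    "norm (S' - S) \<le> 2 * norm S * norm S * norm (T' - T)"
proof -
  define V where "V = - (S o\<^sub>L (T' - T))"
  have V: "norm V \<le> 1 / 2"
    using norm_blinfun_compose[of S "T' - T"] small by (simp add: V_def mult.commute)
  then have "norm V < 1" by simp
  then obtain U where U: "\<And>x. blinfun_apply U (x - V x) = x" "\<And>y. U y - V (U y) = y"
    by (rule neumann_inverse) blast
  define S' where "S' = U o\<^sub>L S"
  have T': "S (T' x) = x - V x" for x
    using S by (simp add: V_def is_inverse_op_iff blinfun.diff_left blinfun.diff_right blinfun.minus_left)
  have inv: "is_inverse_op S' T'"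
    unfolding is_inverse_op_iff
  proof (intro conjI allI)
    fix x
    show "S' (T' x) = x" by (simp add: S'_def T' U)
    have "S (T' (S' x)) = S x" by (simp add: T' S'_def U)
    then show "T' (S' x) = x" using S by (metis is_inverse_op_iff)
  qed
  have Sx: "S x = S' x + S' ((T' - T) (S x))" for x
  proof -
    have "(T' - T) (S x) = T' (S x) - x" using S by (simp add: is_inverse_op_iff blinfun.diff_left)
    then show ?thesis using inv by (simp add: is_inverse_op_iff blinfun.diff_right)
  qed
  have nS': "norm S' \<le> 2 * norm S"
  proof (rule norm_blinfun_bound)
    fix x
    have U_eq: "U (S x) = S x + V (U (S x))" using U(2)[of "S x"] by (simp add: algebra_simps)
    have "norm (U (S x)) \<le> norm (S x) + norm V * norm (U (S x))"
      by (subst U_eq) (metis norm_triangle_le norm_blinfun add_left_mono order_refl)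
    also have "\<dots> \<le> norm (S x) + 1 / 2 * norm (U (S x))"
      using V by (intro add_left_mono mult_right_mono) auto
    finally have "norm (U (S x)) \<le> 2 * norm (S x)" by simp
    also have "\<dots> \<le> 2 * (norm S * norm x)" using norm_blinfun[of S x] by simp
    finally show "norm (S' x) \<le> 2 * norm S * norm x" by (simp add: S'_def)
  qed simp
  moreover have "norm (S' - S) \<le> 2 * norm S * norm S * norm (T' - T)"
  proof (rule norm_blinfun_bound)
    fix x
    have "norm ((S' - S) x) = norm (S' ((T' - T) (S x)))"
      using Sx[of x] by (simp add: blinfun.diff_left norm_minus_commute algebra_simps)
        (metis add_diff_cancel_left' norm_minus_commute)
    also have "\<dots> \<le> norm S' * (norm (T' - T) * (norm S * norm x))"
      by (meson norm_blinfun mult_left_mono norm_ge_zero order_trans)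
    also have "\<dots> \<le> (2 * norm S) * (norm (T' - T) * (norm S * norm x))"
      by (intro mult_right_mono nS' mult_nonneg_nonneg) auto
    finally show "norm ((S' - S) x) \<le> 2 * norm S * norm S * norm (T' - T) * norm x"
      by (simp add: algebra_simps)
  qed simp
  ultimately show ?thesis using that inv by blast
qed


section \<open>Spectrum and resolvent\<close>

lemma cscale_simps:
  "cscale c (x + y) = cscale c x + cscale c y" "cscale c (x - y) = cscale c x - cscale c y"
  "cscale (c + d) x = cscale c x + cscale d x" "cscale (c - d) x = cscale c x - cscale d x"
  "cscale c (cscale d x) = cscale (c * d) x" "cscale 1 x = x" "cscale 0 x = 0" "cscale c 0 = 0"
  "cscale c (- x) = - cscale c x" "cscale (- c) x = - cscale c x"
  by (transfer; auto simp: algebra_simps fun_eq_iff)+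

lemma ell2_nth_simps:
  "ell2_nth (x + y) k = ell2_nth x k + ell2_nth y k" "ell2_nth (x - y) k = ell2_nth x k - ell2_nth y k"
  "ell2_nth 0 k = 0" "ell2_nth (cscale c x) k = c * ell2_nth x k" "ell2_nth (- x) k = - ell2_nth x k"
  by (simp_all add: plus_ell2.rep_eq minus_ell2.rep_eq zero_ell2.rep_eq cscale.rep_eq uminus_ell2.rep_eq)

lemma ell2_eqI: "(\<And>k. ell2_nth x k = ell2_nth y k) \<Longrightarrow> x = y"
  by (auto simp flip: ell2_nth_inject)

lemma scalar_op_apply [simp]: "scalar_op c x = cscale c x"
  by (simp add: scalar_op.rep_eq)

lemma norm_scalar_op_diff: "norm (scalar_op a - scalar_op b) \<le> cmod (a - b)"
  by (rule norm_blinfun_bound) (simp_all add: blinfun.diff_left norm_cscale flip: cscale_simps)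

lemma complex_linear_op_inverse:
  assumes "is_inverse_op S T" "complex_linear_op T"
  shows "complex_linear_op S"
  using assms unfolding is_inverse_op_iff complex_linear_op_def by metis

lemma complex_linear_op_scalar_minus:
  "complex_linear_op T \<Longrightarrow> complex_linear_op (scalar_op z - T)"
  by (simp add: complex_linear_op_def blinfun.diff_left cscale_simps mult.commute)

lemma resolvent_eq: "is_inverse_op S (scalar_op z - T) \<Longrightarrow> resolvent T z = S"
  unfolding resolvent_def by (blast intro: the_equality is_inverse_op_unique)

lemma is_inverse_op_resolvent:
  "z \<notin> op_spectrum T \<Longrightarrow> is_inverse_op (resolvent T z) (scalar_op z - T)"
  unfolding op_spectrum_def using resolvent_eq by blast

lemma resolvent_apply:
  assumes "z \<notin> op_spectrum T"
  shows "resolvent T z (cscale z x - T x) = x"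
    "cscale z (resolvent T z x) - T (resolvent T z x) = x"
  using is_inverse_op_resolvent[OF assms] by (auto simp: is_inverse_op_iff blinfun.diff_left)

lemma complex_linear_op_resolvent:
  "complex_linear_op T \<Longrightarrow> z \<notin> op_spectrum T \<Longrightarrow> complex_linear_op (resolvent T z)"
  using complex_linear_op_inverse is_inverse_op_resolvent complex_linear_op_scalar_minus by blast

text \<open>Operator and spectral parameter move together, because \<open>z - T\<close> only changes
  by at most \<open>cmod (w - z) + norm (T' - T)\<close>. With \<open>T' = T\<close> this yields
  openness of the resolvent set and continuity of the resolvent; with \<open>w = z\<close> it
  compares the approximating operators with the limit.\<close>

lemma resolvent_perturb:
  assumes "z \<notin> op_spectrum T" and "(cmod (w - z) + norm (T' - T)) * norm (resolvent T z) \<le> 1 / 2"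
  shows "w \<notin> op_spectrum T'" "norm (resolvent T' w) \<le> 2 * norm (resolvent T z)"
    "norm (resolvent T' w - resolvent T z)
       \<le> 2 * norm (resolvent T z) * norm (resolvent T z) * (cmod (w - z) + norm (T' - T))"
proof -
  have le: "norm ((scalar_op w - T') - (scalar_op z - T)) \<le> cmod (w - z) + norm (T' - T)"
  proof -
    have eq: "(scalar_op w - T') - (scalar_op z - T) = (scalar_op w - scalar_op z) - (T' - T)" by simp
    show ?thesis
      unfolding eq
      using norm_triangle_ineq4[of "scalar_op w - scalar_op z" "T' - T"] norm_scalar_op_diff[of w z]
      by linarith
  qed
  have small: "norm ((scalar_op w - T') - (scalar_op z - T)) * norm (resolvent T z) \<le> 1 / 2"
    using mult_right_mono[OF le norm_ge_zero] assms(2) by (rule order_trans)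
  obtain S' where S': "is_inverse_op S' (scalar_op w - T')" "norm S' \<le> 2 * norm (resolvent T z)"
    "norm (S' - resolvent T z) \<le> 2 * norm (resolvent T z) * norm (resolvent T z)
       * norm ((scalar_op w - T') - (scalar_op z - T))"
    using is_inverse_op_perturb[OF is_inverse_op_resolvent[OF assms(1)] small] by blast
  note eq = resolvent_eq[OF S'(1)]
  show "w \<notin> op_spectrum T'" using S'(1) by (auto simp: op_spectrum_def)
  show "norm (resolvent T' w) \<le> 2 * norm (resolvent T z)" using S'(2) eq by simp
  show "norm (resolvent T' w - resolvent T z)
       \<le> 2 * norm (resolvent T z) * norm (resolvent T z) * (cmod (w - z) + norm (T' - T))"
    unfolding eq by (rule order_trans[OF S'(3)]) (intro mult_left_mono le mult_nonneg_nonneg; simp)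
qed

lemma open_resolvent_set: "open (- op_spectrum T)"
  unfolding open_dist
proof (intro ballI)
  fix z assume z: "z \<in> - op_spectrum T"
  let ?N = "norm (resolvent T z)"
  have "w \<in> - op_spectrum T" if "dist w z < 1 / (2 * (?N + 1))" for w
  proof -
    have "cmod (w - z) * ?N \<le> 1 / (2 * (?N + 1)) * (?N + 1)"
      using that by (intro mult_mono) (auto simp: dist_norm)
    also have "\<dots> = 1 / 2" using norm_ge_zero[of "resolvent T z"] by (simp add: field_simps add_nonneg_eq_0_iff)
    finally show ?thesis using resolvent_perturb(1)[of z T w T] z by simp
  qed
  moreover have "0 < 1 / (2 * (?N + 1))" by (simp add: add_nonneg_pos)
  ultimately show "\<exists>e>0. \<forall>w. dist w z < e \<longrightarrow> w \<in> - op_spectrum T" by blast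
qed

lemma continuous_on_resolvent: "continuous_on (- op_spectrum T) (resolvent T)"
  unfolding continuous_on_def
proof (intro ballI)
  fix z assume z: "z \<in> - op_spectrum T"
  let ?N = "norm (resolvent T z)"
  have lim: "((\<lambda>w. c * (cmod (w - z) + norm (T - T))) \<longlongrightarrow> c * 0) (at z within - op_spectrum T)" for c
    by (auto intro!: tendsto_eq_intros)
  have "\<forall>\<^sub>F w in at z within - op_spectrum T. ?N * (cmod (w - z) + norm (T - T)) < 1 / 2"
    by (rule order_tendstoD(2)[OF lim[of ?N]]) simp
  then have ev: "\<forall>\<^sub>F w in at z within - op_spectrum T.
      norm (resolvent T w - resolvent T z) \<le> 2 * ?N * ?N * (cmod (w - z) + norm (T - T))"
  proof (rule eventually_mono)
    fix w assume "?N * (cmod (w - z) + norm (T - T)) < 1 / 2"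
    then have "(cmod (w - z) + norm (T - T)) * ?N \<le> 1 / 2" by (simp add: mult.commute)
    with z show "norm (resolvent T w - resolvent T z) \<le> 2 * ?N * ?N * (cmod (w - z) + norm (T - T))"
      by (intro resolvent_perturb(3)) auto
  qed
  have "((\<lambda>w. resolvent T w - resolvent T z) \<longlongrightarrow> 0) (at z within - op_spectrum T)"
    by (rule Lim_null_comparison[OF ev]) (use lim[of "2 * ?N * ?N"] in simp)
  then show "(resolvent T \<longlongrightarrow> resolvent T z) (at z within - op_spectrum T)"
    by (simp add: LIM_zero_iff)
qed

lemma resolvent_outside_norm:
  assumes z: "norm T < cmod z"
  shows "z \<notin> op_spectrum T" "norm (resolvent T z) \<le> 1 / (cmod z - norm T)"
proof -
  have z0: "z \<noteq> 0" using z by auto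
  define V where "V = scalar_op (1 / z) o\<^sub>L T"
  have "norm V \<le> norm T / cmod z"
    by (rule norm_blinfun_bound)
      (auto simp: V_def norm_cscale norm_divide divide_right_mono norm_blinfun)
  also have "\<dots> < 1" using z z0 by simp
  finally obtain U where U: "\<And>x. blinfun_apply U (x - V x) = x" "\<And>y. U y - V (U y) = y"
    by (rule neumann_inverse) blast
  have V: "cscale z x - T x = cscale z (x - V x)" for x
    using z0 by (simp add: V_def cscale_simps)
  have inv: "is_inverse_op (U o\<^sub>L scalar_op (1 / z)) (scalar_op z - T)"
    unfolding is_inverse_op_iff using z0 by (simp add: blinfun.diff_left V cscale_simps U)
  then show nin: "z \<notin> op_spectrum T" by (auto simp: op_spectrum_def)
  show "norm (resolvent T z) \<le> 1 / (cmod z - norm T)"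
  proof (rule norm_blinfun_bound)
    fix y
    let ?x = "resolvent T z y"
    have "cmod z * norm ?x = norm (y + T ?x)"
      using resolvent_apply(2)[OF nin, of y] by (metis diff_add_cancel norm_cscale)
    also have "\<dots> \<le> norm y + norm T * norm ?x"
      by (meson norm_triangle_le norm_blinfun add_left_mono)
    finally show "norm ?x \<le> 1 / (cmod z - norm T) * norm y"
      using z by (simp add: field_simps)
  qed (use z in simp)
qed

lemma op_eigenvalue_in_spectrum:
  assumes "x \<noteq> 0" "blinfun_apply T x = cscale z x"
  shows "z \<in> op_spectrum T"
  using resolvent_apply(1)[of z T x] assms by (auto simp: blinfun.zero_right)

section \<open>Operators given by matrices\<close>

lemma geometric_summable_int:
  fixes \<theta> :: real
  assumes "0 < \<theta>" "\<theta> < 1" shows "(\<lambda>k::int. \<theta> ^ nat \<bar>k\<bar>) summable_on UNIV"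
proof -
  have "(\<lambda>k::int. sqrt \<theta> ^ (2 * nat \<bar>k\<bar>)) summable_on UNIV"
    by (rule weights_summable) (use assms in auto)
  then show ?thesis using assms by (simp add: power_mult)
qed

text \<open>Geometric decay in both indices at once makes every row summable and every image square
  summable, so that the operator norm is at most \<open>C\<close> times a constant depending on
  \<open>\<theta>\<close> alone. Entrywise estimates thereby become operator norm estimates.\<close>

definition exp_bounded :: "real \<Rightarrow> real \<Rightarrow> (int \<Rightarrow> int \<Rightarrow> complex) \<Rightarrow> bool" where
  "exp_bounded C \<theta> a \<longleftrightarrow> 0 < \<theta> \<and> \<theta> < 1 \<and> (\<forall>k l. cmod (a k l) \<le> C * \<theta> ^ (nat \<bar>k\<bar> + nat \<bar>l\<bar>))"

definition matrix_op :: "(int \<Rightarrow> int \<Rightarrow> complex) \<Rightarrow> ell2 \<Rightarrow>\<^sub>L ell2" where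
  "matrix_op a = Blinfun (\<lambda>x. Abs_ell2 (\<lambda>k. \<Sum>\<^sub>\<infinity>l. a k l * ell2_nth x l))"

text \<open>The first factor pays for a row sum, each coordinate of \<open>x\<close> being bounded
  by \<open>norm x\<close>; the second is the norm of the resulting sequence of row bounds.\<close>

definition weight_const :: "real \<Rightarrow> real" where
  "weight_const \<theta> = (\<Sum>\<^sub>\<infinity>l::int. \<theta> ^ nat \<bar>l\<bar>) * sqrt (\<Sum>\<^sub>\<infinity>k::int. \<theta> ^ (2 * nat \<bar>k\<bar>))"

lemma exp_bounded_nonneg: "exp_bounded C \<theta> a \<Longrightarrow> 0 \<le> C"
  unfolding exp_bounded_def using order_trans[OF norm_ge_zero[of "a 0 0"]] by fastforce

lemma exp_bounded_row_summable:
  assumes a: "exp_bounded C \<theta> a"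
  shows "(\<lambda>l. norm (a k l * ell2_nth x l)) summable_on UNIV"
    "cmod (\<Sum>\<^sub>\<infinity>l. a k l * ell2_nth x l) \<le> C * \<theta> ^ nat \<bar>k\<bar> * (\<Sum>\<^sub>\<infinity>l::int. \<theta> ^ nat \<bar>l\<bar>) * norm x"
proof -
  note th = a[unfolded exp_bounded_def]
  have le: "norm (a k l * ell2_nth x l) \<le> (C * \<theta> ^ nat \<bar>k\<bar> * norm x) * \<theta> ^ nat \<bar>l\<bar>" for l
  proof -
    have "norm (a k l * ell2_nth x l) \<le> C * \<theta> ^ (nat \<bar>k\<bar> + nat \<bar>l\<bar>) * norm x"
      unfolding norm_mult using th exp_bounded_nonneg[OF a]
      by (intro mult_mono ell2_nth_le mult_nonneg_nonneg) auto
    then show ?thesis by (simp add: power_add mult_ac)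
  qed
  have s: "(\<lambda>l::int. (C * \<theta> ^ nat \<bar>k\<bar> * norm x) * \<theta> ^ nat \<bar>l\<bar>) summable_on UNIV"
    using th by (intro summable_on_cmult_right geometric_summable_int) auto
  show abs: "(\<lambda>l. norm (a k l * ell2_nth x l)) summable_on UNIV"
    by (rule summable_on_comparison_test[OF s]) (use le in auto)
  have "cmod (\<Sum>\<^sub>\<infinity>l. a k l * ell2_nth x l) \<le> (\<Sum>\<^sub>\<infinity>l. norm (a k l * ell2_nth x l))"
    by (rule norm_infsum_bound[OF abs])
  also have "\<dots> \<le> (\<Sum>\<^sub>\<infinity>l::int. (C * \<theta> ^ nat \<bar>k\<bar> * norm x) * \<theta> ^ nat \<bar>l\<bar>)"
    by (rule infsum_mono[OF abs s]) (use le in auto)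
  also have "\<dots> = C * \<theta> ^ nat \<bar>k\<bar> * (\<Sum>\<^sub>\<infinity>l::int. \<theta> ^ nat \<bar>l\<bar>) * norm x"
    by (simp add: infsum_cmult_right')
  finally show "cmod (\<Sum>\<^sub>\<infinity>l. a k l * ell2_nth x l) \<le> C * \<theta> ^ nat \<bar>k\<bar> * (\<Sum>\<^sub>\<infinity>l::int. \<theta> ^ nat \<bar>l\<bar>) * norm x" .
qed

lemma matrix_op_bounded_linear:
  assumes a: "exp_bounded C \<theta> a"
  defines "f \<equiv> \<lambda>x. Abs_ell2 (\<lambda>k. \<Sum>\<^sub>\<infinity>l. a k l * ell2_nth x l)"
  shows "ell2_nth (f x) k = (\<Sum>\<^sub>\<infinity>l. a k l * ell2_nth x l)"
    "norm (f x) \<le> norm x * (C * weight_const \<theta>)" "bounded_linear f"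
proof -
  note th = a[unfolded exp_bounded_def]
  define D where "D = C * (\<Sum>\<^sub>\<infinity>l::int. \<theta> ^ nat \<bar>l\<bar>)"
  have D0: "0 \<le> D"
    unfolding D_def using th exp_bounded_nonneg[OF a] by (intro mult_nonneg_nonneg infsum_nonneg) auto
  have le: "(cmod (\<Sum>\<^sub>\<infinity>l. a k l * ell2_nth x l))\<^sup>2 \<le> (D * norm x)\<^sup>2 * \<theta> ^ (2 * nat \<bar>k\<bar>)" for k x
  proof -
    have "(cmod (\<Sum>\<^sub>\<infinity>l. a k l * ell2_nth x l))\<^sup>2 \<le> (D * norm x * \<theta> ^ nat \<bar>k\<bar>)\<^sup>2"
      using exp_bounded_row_summable(2)[OF a, of k x]
      by (intro power_mono) (auto simp: D_def mult_ac)
    then show ?thesis by (simp add: power_mult_distrib power_mult[symmetric] mult.commute)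
  qed
  have s: "(\<lambda>k::int. (D * norm x)\<^sup>2 * \<theta> ^ (2 * nat \<bar>k\<bar>)) summable_on UNIV" for x :: ell2
    using th by (intro summable_on_cmult_right weights_summable) auto
  have sum: "(\<lambda>k. (cmod (\<Sum>\<^sub>\<infinity>l. a k l * ell2_nth x l))\<^sup>2) summable_on UNIV" for x
    by (rule summable_on_comparison_test[OF s[of x]]) (use le in auto)
  show nth: "ell2_nth (f x) k = (\<Sum>\<^sub>\<infinity>l. a k l * ell2_nth x l)" for x k
    unfolding f_def using sum[of x] by (simp add: Abs_ell2_inverse)
  show bound: "norm (f x) \<le> norm x * (C * weight_const \<theta>)" for x
  proof -
    have "norm (f x) \<le> sqrt (\<Sum>\<^sub>\<infinity>k::int. (D * norm x)\<^sup>2 * \<theta> ^ (2 * nat \<bar>k\<bar>))"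
      unfolding norm_ell2_eq[of "f x"] nth by (intro real_sqrt_le_mono infsum_mono sum s le)
    also have "\<dots> = D * norm x * sqrt (\<Sum>\<^sub>\<infinity>k::int. \<theta> ^ (2 * nat \<bar>k\<bar>))"
      using D0 by (simp add: infsum_cmult_right' real_sqrt_mult)
    finally show ?thesis by (simp add: D_def weight_const_def mult_ac)
  qed
  note summ = abs_summable_summable[OF exp_bounded_row_summable(1)[OF a]]
  show "bounded_linear f"
  proof (rule bounded_linear_intro[OF _ _ bound])
    show "f (x + y) = f x + f y" for x y
      by (rule ell2_eqI) (simp add: nth ell2_nth_simps distrib_left infsum_add summ)
    show "f (c *\<^sub>R x) = c *\<^sub>R f x" for c x
      by (rule ell2_eqI)
        (simp add: nth scaleR_ell2.rep_eq scaleR_conv_of_real mult.left_commute infsum_cmult_right')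
  qed
qed

lemma matrix_op_nth:
  assumes "exp_bounded C \<theta> a"
  shows "ell2_nth (matrix_op a x) k = (\<Sum>\<^sub>\<infinity>l. a k l * ell2_nth x l)"
  using matrix_op_bounded_linear[OF assms] unfolding matrix_op_def by (simp add: bounded_linear_Blinfun_apply)

lemma weight_const_nonneg: "0 < \<theta> \<Longrightarrow> 0 \<le> weight_const \<theta>"
  unfolding weight_const_def by (intro mult_nonneg_nonneg infsum_nonneg real_sqrt_ge_zero) auto

lemma norm_matrix_op:
  assumes "exp_bounded C \<theta> a" shows "norm (matrix_op a) \<le> C * weight_const \<theta>"
  using matrix_op_bounded_linear[OF assms] exp_bounded_nonneg[OF assms] assms
  by (intro norm_blinfun_bound mult_nonneg_nonneg weight_const_nonneg)
     (auto simp: matrix_op_def bounded_linear_Blinfun_apply mult.commute exp_bounded_def)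

lemma complex_linear_matrix_op:
  assumes "exp_bounded C \<theta> a" shows "complex_linear_op (matrix_op a)"
  unfolding complex_linear_op_def
  by (intro allI ell2_eqI)
    (simp add: matrix_op_nth[OF assms] ell2_nth_simps mult.left_commute infsum_cmult_right')

lemma exp_bounded_diff:
  assumes "exp_bounded C \<theta> a" "exp_bounded D \<theta> b"
  shows "exp_bounded (C + D) \<theta> (\<lambda>k l. a k l - b k l)"
  unfolding exp_bounded_def
proof (intro conjI allI)
  fix k l
  have "cmod (a k l - b k l) \<le> cmod (a k l) + cmod (b k l)" by (rule norm_triangle_ineq4)
  also have "\<dots> \<le> C * \<theta> ^ (nat \<bar>k\<bar> + nat \<bar>l\<bar>) + D * \<theta> ^ (nat \<bar>k\<bar> + nat \<bar>l\<bar>)"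
    using assms by (intro add_mono) (auto simp: exp_bounded_def)
  finally show "cmod (a k l - b k l) \<le> (C + D) * \<theta> ^ (nat \<bar>k\<bar> + nat \<bar>l\<bar>)" by (simp add: distrib_right)
qed (use assms in \<open>auto simp: exp_bounded_def\<close>)

lemma exp_bounded_mono:
  assumes a: "exp_bounded C \<theta> a" and "C \<le> D" "\<theta> \<le> \<eta>" "\<eta> < 1"
  shows "exp_bounded D \<eta> a"
  unfolding exp_bounded_def
proof (intro conjI allI)
  fix k l
  have "cmod (a k l) \<le> C * \<theta> ^ (nat \<bar>k\<bar> + nat \<bar>l\<bar>)" using a by (simp add: exp_bounded_def)
  also have "\<dots> \<le> D * \<eta> ^ (nat \<bar>k\<bar> + nat \<bar>l\<bar>)"
    using assms exp_bounded_nonneg[OF a] by (intro mult_mono power_mono) (auto simp: exp_bounded_def)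
  finally show "cmod (a k l) \<le> D * \<eta> ^ (nat \<bar>k\<bar> + nat \<bar>l\<bar>)" .
qed (use assms in \<open>auto simp: exp_bounded_def\<close>)

text \<open>Two rates are allowed since a finite matrix extended by zero comes with the generic rate
  \<open>1 / 2\<close>, unrelated to the rate of the Koopman matrix.\<close>

lemma matrix_op_diff:
  assumes "exp_bounded C \<theta> a" "exp_bounded D \<eta> b"
  shows "matrix_op a - matrix_op b = matrix_op (\<lambda>k l. a k l - b k l)"
proof -
  define \<zeta> where "\<zeta> = max \<theta> \<eta>"
  have a: "exp_bounded C \<zeta> a" and b: "exp_bounded D \<zeta> b"
    using exp_bounded_mono[OF assms(1), of C \<zeta>] exp_bounded_mono[OF assms(2), of D \<zeta>] assms
    by (auto simp: \<zeta>_def exp_bounded_def)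
  note ab = exp_bounded_diff[OF a b]
  show ?thesis
  proof (intro blinfun_eqI ell2_eqI)
    fix x k
    have "(\<Sum>\<^sub>\<infinity>l. a k l * ell2_nth x l)
        = (\<Sum>\<^sub>\<infinity>l. (a k l - b k l) * ell2_nth x l + b k l * ell2_nth x l)"
      by (simp add: algebra_simps)
    also have "\<dots> = (\<Sum>\<^sub>\<infinity>l. (a k l - b k l) * ell2_nth x l) + (\<Sum>\<^sub>\<infinity>l. b k l * ell2_nth x l)"
      by (rule infsum_add[OF abs_summable_summable[OF exp_bounded_row_summable(1)[OF ab]]
            abs_summable_summable[OF exp_bounded_row_summable(1)[OF b]]])
    finally show "ell2_nth ((matrix_op a - matrix_op b) x) k
        = ell2_nth (matrix_op (\<lambda>k l. a k l - b k l) x) k"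
      by (simp add: blinfun.diff_left ell2_nth_simps matrix_op_nth[OF a] matrix_op_nth[OF b]
          matrix_op_nth[OF ab])
  qed
qed


section \<open>Finite sections\<close>

lemma obs_index_nat: "\<bar>k\<bar> < int n \<Longrightarrow> nat (k + (int n - 1)) < 2 * n - 1"
  "\<bar>k\<bar> < int n \<Longrightarrow> obs_index n (nat (k + (int n - 1))) = k"
  "j < 2 * n - 1 \<Longrightarrow> \<bar>obs_index n j\<bar> < int n"
  "j < 2 * n - 1 \<Longrightarrow> nat (obs_index n j + (int n - 1)) = j"
  by (auto simp: obs_index_def)

lemma bij_betw_obs_index: "bij_betw (obs_index n) {0..<2 * n - 1} {k. \<bar>k\<bar> < int n}"
  by (rule bij_betwI[where g = "\<lambda>k. nat (k + (int n - 1))"]) (auto simp: obs_index_nat)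

lift_definition emb_vec :: "nat \<Rightarrow> complex Matrix.vec \<Rightarrow> ell2"
  is "\<lambda>n (v :: complex Matrix.vec) k. if \<bar>k\<bar> < int n then v $ nat (k + (int n - 1)) else 0"
proof -
  fix n and v :: "complex Matrix.vec"
  have "(\<lambda>k. (cmod (if \<bar>k\<bar> < int n then v $ nat (k + (int n - 1)) else 0))\<^sup>2) summable_on {k. \<bar>k\<bar> < int n}"
    by (rule summable_on_finite) (metis bij_betw_finite bij_betw_obs_index finite_atLeastLessThan)
  then show "(\<lambda>k. (cmod (if \<bar>k\<bar> < int n then v $ nat (k + (int n - 1)) else 0))\<^sup>2) summable_on UNIV"
    by (rule summable_on_cong_neutral[THEN iffD1, rotated -1]) auto
qed

definition section_vec :: "nat \<Rightarrow> ell2 \<Rightarrow> complex Matrix.vec" where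
  "section_vec n x = Matrix.vec (2 * n - 1) (\<lambda>j. ell2_nth x (obs_index n j))"

lemma section_vec_carrier: "section_vec n x \<in> carrier_vec (2 * n - 1)"
  by (simp add: section_vec_def)

lemma section_vec_emb_vec: "v \<in> carrier_vec (2 * n - 1) \<Longrightarrow> section_vec n (emb_vec n v) = v"
  by (rule eq_vecI) (auto simp: section_vec_def emb_vec.rep_eq obs_index_nat)

lemma emb_vec_section_vec_nth: "ell2_nth (emb_vec n (section_vec n x)) k = (if \<bar>k\<bar> < int n then ell2_nth x k else 0)"
  by (auto simp: section_vec_def emb_vec.rep_eq obs_index_nat)

lemma emb_vec_add:
  assumes "v \<in> carrier_vec (2 * n - 1)" "w \<in> carrier_vec (2 * n - 1)"
  shows "emb_vec n (v + w) = emb_vec n v + emb_vec n w"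
  using assms by (intro ell2_eqI) (auto simp: emb_vec.rep_eq ell2_nth_simps obs_index_nat)

lemma emb_vec_smult:
  assumes "v \<in> carrier_vec (2 * n - 1)"
  shows "emb_vec n (c \<cdot>\<^sub>v v) = cscale c (emb_vec n v)"
  using assms by (intro ell2_eqI) (auto simp: emb_vec.rep_eq ell2_nth_simps obs_index_nat)

lemma emb_vec_zero: "emb_vec n (0\<^sub>v (2 * n - 1)) = 0"
  by (intro ell2_eqI) (auto simp: emb_vec.rep_eq ell2_nth_simps obs_index_nat)

lemma emb_vec_minus:
  assumes "v \<in> carrier_vec (2 * n - 1)" "w \<in> carrier_vec (2 * n - 1)"
  shows "emb_vec n (v - w) = emb_vec n v - emb_vec n w"
  using assms by (intro ell2_eqI) (auto simp: emb_vec.rep_eq ell2_nth_simps obs_index_nat)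

lemma section_vec_add: "section_vec n (x + y) = section_vec n x + section_vec n y"
  by (rule eq_vecI) (auto simp: section_vec_def ell2_nth_simps)

lemma section_vec_minus: "section_vec n (x - y) = section_vec n x - section_vec n y"
  by (rule eq_vecI) (auto simp: section_vec_def ell2_nth_simps)

lemma finite_section: "finite {k. \<bar>k\<bar> < int n}"
  by (metis bij_betw_finite bij_betw_obs_index finite_atLeastLessThan)

definition block_matrix :: "nat \<Rightarrow> complex mat \<Rightarrow> int \<Rightarrow> int \<Rightarrow> complex" where
  "block_matrix n X k l = (if \<bar>k\<bar> < int n \<and> \<bar>l\<bar> < int n
     then X $$ (nat (k + (int n - 1)), nat (l + (int n - 1))) else 0)"

text \<open>Only boundedness of the operator is at stake: the constant depends on \<open>n\<close>
  and on the matrix, and uniform estimates come from comparison with the Koopman matrix. The factor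
  \<open>2 ^ (2 * n)\<close> outweighs the smallest value of the weight on the block.\<close>

lemma exp_bounded_block_matrix: "\<exists>C. exp_bounded C (1 / 2) (block_matrix n X)"
proof -
  let ?I = "{k. \<bar>k\<bar> < int n}"
  define S where "S = (\<Sum>p\<in>?I \<times> ?I. cmod (block_matrix n X (fst p) (snd p)))"
  have le: "cmod (block_matrix n X k l) \<le> (S * 2 ^ (2 * n)) * (1 / 2) ^ (nat \<bar>k\<bar> + nat \<bar>l\<bar>)" for k l
  proof (cases "\<bar>k\<bar> < int n \<and> \<bar>l\<bar> < int n")
    case True
    have "cmod (block_matrix n X k l) \<le> S"
      unfolding S_def using True finite_section[of n]
      by (intro member_le_sum[where i = "(k, l)" and f = "\<lambda>p. cmod (block_matrix n X (fst p) (snd p))", simplified]) auto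
    moreover have "(1::real) \<le> 2 ^ (2 * n) * (1 / 2) ^ (nat \<bar>k\<bar> + nat \<bar>l\<bar>)"
    proof -
      have "(2::real) ^ (nat \<bar>k\<bar> + nat \<bar>l\<bar>) \<le> 2 ^ (2 * n)" using True by (intro power_increasing) auto
      then show ?thesis by (simp add: power_one_over field_simps)
    qed
    moreover have "0 \<le> S" unfolding S_def by (intro sum_nonneg) auto
    ultimately show ?thesis using mult_mono[of "cmod (block_matrix n X k l)" S 1 "2 ^ (2 * n) * (1 / 2) ^ (nat \<bar>k\<bar> + nat \<bar>l\<bar>)"]
      by (simp add: mult.assoc)
  next
    case False
    moreover have "0 \<le> S" unfolding S_def by (intro sum_nonneg) auto
    ultimately show ?thesis by (auto simp: block_matrix_def)
  qed
  show ?thesis by (rule exI[of _ "S * 2 ^ (2 * n)"]) (use le in \<open>simp add: exp_bounded_def\<close>)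
qed

lemma block_op_eq:
  assumes X: "X \<in> carrier_mat (2 * n - 1) (2 * n - 1)"
  shows "matrix_op (block_matrix n X) x = emb_vec n (X *\<^sub>v section_vec n x)"
proof (rule ell2_eqI)
  fix k
  obtain C where C: "exp_bounded C (1 / 2) (block_matrix n X)" using exp_bounded_block_matrix by blast
  have "ell2_nth (matrix_op (block_matrix n X) x) k = (\<Sum>\<^sub>\<infinity>l. block_matrix n X k l * ell2_nth x l)"
    by (rule matrix_op_nth[OF C])
  also have "\<dots> = (\<Sum>\<^sub>\<infinity>l\<in>{l. \<bar>l\<bar> < int n}. block_matrix n X k l * ell2_nth x l)"
    by (rule infsum_cong_neutral) (auto simp: block_matrix_def)
  also have "\<dots> = (\<Sum>l\<in>{l. \<bar>l\<bar> < int n}. block_matrix n X k l * ell2_nth x l)"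
    by (simp add: finite_section)
  also have "\<dots> = (\<Sum>j\<in>{0..<2 * n - 1}. block_matrix n X k (obs_index n j) * ell2_nth x (obs_index n j))"
    by (rule sum.reindex_bij_betw[OF bij_betw_obs_index, symmetric])
  also have "\<dots> = ell2_nth (emb_vec n (X *\<^sub>v section_vec n x)) k"
    using X by (auto simp: emb_vec.rep_eq block_matrix_def obs_index_nat scalar_prod_def section_vec_def
        intro!: sum.cong)
  finally show "ell2_nth (matrix_op (block_matrix n X) x) k = ell2_nth (emb_vec n (X *\<^sub>v section_vec n x)) k" .
qed

definition truncation :: "nat \<Rightarrow> ell2 \<Rightarrow>\<^sub>L ell2" where
  "truncation n = matrix_op (block_matrix n (1\<^sub>m (2 * n - 1)))"

lemma truncation_eq: "truncation n x = emb_vec n (section_vec n x)"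
  unfolding truncation_def block_op_eq[OF one_carrier_mat] one_mult_mat_vec[OF section_vec_carrier] ..

lemma truncation_nth: "ell2_nth (truncation n x) k = (if \<bar>k\<bar> < int n then ell2_nth x k else 0)"
  by (simp add: truncation_eq emb_vec_section_vec_nth)

lemma norm_truncation_compl: "norm (x - truncation n x) \<le> norm x"
  unfolding norm_ell2_eq
  by (intro real_sqrt_le_mono infsum_mono ell2_nth_summable) (auto simp: ell2_nth_simps truncation_nth)

text \<open>Only rows with \<open>|k| \<ge> n\<close> remain. Writing the decay as a product of two
  equal halves, one half gives the rate \<open>sqrt \<theta> ^ n\<close> and the other keeps the
  matrix exponentially bounded.\<close>

lemma norm_matrix_op_minus_truncation:
  assumes a: "exp_bounded C \<theta> a"
  shows "norm (matrix_op a - (truncation n o\<^sub>L matrix_op a)) \<le> C * weight_const (sqrt \<theta>) * sqrt \<theta> ^ n"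
proof -
  define b where "b k l = (if \<bar>k\<bar> < int n then 0 else a k l)" for k l
  note th = a[unfolded exp_bounded_def]
  note C = exp_bounded_nonneg[OF a]
  have b: "exp_bounded (C * sqrt \<theta> ^ n) (sqrt \<theta>) b"
    unfolding exp_bounded_def
  proof (intro conjI allI)
    fix k l
    show "cmod (b k l) \<le> C * sqrt \<theta> ^ n * sqrt \<theta> ^ (nat \<bar>k\<bar> + nat \<bar>l\<bar>)"
    proof (cases "\<bar>k\<bar> < int n")
      case True
      then show ?thesis using C th by (simp add: b_def)
    next
      case False
      then have "cmod (b k l) \<le> C * \<theta> ^ (nat \<bar>k\<bar> + nat \<bar>l\<bar>)" using th by (simp add: b_def)
      also have "\<theta> ^ (nat \<bar>k\<bar> + nat \<bar>l\<bar>) = sqrt \<theta> ^ (nat \<bar>k\<bar> + nat \<bar>l\<bar>) * sqrt \<theta> ^ (nat \<bar>k\<bar> + nat \<bar>l\<bar>)"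
        using th by (simp flip: power_mult_distrib)
      also have "C * (sqrt \<theta> ^ (nat \<bar>k\<bar> + nat \<bar>l\<bar>) * sqrt \<theta> ^ (nat \<bar>k\<bar> + nat \<bar>l\<bar>))
         \<le> C * (sqrt \<theta> ^ n * sqrt \<theta> ^ (nat \<bar>k\<bar> + nat \<bar>l\<bar>))"
        using th C False by (intro mult_left_mono mult_right_mono power_decreasing) auto
      finally show ?thesis by simp
    qed
  qed (use th in auto)
  have "matrix_op a - (truncation n o\<^sub>L matrix_op a) = matrix_op b"
    by (intro blinfun_eqI ell2_eqI)
      (auto simp: blinfun.diff_left ell2_nth_simps truncation_nth matrix_op_nth[OF a] matrix_op_nth[OF b] b_def)
  then show ?thesis using norm_matrix_op[OF b] by (simp add: mult_ac)
qed

section \<open>Compactness\<close>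

lift_definition ell2_unit :: "int \<Rightarrow> ell2" is "\<lambda>k j. if j = k then 1 else 0"
proof -
  fix k :: int
  have "(\<lambda>j. (cmod (if j = k then 1 else 0))\<^sup>2) summable_on {k}" by simp
  then show "(\<lambda>j. (cmod (if j = k then 1 else 0))\<^sup>2) summable_on UNIV"
    by (rule summable_on_cong_neutral[THEN iffD1, rotated -1]) auto
qed

lemma bounded_linear_cscale_left: "bounded_linear (\<lambda>c. cscale c x)"
  by (rule bounded_linear_intro[where K = "norm x"])
    (auto simp: cscale_simps norm_cscale scaleR_conv_of_real intro!: ell2_eqI
      simp: ell2_nth_simps scaleR_ell2.rep_eq)

text \<open>Each new coordinate adds a one-dimensional closed disc as a Minkowski summand, and sums
  of compact sets are compact.\<close>

lemma compact_finite_box: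
  assumes "finite F"
  shows "compact {x. (\<forall>k\<in>F. cmod (ell2_nth x k) \<le> B) \<and> (\<forall>k. k \<notin> F \<longrightarrow> ell2_nth x k = 0)}"
  using assms
proof (induction F)
  case empty
  have "{x. \<forall>k. ell2_nth x k = 0} = {0}"
    by (auto simp: ell2_nth_simps intro!: ell2_eqI)
  then show ?case by simp
next
  case (insert k F)
  let ?Q = "\<lambda>F. {x. (\<forall>k\<in>F. cmod (ell2_nth x k) \<le> B) \<and> (\<forall>k. k \<notin> F \<longrightarrow> ell2_nth x k = 0)}"
  let ?L = "(\<lambda>c. cscale c (ell2_unit k)) ` cball 0 B"
  have "compact ?L"
    by (intro compact_continuous_image linear_continuous_on bounded_linear_cscale_left compact_cball)
  then have c: "compact {x + y |x y. x \<in> ?L \<and> y \<in> ?Q F}"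
    using insert.IH by (rule compact_sums)
  have "?Q (insert k F) = {x + y |x y. x \<in> ?L \<and> y \<in> ?Q F}"
  proof (intro equalityI subsetI)
    fix x assume x: "x \<in> ?Q (insert k F)"
    let ?l = "cscale (ell2_nth x k) (ell2_unit k)"
    have "?l \<in> ?L" using x by auto
    moreover have "x - ?l \<in> ?Q F"
      using x insert.hyps by (auto simp: ell2_nth_simps ell2_unit.rep_eq)
    moreover have "x = ?l + (x - ?l)" by simp
    ultimately show "x \<in> {x + y |x y. x \<in> ?L \<and> y \<in> ?Q F}" by blast
  next
    fix x assume "x \<in> {x + y |x y. x \<in> ?L \<and> y \<in> ?Q F}"
    then show "x \<in> ?Q (insert k F)"
      using insert.hyps by (auto simp: ell2_nth_simps ell2_unit.rep_eq)
  qed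
  then show ?case using c by simp
qed

text \<open>The truncated image of the unit ball lies in a compact box, hence has a finite
  \<open>e / 4\<close>-net. The truncation error is another \<open>e / 4\<close>; closed balls of
  radius \<open>e / 2\<close> then cover the image together with its closure.\<close>

lemma compact_operator_if_truncation_close:
  assumes "\<And>e. 0 < e \<Longrightarrow> \<exists>N. norm (T - (truncation N o\<^sub>L T)) < e"
  shows "compact_operator T"
  unfolding compact_operator_def compact_eq_totally_bounded
proof (intro conjI allI impI)
  show "complete (closure (blinfun_apply T ` cball 0 1))"
    by (simp add: complete_eq_closed)
  fix e :: real assume e: "0 < e"
  then obtain N where N: "norm (T - (truncation N o\<^sub>L T)) < e / 4" using assms[of "e / 4"] by auto
  let ?F = "{k. \<bar>k\<bar> < int N}"
  define Q where "Q = {x. (\<forall>k\<in>?F. cmod (ell2_nth x k) \<le> norm T) \<and> (\<forall>k. k \<notin> ?F \<longrightarrow> ell2_nth x k = 0)}"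
  have "compact Q" unfolding Q_def by (rule compact_finite_box[OF finite_section])
  then obtain C where C: "finite C" "Q \<subseteq> (\<Union>x\<in>C. ball x (e / 4))"
    unfolding compact_eq_totally_bounded using e by (meson zero_less_divide_iff zero_less_numeral)
  have "T x \<in> (\<Union>c\<in>C. cball c (e / 2))" if x: "norm x \<le> 1" for x
  proof -
    have "norm (T x) \<le> norm T" using norm_blinfun[of T x] mult_left_mono[OF x norm_ge_zero[of T]] by simp
    then have "truncation N (T x) \<in> Q"
      by (auto simp: Q_def truncation_nth intro: order_trans[OF ell2_nth_le])
    then obtain c where c: "c \<in> C" "dist c (truncation N (T x)) < e / 4" using C by auto
    have "norm (T x - truncation N (T x)) \<le> norm (T - (truncation N o\<^sub>L T)) * norm x"
      using norm_blinfun[of "T - (truncation N o\<^sub>L T)" x] by (simp add: blinfun.diff_left)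
    also have "\<dots> \<le> norm (T - (truncation N o\<^sub>L T)) * 1" by (intro mult_left_mono x) auto
    finally have "dist (truncation N (T x)) (T x) < e / 4" using N by (simp add: dist_norm norm_minus_commute)
    then have "dist c (T x) \<le> e / 2" using c(2) dist_triangle[of c "T x" "truncation N (T x)"] by linarith
    then show ?thesis using c(1) by auto
  qed
  then have "blinfun_apply T ` cball 0 1 \<subseteq> (\<Union>c\<in>C. cball c (e / 2))" by auto
  moreover have "closed (\<Union>c\<in>C. cball c (e / 2))" using C(1) by (intro closed_UN) auto
  ultimately have "closure (blinfun_apply T ` cball 0 1) \<subseteq> (\<Union>c\<in>C. cball c (e / 2))"
    by (rule closure_minimal)
  also have "\<dots> \<subseteq> (\<Union>c\<in>C. ball c e)" using e by auto
  finally show "\<exists>k. finite k \<and> closure (blinfun_apply T ` cball 0 1) \<subseteq> (\<Union>x\<in>k. ball x e)"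
    using C(1) by blast
qed


section \<open>The Fredholm determinant of a finite section\<close>

definition compression :: "nat \<Rightarrow> (ell2 \<Rightarrow>\<^sub>L ell2) \<Rightarrow> complex mat" where
  "compression N G = Matrix.mat (2 * N - 1) (2 * N - 1)
     (\<lambda>(i, j). ell2_nth (G (emb_vec N (unit_vec (2 * N - 1) j))) (obs_index N i))"

lemma compression_carrier: "compression N G \<in> carrier_mat (2 * N - 1) (2 * N - 1)"
  by (simp add: compression_def)

lemma ell2_nth_sum: "ell2_nth (sum f S) k = (\<Sum>i\<in>S. ell2_nth (f i) k)"
  by (induction S rule: infinite_finite_induct) (auto simp: ell2_nth_simps)

lemma emb_vec_expand:
  assumes "v \<in> carrier_vec (2 * N - 1)"
  shows "emb_vec N v = (\<Sum>j<2 * N - 1. cscale (v $ j) (emb_vec N (unit_vec (2 * N - 1) j)))"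
proof (rule ell2_eqI)
  fix k
  show "ell2_nth (emb_vec N v) k
      = ell2_nth (\<Sum>j<2 * N - 1. cscale (v $ j) (emb_vec N (unit_vec (2 * N - 1) j))) k"
  proof (cases "\<bar>k\<bar> < int N")
    case True
    let ?i = "nat (k + (int N - 1))"
    have i: "?i < 2 * N - 1" using obs_index_nat(1)[OF True] .
    have "ell2_nth (\<Sum>j<2 * N - 1. cscale (v $ j) (emb_vec N (unit_vec (2 * N - 1) j))) k
        = (\<Sum>j<2 * N - 1. if j = ?i then v $ j else 0)"
      unfolding ell2_nth_sum
      by (intro sum.cong) (use True i in \<open>auto simp: ell2_nth_simps emb_vec.rep_eq unit_vec_def\<close>)
    also have "\<dots> = v $ ?i" using i by simp
    finally show ?thesis using True by (simp add: emb_vec.rep_eq)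
  qed (auto simp: ell2_nth_sum ell2_nth_simps emb_vec.rep_eq)
qed

lemma compression_mult_vec:
  assumes G: "complex_linear_op G" and v: "v \<in> carrier_vec (2 * N - 1)"
  shows "compression N G *\<^sub>v v = section_vec N (G (emb_vec N v))"
proof (rule eq_vecI)
  fix i assume "i < dim_vec (section_vec N (G (emb_vec N v)))"
  then have i: "i < 2 * N - 1" by (simp add: section_vec_def)
  have "section_vec N (G (emb_vec N v)) $ i
      = (\<Sum>j<2 * N - 1. v $ j * ell2_nth (G (emb_vec N (unit_vec (2 * N - 1) j))) (obs_index N i))"
    using i G unfolding emb_vec_expand[OF v]
    by (simp add: section_vec_def blinfun.sum_right ell2_nth_sum complex_linear_op_def ell2_nth_simps)
  then show "(compression N G *\<^sub>v v) $ i = section_vec N (G (emb_vec N v)) $ i"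
    using i v by (simp add: compression_def scalar_prod_def lessThan_atLeast0 mult.commute)
qed (simp add: section_vec_def compression_def)

text \<open>The determinant of \<open>1 - P K (z - A)^-1\<close> on the range of
  \<open>P = truncation N\<close>, where \<open>A = K - P K\<close>. When \<open>A\<close> is small,
  its resolvent exists outside a small disc even at spectral points of \<open>K\<close>, so this
  function is holomorphic across them and can detect them as zeros.\<close>

definition fredholm_det :: "nat \<Rightarrow> (ell2 \<Rightarrow>\<^sub>L ell2) \<Rightarrow> complex \<Rightarrow> complex" where
  "fredholm_det N K z = det (1\<^sub>m (2 * N - 1)
     - compression N (K o\<^sub>L resolvent (K - (truncation N o\<^sub>L K)) z))"

lemma complex_linear_op_compose:
  "complex_linear_op S \<Longrightarrow> complex_linear_op T \<Longrightarrow> complex_linear_op (S o\<^sub>L T)"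
  by (simp add: complex_linear_op_def)

lemma complex_linear_op_diff:
  "complex_linear_op S \<Longrightarrow> complex_linear_op T \<Longrightarrow> complex_linear_op (S - T)"
  by (simp add: complex_linear_op_def blinfun.diff_left cscale_simps)

lemma complex_linear_op_truncation: "complex_linear_op (truncation N)"
  unfolding truncation_def using exp_bounded_block_matrix complex_linear_matrix_op by blast

lemma complex_linear_op_minus_truncation:
  "complex_linear_op K \<Longrightarrow> complex_linear_op (K - (truncation N o\<^sub>L K))"
  by (intro complex_linear_op_diff complex_linear_op_compose complex_linear_op_truncation)

lemma mat_inverse_det_nonzero:
  fixes X :: "complex mat"
  assumes X: "X \<in> carrier_mat n n" and det: "det X \<noteq> 0"
  obtains Y where "Y \<in> carrier_mat n n" "X * Y = 1\<^sub>m n" "Y * X = 1\<^sub>m n"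
proof
  note adj = adj_mat[OF X]
  let ?Y = "inverse (det X) \<cdot>\<^sub>m adj_mat X"
  show "?Y \<in> carrier_mat n n" using adj by simp
  have one: "inverse (det X) \<cdot>\<^sub>m (det X \<cdot>\<^sub>m 1\<^sub>m n) = 1\<^sub>m n"
    using det by (intro eq_matI) auto
  show "X * ?Y = 1\<^sub>m n" using adj X one by (simp add: mult_smult_distrib)
  show "?Y * X = 1\<^sub>m n" using adj X one by (simp add: mult_smult_assoc_mat)
qed

text \<open>A kernel vector \<open>v\<close> of the matrix gives \<open>x = (z - A)^-1 v\<close>
  with \<open>P K x = v = (z - A) x\<close>. Adding \<open>A x = K x - P K x\<close> leaves
  \<open>K x = z x\<close>.\<close>

lemma fredholm_det_zero_imp_eigenvalue:
  assumes K: "complex_linear_op K" and z: "z \<notin> op_spectrum (K - (truncation N o\<^sub>L K))"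
    and det: "fredholm_det N K z = 0"
  shows "op_eigenvalue K z"
proof -
  define A where "A = K - (truncation N o\<^sub>L K)"
  define G where "G = K o\<^sub>L resolvent A z"
  have z: "z \<notin> op_spectrum A" using z by (simp add: A_def)
  have "complex_linear_op A" unfolding A_def by (rule complex_linear_op_minus_truncation[OF K])
  then have G: "complex_linear_op G"
    unfolding G_def by (intro complex_linear_op_compose K complex_linear_op_resolvent z)
  have "1\<^sub>m (2 * N - 1) - compression N G \<in> carrier_mat (2 * N - 1) (2 * N - 1)"
    by (intro minus_carrier_mat compression_carrier)
  from det_0_iff_vec_prod_zero_field[OF this] det
  obtain v where v: "v \<in> carrier_vec (2 * N - 1)" "v \<noteq> 0\<^sub>v (2 * N - 1)"
    and "(1\<^sub>m (2 * N - 1) - compression N G) *\<^sub>v v = 0\<^sub>v (2 * N - 1)"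
    unfolding fredholm_det_def A_def G_def by auto
  then have eq: "v - section_vec N (G (emb_vec N v)) = 0\<^sub>v (2 * N - 1)"
    using minus_mult_distrib_mat_vec[OF one_carrier_mat compression_carrier v(1)]
    by (simp only: one_mult_mat_vec[OF v(1)] compression_mult_vec[OF G v(1)])
  have v_eq: "section_vec N (G (emb_vec N v)) = v"
  proof (rule eq_vecI)
    fix i assume i: "i < dim_vec v"
    have "(v - section_vec N (G (emb_vec N v))) $ i = 0" using eq i v(1) by simp
    then show "section_vec N (G (emb_vec N v)) $ i = v $ i" using i v(1) by (simp add: section_vec_def)
  qed (use v(1) in \<open>simp add: section_vec_def\<close>)
  define x where "x = resolvent A z (emb_vec N v)"
  have "cscale z x - A x = emb_vec N v" unfolding x_def by (rule resolvent_apply(2)[OF z])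
  moreover have "truncation N (K x) = emb_vec N v"
    unfolding truncation_eq x_def using v_eq by (simp add: G_def)
  ultimately have Kx: "K x = cscale z x"
    by (simp add: A_def blinfun.diff_left algebra_simps)
  have "x \<noteq> 0"
  proof
    assume "x = 0"
    then have "emb_vec N v = 0"
      using resolvent_apply(2)[OF z, of "emb_vec N v"] by (simp add: x_def blinfun.zero_right cscale_simps)
    then have "v = section_vec N 0" using section_vec_emb_vec[OF v(1)] by simp
    then show False using v(2) by (auto simp: section_vec_def ell2_nth_simps)
  qed
  then show ?thesis using Kx by (auto simp: op_eigenvalue_def)
qed

text \<open>With \<open>A = K - P K\<close> for the truncation \<open>P\<close>, the identity
  \<open>z - K = (1 - P K (z - A)\<^sup>-\<^sup>1) (z - A)\<close> reduces the inversion of \<open>z - K\<close> to the inversion of a finite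
  matrix \<open>1 - X\<close>.\<close>

lemma fredholm_det_nonzero_imp_regular:
  assumes K: "complex_linear_op K" and z: "z \<notin> op_spectrum (K - (truncation N o\<^sub>L K))"
    and det: "fredholm_det N K z \<noteq> 0"
  shows "z \<notin> op_spectrum K"
proof -
  define A where "A = K - (truncation N o\<^sub>L K)"
  define G where "G = K o\<^sub>L resolvent A z"
  define X where "X = compression N G"
  let ?n = "2 * N - 1"
  let ?sec = "section_vec N" and ?emb = "emb_vec N"
  have z: "z \<notin> op_spectrum A" using z by (simp add: A_def)
  have "complex_linear_op A" unfolding A_def by (rule complex_linear_op_minus_truncation[OF K])
  then have G: "complex_linear_op G"
    unfolding G_def by (intro complex_linear_op_compose K complex_linear_op_resolvent z)
  have X: "X \<in> carrier_mat ?n ?n" unfolding X_def by (rule compression_carrier)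
  then have X1: "1\<^sub>m ?n - X \<in> carrier_mat ?n ?n" by (rule minus_carrier_mat)
  have "det (1\<^sub>m ?n - X) \<noteq> 0" using det unfolding fredholm_det_def X_def G_def A_def .
  then obtain Y where Y: "Y \<in> carrier_mat ?n ?n" "(1\<^sub>m ?n - X) * Y = 1\<^sub>m ?n" "Y * (1\<^sub>m ?n - X) = 1\<^sub>m ?n"
    by (rule mat_inverse_det_nonzero[OF X1])
  have Xv: "(1\<^sub>m ?n - X) *\<^sub>v v = v - ?sec (G (?emb v))" if "v \<in> carrier_vec ?n" for v
    using minus_mult_distrib_mat_vec[OF one_carrier_mat X that] that
    by (simp add: X_def compression_mult_vec[OF G])
  define U where "U = matrix_op (block_matrix N Y)"
  have U: "U x = ?emb (Y *\<^sub>v ?sec x)" for x unfolding U_def by (rule block_op_eq[OF Y(1)])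
  have Yc: "Y *\<^sub>v v \<in> carrier_vec ?n" if "v \<in> carrier_vec ?n" for v using Y(1) that by simp
  \<comment> \<open>\<open>1 + U G\<close> inverts \<open>1 - P G\<close>: writing
    \<open>P = E F\<close> with \<open>E\<close> the embedding and \<open>F\<close> the section, the
    inverse of \<open>1 - E F G\<close> is \<open>1 + E Y F G\<close>, where \<open>Y\<close> is the
    inverse of the finite matrix \<open>1 - F G E\<close>.\<close>
  define S where "S = resolvent A z o\<^sub>L (id_blinfun + (U o\<^sub>L G))"
  have S: "S y = resolvent A z (y + ?emb (Y *\<^sub>v ?sec (G y)))" for y
    by (simp add: S_def U blinfun.add_left)
  have zK: "cscale z x - K x = w - ?emb (?sec (G w))" if w: "w = cscale z x - A x" for x w
  proof -
    have "G w = K x" using resolvent_apply(1)[OF z, of x] w by (simp add: G_def)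
    then show ?thesis unfolding w by (simp add: A_def blinfun.diff_left truncation_eq)
  qed
  have "is_inverse_op S (scalar_op z - K)"
    unfolding is_inverse_op_iff
  proof (intro conjI allI)
    fix y
    define g where "g = ?sec (G y)"
    have g: "g \<in> carrier_vec ?n" unfolding g_def by (rule section_vec_carrier)
    define u where "u = Y *\<^sub>v g"
    have u: "u \<in> carrier_vec ?n" using Yc[OF g] unfolding u_def .
    have "u - ?sec (G (?emb u)) = g"
      using Xv[OF u] assoc_mult_mat_vec[OF X1 Y(1) g] Y(2) g by (simp add: u_def)
    then have e: "?emb u - ?emb (?sec (G (?emb u))) = ?emb g"
      using emb_vec_minus[OF u section_vec_carrier, of "G (?emb u)"] by simp
    have "(scalar_op z - K) (S y) = (y + ?emb u) - ?emb (?sec (G (y + ?emb u)))"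
      unfolding blinfun.diff_left scalar_op_apply
      by (rule zK) (simp add: S u_def g_def resolvent_apply(2)[OF z])
    also have "?emb (?sec (G (y + ?emb u))) = ?emb g + ?emb (?sec (G (?emb u)))"
      unfolding blinfun.add_right section_vec_add g_def
      by (rule emb_vec_add[OF section_vec_carrier section_vec_carrier])
    finally show "(scalar_op z - K) (S y) = y" unfolding e[symmetric] by simp
  next
    fix x
    define w where "w = cscale z x - A x"
    define g where "g = ?sec (G w)"
    have g: "g \<in> carrier_vec ?n" unfolding g_def by (rule section_vec_carrier)
    have "?sec (G (w - ?emb g)) = (1\<^sub>m ?n - X) *\<^sub>v g"
      unfolding Xv[OF g] by (simp add: blinfun.diff_right section_vec_minus g_def)
    then have "Y *\<^sub>v ?sec (G (w - ?emb g)) = g"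
      using assoc_mult_mat_vec[OF Y(1) X1 g] Y(3) g by simp
    then have "S (w - ?emb g) = resolvent A z w" by (simp add: S)
    also have "\<dots> = x" unfolding w_def by (rule resolvent_apply(1)[OF z])
    finally show "S ((scalar_op z - K) x) = x"
      using zK[OF w_def] by (simp add: blinfun.diff_left g_def)
  qed
  then show ?thesis by (auto simp: op_spectrum_def)
qed

lemma resolvent_identity:
  assumes A: "complex_linear_op A" and "w \<notin> op_spectrum A" "z \<notin> op_spectrum A"
  shows "resolvent A w u - resolvent A z u = cscale (z - w) (resolvent A w (resolvent A z u))"
proof -
  let ?x = "resolvent A z u"
  have "u = (cscale w ?x - A ?x) + cscale (z - w) ?x"
    using resolvent_apply(2)[OF assms(3), of u] by (simp add: cscale_simps)
  then have "resolvent A w u = resolvent A w (cscale w ?x - A ?x) + resolvent A w (cscale (z - w) ?x)"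
    by (metis blinfun.add_right)
  then show ?thesis
    using resolvent_apply(1)[OF assms(2), of ?x] complex_linear_op_resolvent[OF A assms(2)]
    by (simp add: complex_linear_op_def)
qed

text \<open>The resolvent identity turns the difference quotient into minus the coordinate of
  \<open>K (resolvent A w (resolvent A z u))\<close>, and continuity of the resolvent gives the
  limit.\<close>

lemma holomorphic_resolvent_coordinate:
  assumes K: "complex_linear_op K" and A: "complex_linear_op A"
  shows "(\<lambda>z. ell2_nth (K (resolvent A z u)) k) holomorphic_on - op_spectrum A"
proof (rule holomorphic_onI)
  fix z assume z: "z \<in> - op_spectrum A"
  let ?f = "\<lambda>z. ell2_nth (K (resolvent A z u)) k"
  let ?y = "resolvent A z u"
  have lim: "((\<lambda>w. ell2_nth (K (resolvent A w ?y)) k) \<longlongrightarrow> ell2_nth (K (resolvent A z ?y)) k)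
      (at z within - op_spectrum A)"
  proof -
    have "bounded_linear (\<lambda>x. ell2_nth x k)"
      by (rule bounded_linear_intro[where K = 1])
        (auto simp: ell2_nth_simps scaleR_ell2.rep_eq ell2_nth_le)
    then show ?thesis
      using continuous_on_resolvent[of A] z
      by (intro bounded_linear.tendsto[of "\<lambda>x. ell2_nth x k"] tendsto_intros) (auto simp: continuous_on_def)
  qed
  have "(?f has_field_derivative - ell2_nth (K (resolvent A z ?y)) k) (at z within - op_spectrum A)"
    unfolding has_field_derivative_iff
  proof (rule Lim_transform_eventually)
    show "((\<lambda>w. - ell2_nth (K (resolvent A w ?y)) k) \<longlongrightarrow> - ell2_nth (K (resolvent A z ?y)) k)
        (at z within - op_spectrum A)"
      by (intro tendsto_minus lim)
    show "\<forall>\<^sub>F w in at z within - op_spectrum A.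
        - ell2_nth (K (resolvent A w ?y)) k = (?f w - ?f z) / (w - z)"
      unfolding eventually_at_filter
    proof (intro always_eventually allI impI)
      fix w assume w: "w \<noteq> z" "w \<in> - op_spectrum A"
      have "?f w - ?f z = ell2_nth (K (resolvent A w u - resolvent A z u)) k"
        by (simp add: blinfun.diff_right ell2_nth_simps)
      also have "\<dots> = (z - w) * ell2_nth (K (resolvent A w ?y)) k"
        using resolvent_identity[OF A, of w z u] w z K by (simp add: complex_linear_op_def ell2_nth_simps)
      finally show "- ell2_nth (K (resolvent A w ?y)) k = (?f w - ?f z) / (w - z)"
        using w(1) by (simp add: field_simps)
    qed
  qed
  then show "?f field_differentiable at z within - op_spectrum A"
    by (auto simp: field_differentiable_def)
qed

lemma holomorphic_fredholm_det:
  assumes K: "complex_linear_op K"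
  shows "fredholm_det N K holomorphic_on - op_spectrum (K - (truncation N o\<^sub>L K))"
proof -
  let ?A = "K - (truncation N o\<^sub>L K)" and ?n = "2 * N - 1"
  have A: "complex_linear_op ?A" by (rule complex_linear_op_minus_truncation[OF K])
  have ent: "(\<lambda>z. (1\<^sub>m ?n - compression N (K o\<^sub>L resolvent ?A z)) $$ (i, j))
      holomorphic_on - op_spectrum ?A" if "i < ?n" "j < ?n" for i j
  proof -
    have "(\<lambda>z. 1\<^sub>m ?n $$ (i, j) - ell2_nth (K (resolvent ?A z (emb_vec N (unit_vec ?n j)))) (obs_index N i))
        holomorphic_on - op_spectrum ?A"
      by (intro holomorphic_intros holomorphic_resolvent_coordinate K A)
    then show ?thesis using that by (simp add: compression_def)
  qed
  have det: "fredholm_det N K z = (\<Sum>p | p permutes {0..<?n}. signof p *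
      (\<Prod>i = 0..<?n. (1\<^sub>m ?n - compression N (K o\<^sub>L resolvent ?A z)) $$ (i, p i)))" for z
    unfolding fredholm_det_def by (rule det_def') (intro minus_carrier_mat compression_carrier)
  have "(\<lambda>z. \<Sum>p | p permutes {0..<?n}. signof p *
      (\<Prod>i = 0..<?n. (1\<^sub>m ?n - compression N (K o\<^sub>L resolvent ?A z)) $$ (i, p i)))
      holomorphic_on - op_spectrum ?A"
  proof (intro holomorphic_on_sum holomorphic_on_mult holomorphic_on_const holomorphic_on_prod ent)
    fix p i assume "p \<in> {p. p permutes {0..<?n}}" "i \<in> {0..<?n}"
    then show "p i < ?n" using permutes_in_image[of p "{0..<?n}" i] by auto
  qed auto
  then show ?thesis by (simp add: det fun_eq_iff cong: holomorphic_cong)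
qed

section \<open>The spectrum away from zero\<close>

lemma norm_minus_truncation_compose: "norm (D - (truncation N o\<^sub>L D)) \<le> norm D"
proof (rule norm_blinfun_bound)
  fix x
  have "norm (D x - truncation N (D x)) \<le> norm (D x)" by (rule norm_truncation_compl)
  also have "\<dots> \<le> norm D * norm x" by (rule norm_blinfun)
  finally show "norm ((D - (truncation N o\<^sub>L D)) x) \<le> norm D * norm x"
    by (simp add: blinfun.diff_left)
qed simp

text \<open>This is the form in which compactness is used: complex linearity must be recorded
  separately, and closeness to a truncation supplies the finite determinant.\<close>

definition truncation_close :: "(ell2 \<Rightarrow>\<^sub>L ell2) \<Rightarrow> bool" where
  "truncation_close T \<longleftrightarrow> complex_linear_op T \<and> (\<forall>e>0. \<exists>N. norm (T - (truncation N o\<^sub>L T)) < e)"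

lemma truncation_close_matrix_op:
  assumes a: "exp_bounded C \<theta> a"
  shows "truncation_close (matrix_op a)"
  unfolding truncation_close_def
proof (intro conjI allI impI)
  show "complex_linear_op (matrix_op a)" by (rule complex_linear_matrix_op[OF a])
  fix e :: real assume e: "0 < e"
  have "sqrt \<theta> < 1" "0 < sqrt \<theta>" using a by (auto simp: exp_bounded_def)
  then have "(\<lambda>n. C * weight_const (sqrt \<theta>) * sqrt \<theta> ^ n) \<longlonglongrightarrow> C * weight_const (sqrt \<theta>) * 0"
    by (intro tendsto_mult_left LIMSEQ_realpow_zero) auto
  then have "\<forall>\<^sub>F n in sequentially. C * weight_const (sqrt \<theta>) * sqrt \<theta> ^ n < e"
    by (rule order_tendstoD(2)) (use e in simp)
  then obtain N where "C * weight_const (sqrt \<theta>) * sqrt \<theta> ^ N < e"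
    by (auto simp: eventually_sequentially)
  then show "\<exists>N. norm (matrix_op a - (truncation N o\<^sub>L matrix_op a)) < e"
    using norm_matrix_op_minus_truncation[OF a, of N] by (intro exI[of _ N]) linarith
qed

lemma fredholm_det_zero_iff:
  assumes "complex_linear_op K" "norm (K - (truncation N o\<^sub>L K)) < cmod z"
  shows "fredholm_det N K z = 0 \<longleftrightarrow> z \<in> op_spectrum K"
    and "z \<in> op_spectrum K \<Longrightarrow> op_eigenvalue K z"
proof -
  note z = resolvent_outside_norm(1)[OF assms(2)]
  note 1 = fredholm_det_zero_imp_eigenvalue[OF assms(1) z]
  note 2 = fredholm_det_nonzero_imp_regular[OF assms(1) z]
  show "fredholm_det N K z = 0 \<longleftrightarrow> z \<in> op_spectrum K"
    using 1 2 op_eigenvalue_in_spectrum by (auto simp: op_eigenvalue_def)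
  show "z \<in> op_spectrum K \<Longrightarrow> op_eigenvalue K z" using 1 2 by blast
qed

lemma op_eigenvalue_nonzero_spectrum:
  assumes "truncation_close K" "z \<in> op_spectrum K" "z \<noteq> 0"
  shows "op_eigenvalue K z"
proof -
  obtain N where "norm (K - (truncation N o\<^sub>L K)) < cmod z"
    using assms unfolding truncation_close_def by (meson zero_less_norm_iff)
  then show ?thesis using assms fredholm_det_zero_iff(2) by (auto simp: truncation_close_def)
qed

text \<open>A spectral point outside the disc would make the constant 0, whereas far out, beyond
  \<open>norm K\<close>, there is no spectrum and the determinant does not vanish. This rules out an
  identically vanishing determinant in the zero-counting arguments.\<close>

lemma fredholm_det_nonconstant:
  assumes K: "complex_linear_op K" and \<rho>: "norm (K - (truncation N o\<^sub>L K)) \<le> \<rho>"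
    and \<mu>: "\<mu> \<in> op_spectrum K" "\<rho> < cmod \<mu>"
  shows "\<not> fredholm_det N K constant_on - cball 0 \<rho>"
proof
  assume "fredholm_det N K constant_on - cball 0 \<rho>"
  then obtain c where c: "\<And>z. \<rho> < cmod z \<Longrightarrow> fredholm_det N K z = c"
    by (auto simp: constant_on_def)
  have "fredholm_det N K \<mu> = 0" using fredholm_det_zero_iff(1)[OF K, of N \<mu>] \<rho> \<mu> by auto
  then have c0: "c = 0" using c[OF \<mu>(2)] by simp
  define z :: complex where "z = of_real (norm K + \<rho> + 1)"
  have "0 \<le> \<rho>" using \<rho> norm_ge_zero order_trans by blast
  then have z: "cmod z = norm K + \<rho> + 1" by (simp add: z_def del: of_real_add)
  have "z \<notin> op_spectrum K"
    by (rule resolvent_outside_norm(1)) (use z \<open>0 \<le> \<rho>\<close> in simp)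
  moreover have "\<rho> < cmod z" using z norm_ge_zero[of K] by linarith
  ultimately show False
    using c[of z] c0 fredholm_det_zero_iff(1)[OF K, of N z] \<rho> by simp
qed

text \<open>The points in question are zeros of a nonconstant holomorphic function in a compact
  annulus. The halved radius \<open>e / 2\<close> leaves an open connected domain around that
  annulus; a spectral point is needed for nonconstancy, hence the case split.\<close>

lemma finite_spectrum_away_from_zero:
  assumes K: "truncation_close K" and e: "0 < e"
  shows "finite {z \<in> op_spectrum K. e \<le> cmod z}"
proof (cases "{z \<in> op_spectrum K. e \<le> cmod z} = {}")
  case False
  then obtain \<mu> where \<mu>: "\<mu> \<in> op_spectrum K" "e \<le> cmod \<mu>" by blast
  have K': "complex_linear_op K" using K by (simp add: truncation_close_def)
  obtain N where N: "norm (K - (truncation N o\<^sub>L K)) < e / 2"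
    using K e unfolding truncation_close_def by (meson half_gt_zero)
  let ?S = "- cball (0::complex) (e / 2)"
  have "?S \<subseteq> - op_spectrum (K - (truncation N o\<^sub>L K))"
    using resolvent_outside_norm(1) N by force
  then have hol: "fredholm_det N K holomorphic_on ?S"
    by (rule holomorphic_on_subset[OF holomorphic_fredholm_det[OF K']])
  have conn: "connected ?S" by (rule connected_complement_bounded_convex) auto
  have nc: "\<not> fredholm_det N K constant_on ?S"
    by (rule fredholm_det_nonconstant[OF K' less_imp_le[OF N] \<mu>(1)]) (use \<mu> e in simp)
  have "finite {z \<in> cball 0 (norm K) - ball 0 e. fredholm_det N K z = 0}"
    by (rule holomorphic_compact_finite_zeros[OF hol _ conn _ _ nc])
      (use e in \<open>auto intro!: compact_diff\<close>)
  moreover have "{z \<in> op_spectrum K. e \<le> cmod z} \<subseteq> {z \<in> cball 0 (norm K) - ball 0 e. fredholm_det N K z = 0}"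
    using fredholm_det_zero_iff(1)[OF K', of N] N e resolvent_outside_norm(1)[of K]
    by (auto simp: not_less intro: leI)
  ultimately show ?thesis by (rule finite_subset[rotated])
next
  case True
  show ?thesis unfolding True by simp
qed

text \<open>In the infinite case the nonzero spectrum is a countable union of finite sets. An
  injective enumeration meets each of them finitely often and so tends to 0, and closedness of the
  spectrum puts 0 into it.\<close>

lemma spectrum_finite_or_null_sequence:
  assumes K: "truncation_close K"
  shows "finite (op_spectrum K) \<or>
    (\<exists>s :: nat \<Rightarrow> complex. s \<longlonglongrightarrow> 0 \<and> op_spectrum K = insert 0 (range s))"
proof (cases "finite (op_spectrum K)")
  case False
  define S where "S = op_spectrum K - {0}"
  have inf: "infinite S" using False by (simp add: S_def)
  have fin: "finite {z \<in> S. e \<le> cmod z}" if "0 < e" for e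
    by (rule finite_subset[OF _ finite_spectrum_away_from_zero[OF K that]]) (auto simp: S_def)
  have "S = (\<Union>n::nat. {z \<in> S. inverse (real (Suc n)) \<le> cmod z})"
  proof (intro equalityI subsetI)
    fix z assume z: "z \<in> S"
    then have "0 < cmod z" by (simp add: S_def)
    then obtain n where "inverse (real (Suc n)) < cmod z" using reals_Archimedean by blast
    then show "z \<in> (\<Union>n::nat. {z \<in> S. inverse (real (Suc n)) \<le> cmod z})" using z
      by (intro UN_I[of n]) auto
  qed auto
  moreover have "countable (\<Union>n::nat. {z \<in> S. inverse (real (Suc n)) \<le> cmod z})"
  proof (rule countable_UN)
    show "countable {z \<in> S. inverse (real (Suc n)) \<le> cmod z}" for n
      by (intro countable_finite fin) simp
  qed simp
  ultimately have cnt: "countable S" by (rule ssubst)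
  define s where "s = from_nat_into S"
  have bij: "bij_betw s UNIV S" unfolding s_def by (rule bij_betw_from_nat_into[OF cnt inf])
  have lim: "s \<longlonglongrightarrow> 0"
  proof (rule LIMSEQ_I)
    fix e :: real assume e: "0 < e"
    have "finite (s -` {z \<in> S. e \<le> cmod z})"
      using bij by (intro finite_vimageI fin e) (auto simp: bij_betw_def)
    then obtain N where N: "\<forall>n\<in>s -` {z \<in> S. e \<le> cmod z}. n < N"
      unfolding finite_nat_set_iff_bounded ..
    have "norm (s n - 0) < e" if "n \<ge> N" for n
    proof (rule ccontr)
      assume "\<not> norm (s n - 0) < e"
      moreover have "s n \<in> S" using bij by (auto simp: bij_betw_def)
      ultimately have "n < N" using N by simp
      then show False using that by simp
    qed
    then show "\<exists>N. \<forall>n\<ge>N. norm (s n - 0) < e" by blast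
  qed
  have "closed (op_spectrum K)" using open_resolvent_set[of K] by (simp add: closed_def)
  moreover have "s n \<in> op_spectrum K" for n using bij by (auto simp: bij_betw_def S_def)
  ultimately have "0 \<in> op_spectrum K" using lim by (rule closed_sequentially)
  then have "op_spectrum K = insert 0 (range s)" using bij by (auto simp: bij_betw_def S_def)
  then show ?thesis using lim by blast
qed simp


section \<open>Convergence rate for zeros\<close>

lemma eventually_power_less:
  fixes q c :: real
  assumes "0 \<le> q" "q < 1" "0 < c"
  shows "\<forall>\<^sub>F n in sequentially. C * q ^ n < c"
proof -
  have "(\<lambda>n. C * q ^ n) \<longlonglongrightarrow> C * 0"
    by (intro tendsto_mult_left LIMSEQ_realpow_zero) (use assms in auto)
  then show ?thesis by (rule order_tendstoD(2)) (use assms in simp)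
qed

text \<open>If \<open>F n\<close> had no zero close to \<open>\<mu>\<close>, then the maximum principle for \<open>1 / F n\<close> would give a lower
  bound for \<open>F n \<mu>\<close> contradicting \<open>F n \<mu> = O(q\<^sup>n)\<close>.\<close>

lemma zeros_converge_exponentially:
  fixes f :: "complex \<Rightarrow> complex"
  assumes f: "f holomorphic_on S" "open S" "connected S" "\<mu> \<in> S" "f \<mu> = 0" "\<not> f constant_on S"
    and R: "0 < R" "cball \<mu> R \<subseteq> S"
    and F: "\<forall>\<^sub>F n in sequentially. F n holomorphic_on ball \<mu> R \<and>
       (\<forall>z\<in>ball \<mu> R. cmod (F n z - f z) \<le> L * q ^ n)"
    and q: "0 < q" "q < 1" and L: "0 < L"
  obtains q' where "0 < q'" "q' < 1"
    "\<forall>\<^sub>F n in sequentially. \<exists>z. z \<in> ball \<mu> R \<and> F n z = 0 \<and> cmod (z - \<mu>) \<le> q' ^ n"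
proof -
  obtain g r p where g: "0 < p" "0 < r" "ball \<mu> r \<subseteq> S" "g holomorphic_on ball \<mu> r"
    "\<And>w. w \<in> ball \<mu> r \<Longrightarrow> f w = (w - \<mu>) ^ p * g w" "\<And>w. w \<in> ball \<mu> r \<Longrightarrow> g w \<noteq> 0"
    by (rule holomorphic_factor_zero_nonconstant[OF f]) (rule that; assumption)
  define s where "s = min r R / 2"
  have s: "0 < s" "s < r" "s < R" using g(2) R(1) by (auto simp: s_def)
  have "continuous_on (cball \<mu> s) (\<lambda>w. cmod (g w))"
    using s by (intro continuous_on_norm holomorphic_on_imp_continuous_on holomorphic_on_subset[OF g(4)])
      (auto simp: subset_iff)
  then obtain w0 where w0: "w0 \<in> cball \<mu> s" "\<And>w. w \<in> cball \<mu> s \<Longrightarrow> cmod (g w0) \<le> cmod (g w)"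
    using continuous_attains_inf[OF compact_cball, of \<mu> s] s by force
  define c where "c = cmod (g w0)"
  have c: "0 < c" using g(6)[of w0] w0(1) s by (auto simp: c_def)
  have f_ge: "c * dist \<mu> w ^ p \<le> cmod (f w)" if "dist \<mu> w \<le> s" for w
  proof -
    have "cmod (f w) = dist \<mu> w ^ p * cmod (g w)"
      using g(5)[of w] that s by (simp add: norm_mult norm_power dist_norm norm_minus_commute)
    moreover have "c \<le> cmod (g w)" using w0(2)[of w] that by (simp add: c_def)
    ultimately show ?thesis using mult_left_mono[of c "cmod (g w)" "dist \<mu> w ^ p"] by (simp add: mult.commute)
  qed
  \<comment> \<open>The exponent halves the rate and accounts for the order \<open>p\<close> of the
    zero: at radius \<open>\<rho> = q' ^ n\<close> one has \<open>\<rho> ^ p = sqrt q ^ n\<close>,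
    so the lower bound \<open>c * \<rho> ^ p\<close> for \<open>f\<close> eventually beats the
    perturbation \<open>L * q ^ n\<close>.\<close>
  define q' where "q' = root (2 * p) q"
  have q': "0 < q'" "q' < 1" using q g(1) by (auto simp: q'_def)
  have "q' ^ (2 * p) = q" unfolding q'_def using q g(1) by (intro real_root_pow_pos2) auto
  then have qq: "q ^ n = (q' ^ (2 * p)) ^ n" for n by simp
  have ev1: "\<forall>\<^sub>F n in sequentially. 1 * q' ^ n < s"
    by (rule eventually_power_less) (use q' s in auto)
  have ev2: "\<forall>\<^sub>F n in sequentially. (2 * L) * (q' ^ p) ^ n < c"
    by (rule eventually_power_less) (use q' c g(1) in \<open>auto simp: power_Suc_less_one power_less_one_iff\<close>)
  have "\<forall>\<^sub>F n in sequentially. \<exists>z. z \<in> ball \<mu> R \<and> F n z = 0 \<and> cmod (z - \<mu>) \<le> q' ^ n"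
    using F ev1 ev2
  proof eventually_elim
    case (elim n)
    define \<rho> where "\<rho> = q' ^ n"
    have \<rho>: "0 < \<rho>" "\<rho> < s" using q' elim(2) by (auto simp: \<rho>_def)
    have key: "2 * L * q ^ n < c * \<rho> ^ p"
    proof -
      have "q ^ n = (q' ^ p) ^ n * (q' ^ p) ^ n"
        unfolding qq mult_2 power_add power_mult_distrib ..
      moreover have "\<rho> ^ p = (q' ^ p) ^ n"
        using power_mult[of q' n p] power_mult[of q' p n] by (simp only: \<rho>_def mult.commute[of n p])
      moreover have "(2 * L) * (q' ^ p) ^ n * (q' ^ p) ^ n < c * (q' ^ p) ^ n"
        using elim(3) q' by (intro mult_strict_right_mono) auto
      ultimately show ?thesis by (simp only: mult.assoc)
    qed
    show ?case
    proof (rule ccontr)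
      assume "\<not> ?case"
      then have nz: "F n z \<noteq> 0" if "dist \<mu> z \<le> \<rho>" for z
        using that \<rho> s by (auto simp: \<rho>_def dist_norm norm_minus_commute)
      have Fn: "F n holomorphic_on ball \<mu> R" using elim(1) by blast
      have sub: "cball \<mu> \<rho> \<subseteq> ball \<mu> R" using \<rho> s by (simp add: cball_subset_ball_iff)
      have hol: "(\<lambda>z. inverse (F n z)) holomorphic_on cball \<mu> \<rho>"
        by (intro holomorphic_on_inverse holomorphic_on_subset[OF Fn sub]) (use nz in auto)
      define B where "B = c * \<rho> ^ p - L * q ^ n"
      have Lq: "0 < L * q ^ n" using L q by simp
      have B: "0 < B" using key Lq by (simp add: B_def)
      have "cmod (inverse (F n \<mu>)) \<le> inverse B"
      proof (rule maximum_modulus_frontier[where f = "\<lambda>z. inverse (F n z)" and S = "cball \<mu> \<rho>"])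
        show "(\<lambda>z. inverse (F n z)) holomorphic_on interior (cball \<mu> \<rho>)"
          by (rule holomorphic_on_subset[OF hol]) auto
        show "continuous_on (closure (cball \<mu> \<rho>)) (\<lambda>z. inverse (F n z))"
          unfolding closure_closed[OF closed_cball] by (rule holomorphic_on_imp_continuous_on[OF hol])
        show "cmod (inverse (F n z)) \<le> inverse B" if "z \<in> frontier (cball \<mu> \<rho>)" for z
        proof -
          have z: "dist \<mu> z = \<rho>" using that by (simp add: frontier_cball)
          have "c * \<rho> ^ p \<le> cmod (f z)" using f_ge[of z] z \<rho> by simp
          moreover have "cmod (F n z - f z) \<le> L * q ^ n" using elim(1) z \<rho> s by auto
          moreover have "cmod (f z) \<le> cmod (F n z) + cmod (F n z - f z)"
            by (metis add.commute norm_minus_commute norm_triangle_sub)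
          ultimately have "B \<le> cmod (F n z)" unfolding B_def by linarith
          then show ?thesis using B by (simp add: norm_inverse le_imp_inverse_le)
        qed
      qed (use \<rho> in auto)
      then have "B \<le> cmod (F n \<mu>)"
        using B nz[of \<mu>] \<rho> by (simp add: norm_inverse)
      also have "cmod (F n \<mu>) \<le> L * q ^ n" using elim(1) R f(5) by (metis centre_in_ball diff_zero)
      finally show False using key by (simp add: B_def)
    qed
  qed
  then show ?thesis using that q' by blast
qed

section \<open>Lipschitz estimates for determinants\<close>

lemma prod_lipschitz:
  fixes a b :: "nat \<Rightarrow> complex"
  assumes "1 \<le> M" "\<And>i. i < m \<Longrightarrow> cmod (a i) \<le> M" "\<And>i. i < m \<Longrightarrow> cmod (b i) \<le> M"
    "\<And>i. i < m \<Longrightarrow> cmod (a i - b i) \<le> \<delta>" "0 \<le> \<delta>"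
  shows "cmod ((\<Prod>i = 0..<m. a i) - (\<Prod>i = 0..<m. b i)) \<le> real m * M ^ m * \<delta>"
  using assms(2-4)
proof (induction m)
  case (Suc m)
  let ?A = "\<Prod>i = 0..<m. a i" and ?B = "\<Prod>i = 0..<m. b i"
  have IH: "cmod (?A - ?B) \<le> real m * M ^ m * \<delta>" using Suc by simp
  have B: "cmod ?B \<le> M ^ m"
    unfolding prod_norm[symmetric]
    using prod_mono[of "{0..<m}" "\<lambda>i. cmod (b i)" "\<lambda>_. M"] Suc.prems(2) by (simp add: less_Suc_eq)
  have "cmod (?A * a m - ?B * b m) = cmod ((?A - ?B) * a m + ?B * (a m - b m))"
    by (simp add: algebra_simps)
  also have "\<dots> \<le> cmod (?A - ?B) * cmod (a m) + cmod ?B * cmod (a m - b m)"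
    by (metis norm_mult norm_triangle_ineq)
  also have "\<dots> \<le> (real m * M ^ m * \<delta>) * M + M ^ m * \<delta>"
    using Suc.prems IH B assms(1,5) by (intro add_mono mult_mono mult_nonneg_nonneg) auto
  also have "\<dots> \<le> (real m * M ^ m * \<delta>) * M + M ^ m * \<delta> * M"
    using assms(1,5) mult_left_mono[OF assms(1), of "M ^ m * \<delta>"] by simp
  also have "\<dots> = real (Suc m) * M ^ Suc m * \<delta>" by (simp add: algebra_simps)
  finally show ?case by simp
qed simp

text \<open>A crude factorial constant suffices, because the size \<open>m\<close> of the matrices
  is fixed by the truncation and does not grow with the approximation index.\<close>

lemma det_lipschitz:
  fixes X Y :: "complex mat"
  assumes X: "X \<in> carrier_mat m m" and Y: "Y \<in> carrier_mat m m" and M: "1 \<le> M" and \<delta>: "0 \<le> \<delta>"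
    and bd: "\<And>i j. i < m \<Longrightarrow> j < m \<Longrightarrow> cmod (X $$ (i, j)) \<le> M"
      "\<And>i j. i < m \<Longrightarrow> j < m \<Longrightarrow> cmod (Y $$ (i, j)) \<le> M"
      "\<And>i j. i < m \<Longrightarrow> j < m \<Longrightarrow> cmod (X $$ (i, j) - Y $$ (i, j)) \<le> \<delta>"
  shows "cmod (det X - det Y) \<le> fact m * (real m * M ^ m) * \<delta>"
proof -
  let ?P = "{p. p permutes {0..<m}}"
  have "det X - det Y = (\<Sum>p\<in>?P. signof p * ((\<Prod>i = 0..<m. X $$ (i, p i)) - (\<Prod>i = 0..<m. Y $$ (i, p i))))"
    unfolding det_def'[OF X] det_def'[OF Y] by (simp add: sum_subtractf right_diff_distrib)
  also have "cmod \<dots> \<le> (\<Sum>p\<in>?P. real m * M ^ m * \<delta>)"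
  proof (rule sum_norm_le)
    fix p assume "p \<in> ?P"
    then have p: "p i < m" if "i < m" for i using permutes_in_image[of p "{0..<m}" i] that by auto
    have "cmod ((\<Prod>i = 0..<m. X $$ (i, p i)) - (\<Prod>i = 0..<m. Y $$ (i, p i))) \<le> real m * M ^ m * \<delta>"
      by (rule prod_lipschitz[OF M]) (use bd p \<delta> in auto)
    then show "cmod (signof p * ((\<Prod>i = 0..<m. X $$ (i, p i)) - (\<Prod>i = 0..<m. Y $$ (i, p i))))
        \<le> real m * M ^ m * \<delta>"
      by (simp add: norm_mult sign_def)
  qed
  also have "\<dots> = fact m * (real m * M ^ m) * \<delta>"
    by (simp add: card_permutations[OF refl])
  finally show ?thesis .
qed

section \<open>Eigenvalues of approximating operators\<close>

lemma eventually_norm_diff_less: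
  assumes "\<forall>\<^sub>F n in sequentially. norm (T - Tn n) \<le> C * q ^ n" "0 < q" "q < (1::real)" "0 < e"
  shows "\<forall>\<^sub>F n in sequentially. norm (Tn n - T) < e"
  using assms(1) eventually_power_less[OF less_imp_le[OF assms(2)] assms(3,4), of C]
  by eventually_elim (simp add: norm_minus_commute)

text \<open>One truncation index \<open>N\<close>, chosen for \<open>K\<close>, serves all
  \<open>Kn n\<close>: removing a truncation does not increase norms, so
  \<open>Kn n - P Kn n\<close> is as close to \<open>K - P K\<close> as \<open>Kn n\<close> is to
  \<open>K\<close>. The determinants then converge on a fixed disc at rate \<open>q ^ n\<close>, and
  their zeros at a rate weakened by multiplicity. The claim \<open>z \<noteq> 0\<close> is what
  allows a return from operators extended by zero to matrices.\<close>

lemma spectral_approximation: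
  assumes K: "truncation_close K" and Kn: "\<And>n. complex_linear_op (Kn n)"
    and conv: "\<forall>\<^sub>F n in sequentially. norm (K - Kn n) \<le> C * q ^ n"
    and q: "0 < q" "q < 1" and \<mu>: "\<mu> \<in> op_spectrum K" "\<mu> \<noteq> 0"
  obtains q' where "0 < q'" "q' < 1"
    "\<forall>\<^sub>F n in sequentially. \<exists>z. z \<noteq> 0 \<and> op_eigenvalue (Kn n) z \<and> cmod (z - \<mu>) \<le> q' ^ n"
proof -
  have K': "complex_linear_op K" using K by (simp add: truncation_close_def)
  define m where "m = cmod \<mu>"
  have m: "0 < m" using \<mu> by (simp add: m_def)
  obtain N where N: "norm (K - (truncation N o\<^sub>L K)) < m / 4"
    using K m unfolding truncation_close_def by (metis zero_less_divide_iff zero_less_numeral)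
  define A where "A = K - (truncation N o\<^sub>L K)"
  define An where "An n = Kn n - (truncation N o\<^sub>L Kn n)" for n
  have nA: "norm A < m / 4" using N by (simp add: A_def)
  let ?S = "- cball (0::complex) (m / 4)" and ?d = "2 * N - 1"
  \<comment> \<open>On the disc \<open>cmod z \<ge> 3 * m / 4\<close>, while
    \<open>norm A < m / 4\<close>; the gap is at least \<open>m / 2\<close>.\<close>
  define B where "B = 2 / m"
  have B: "0 < B" using m by (simp add: B_def)
  have far: "3 * m / 4 \<le> cmod z" if "z \<in> cball \<mu> (m / 4)" for z
    using that norm_triangle_ineq2[of \<mu> z] by (simp add: m_def dist_norm)
  have RA: "z \<notin> op_spectrum A" "norm (resolvent A z) \<le> B" if "z \<in> cball \<mu> (m / 4)" for z
  proof -
    have z: "norm A < cmod z" "m / 2 \<le> cmod z - norm A" using far[OF that] nA m by linarith+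
    show "z \<notin> op_spectrum A" using resolvent_outside_norm(1)[OF z(1)] .
    have "norm (resolvent A z) \<le> 1 / (cmod z - norm A)" by (rule resolvent_outside_norm(2)[OF z(1)])
    also have "\<dots> \<le> 1 / (m / 2)" using z m by (intro divide_left_mono) auto
    finally show "norm (resolvent A z) \<le> B" by (simp add: B_def)
  qed
  define e where "e j = emb_vec N (unit_vec ?d j)" for j
  define E where "E = (\<Sum>j<?d. norm (e j))"
  have E: "norm (e j) \<le> E" if "j < ?d" for j
    unfolding E_def by (rule member_le_sum) (use that in auto)
  have E0: "0 \<le> E" unfolding E_def by (intro sum_nonneg) auto
  define M where "M = 1 + (norm K + 1) * (2 * B) * E"
  have M: "1 \<le> M" using B E0 by (simp add: M_def)
  define D where "D = (norm K * (2 * B * B) + 2 * B) * E"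
  have D: "0 \<le> D" using B E0 by (simp add: D_def)
  \<comment> \<open>The summand 1 only makes \<open>L\<close> positive when the other term
    vanishes.\<close>
  define L where "L = fact ?d * (real ?d * M ^ ?d) * D * \<bar>C\<bar> + 1"
  have L: "0 < L" using M D by (auto simp: L_def intro!: add_nonneg_pos mult_nonneg_nonneg)
  have hol: "fredholm_det N K holomorphic_on ?S"
    by (rule holomorphic_on_subset[OF holomorphic_fredholm_det[OF K']])
      (use resolvent_outside_norm(1) N in force)
  have ev1: "\<forall>\<^sub>F n in sequentially. norm (Kn n - K) < 1 / (2 * B)"
    by (rule eventually_norm_diff_less[OF conv q]) (use B in simp)
  have ev2: "\<forall>\<^sub>F n in sequentially. norm (Kn n - K) < 1"
    by (rule eventually_norm_diff_less[OF conv q]) simp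
  have "\<forall>\<^sub>F n in sequentially. (\<forall>z\<in>ball \<mu> (m / 4). z \<notin> op_spectrum (An n)) \<and>
      (\<forall>z\<in>ball \<mu> (m / 4). cmod (fredholm_det N (Kn n) z - fredholm_det N K z) \<le> L * q ^ n)"
    using conv ev1 ev2
  proof eventually_elim
    case (elim n)
    define \<delta> where "\<delta> = norm (Kn n - K)"
    have \<delta>: "\<delta> \<le> \<bar>C\<bar> * q ^ n" "\<delta> * B \<le> 1 / 2" "\<delta> \<le> 1" "0 \<le> \<delta>"
    proof -
      have "C * q ^ n \<le> \<bar>C\<bar> * q ^ n" using q by (intro mult_right_mono) auto
      then show "\<delta> \<le> \<bar>C\<bar> * q ^ n" using elim(1) by (simp add: \<delta>_def norm_minus_commute)
      show "\<delta> * B \<le> 1 / 2" using elim(2) B by (simp add: \<delta>_def field_simps)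
    qed (use elim in \<open>auto simp: \<delta>_def\<close>)
    have nK: "norm (Kn n) \<le> norm K + 1"
      using norm_triangle_sub[of "Kn n" K] \<delta>(3) by (simp add: \<delta>_def)
    have dA: "norm (An n - A) \<le> \<delta>"
    proof -
      have eq: "An n - A = (Kn n - K) - (truncation N o\<^sub>L (Kn n - K))"
        by (intro blinfun_eqI) (simp add: An_def A_def blinfun.diff_left blinfun.diff_right)
      show ?thesis unfolding eq \<delta>_def by (rule norm_minus_truncation_compose)
    qed
    have R: "z \<notin> op_spectrum (An n)" "norm (resolvent (An n) z) \<le> 2 * B"
      "norm (resolvent (An n) z - resolvent A z) \<le> 2 * B * B * \<delta>" if z: "z \<in> ball \<mu> (m / 4)" for z
    proof -
      have z': "z \<in> cball \<mu> (m / 4)" using z by simp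
      have small: "(cmod (z - z) + norm (An n - A)) * norm (resolvent A z) \<le> 1 / 2"
        using mult_mono[OF dA RA(2)[OF z']] \<delta> by simp
      note p = resolvent_perturb[OF RA(1)[OF z'] small]
      show "z \<notin> op_spectrum (An n)" by (rule p(1))
      show "norm (resolvent (An n) z) \<le> 2 * B" using p(2) RA(2)[OF z'] by simp
      have "2 * norm (resolvent A z) * norm (resolvent A z) * (cmod (z - z) + norm (An n - A))
          \<le> 2 * B * B * \<delta>"
        using RA(2)[OF z'] dA B by (intro mult_mono mult_nonneg_nonneg) auto
      then show "norm (resolvent (An n) z - resolvent A z) \<le> 2 * B * B * \<delta>"
        using p(3) by linarith
    qed
    have "cmod (fredholm_det N (Kn n) z - fredholm_det N K z) \<le> L * q ^ n" if z: "z \<in> ball \<mu> (m / 4)" for z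
    proof -
      let ?X = "compression N (Kn n o\<^sub>L resolvent (An n) z)" and ?Y = "compression N (K o\<^sub>L resolvent A z)"
      have z': "z \<in> cball \<mu> (m / 4)" using z by simp
      have entX: "?X $$ (i, j) = ell2_nth (Kn n (resolvent (An n) z (e j))) (obs_index N i)"
        and entY: "?Y $$ (i, j) = ell2_nth (K (resolvent A z (e j))) (obs_index N i)"
        if "i < ?d" "j < ?d" for i j using that by (auto simp: compression_def e_def)
      have ap: "norm (T (S (e j))) \<le> a * b * E"
        if "norm T \<le> a" "norm S \<le> b" "j < ?d" for T S :: "ell2 \<Rightarrow>\<^sub>L ell2" and a b j
      proof -
        have "0 \<le> a" "0 \<le> b" using that norm_ge_zero order_trans by blast+
        have "norm (S (e j)) \<le> b * E"
          using norm_blinfun[of S "e j"] mult_mono[OF that(2) E[OF that(3)]] \<open>0 \<le> b\<close> by simp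
        then have "norm (T (S (e j))) \<le> a * (b * E)"
          using norm_blinfun[of T "S (e j)"] mult_mono[OF that(1), of "norm (S (e j))" "b * E"] \<open>0 \<le> a\<close> by simp
        then show ?thesis by (simp add: mult.assoc)
      qed
      have bX: "cmod (?X $$ (i, j)) \<le> (norm K + 1) * (2 * B) * E" if "i < ?d" "j < ?d" for i j
        unfolding entX[OF that] by (rule order_trans[OF ell2_nth_le ap[OF nK R(2)[OF z] that(2)]])
      have bY: "cmod (?Y $$ (i, j)) \<le> (norm K + 1) * (2 * B) * E" if "i < ?d" "j < ?d" for i j
        unfolding entY[OF that] by (rule order_trans[OF ell2_nth_le ap[OF _ _ that(2)]])
          (use RA(2)[OF z'] B in auto)
      have bXY: "cmod (?X $$ (i, j) - ?Y $$ (i, j)) \<le> D * \<delta>" if "i < ?d" "j < ?d" for i j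
      proof -
        have "?X $$ (i, j) - ?Y $$ (i, j) =
            ell2_nth (K ((resolvent (An n) z - resolvent A z) (e j))
              + (Kn n - K) (resolvent (An n) z (e j))) (obs_index N i)"
          unfolding entX[OF that] entY[OF that]
          by (simp add: blinfun.diff_left blinfun.diff_right ell2_nth_simps)
        also have "cmod \<dots> \<le> norm (K ((resolvent (An n) z - resolvent A z) (e j)))
              + norm ((Kn n - K) (resolvent (An n) z (e j)))"
          by (rule order_trans[OF ell2_nth_le norm_triangle_ineq])
        also have "\<dots> \<le> norm K * (2 * B * B * \<delta>) * E + \<delta> * (2 * B) * E"
          using ap[OF order_refl R(3)[OF z] that(2)] ap[OF _ R(2)[OF z] that(2), of "Kn n - K" \<delta>]
          by (intro add_mono) (auto simp: \<delta>_def)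
        also have "\<dots> = D * \<delta>" by (simp add: D_def algebra_simps)
        finally show ?thesis .
      qed
      have one: "cmod (1\<^sub>m ?d $$ (i, j)) \<le> 1" if "i < ?d" "j < ?d" for i j
        using that by simp
      have Xc: "?X \<in> carrier_mat ?d ?d" "?Y \<in> carrier_mat ?d ?d" by (rule compression_carrier)+
      have "cmod (det (1\<^sub>m ?d - ?X) - det (1\<^sub>m ?d - ?Y)) \<le> fact ?d * (real ?d * M ^ ?d) * (D * \<delta>)"
      proof (rule det_lipschitz)
        fix i j assume ij: "i < ?d" "j < ?d"
        have ent: "(1\<^sub>m ?d - ?X) $$ (i, j) = 1\<^sub>m ?d $$ (i, j) - ?X $$ (i, j)"
          "(1\<^sub>m ?d - ?Y) $$ (i, j) = 1\<^sub>m ?d $$ (i, j) - ?Y $$ (i, j)"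
          using ij Xc by (auto simp del: index_one_mat)
        show "cmod ((1\<^sub>m ?d - ?X) $$ (i, j)) \<le> M" "cmod ((1\<^sub>m ?d - ?Y) $$ (i, j)) \<le> M"
          unfolding ent M_def
          by (rule order_trans[OF norm_triangle_ineq4 add_mono[OF one[OF ij]]], rule bX[OF ij] bY[OF ij])+
        show "cmod ((1\<^sub>m ?d - ?X) $$ (i, j) - (1\<^sub>m ?d - ?Y) $$ (i, j)) \<le> D * \<delta>"
          using bXY[OF ij] unfolding ent by (simp add: norm_minus_commute)
      qed (use M D \<delta> Xc in \<open>auto intro!: minus_carrier_mat\<close>)
      also have "\<dots> \<le> fact ?d * (real ?d * M ^ ?d) * (D * (\<bar>C\<bar> * q ^ n))"
        using M D \<delta> by (intro mult_left_mono mult_nonneg_nonneg) auto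
      also have "\<dots> \<le> L * q ^ n" using q by (simp add: L_def algebra_simps)
      finally show ?thesis by (simp add: fredholm_det_def A_def An_def)
    qed
    then show ?case using R(1) by blast
  qed
  note ev = this
  have F: "\<forall>\<^sub>F n in sequentially. fredholm_det N (Kn n) holomorphic_on ball \<mu> (m / 4) \<and>
      (\<forall>z\<in>ball \<mu> (m / 4). cmod (fredholm_det N (Kn n) z - fredholm_det N K z) \<le> L * q ^ n)"
    using ev
  proof eventually_elim
    case (elim n)
    have "fredholm_det N (Kn n) holomorphic_on ball \<mu> (m / 4)"
      by (rule holomorphic_on_subset[OF holomorphic_fredholm_det[OF Kn]])
        (use elim in \<open>auto simp: An_def\<close>)
    then show ?case using elim by blast
  qed
  have conn: "connected ?S" by (rule connected_complement_bounded_convex) auto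
  have \<mu>S: "\<mu> \<in> ?S" using m by (simp add: m_def)
  have f0: "fredholm_det N K \<mu> = 0"
  proof -
    have "norm (K - (truncation N o\<^sub>L K)) < cmod \<mu>" using N m unfolding m_def by linarith
    then show ?thesis using fredholm_det_zero_iff(1)[OF K'] \<mu>(1) by blast
  qed
  have nc: "\<not> fredholm_det N K constant_on ?S"
    by (rule fredholm_det_nonconstant[OF K' less_imp_le[OF N] \<mu>(1)]) (use m in \<open>simp add: m_def\<close>)
  have sub: "cball \<mu> (m / 4) \<subseteq> ?S"
  proof
    fix z assume "z \<in> cball \<mu> (m / 4)"
    then show "z \<in> ?S" using far[of z] m by simp
  qed
  have m4: "0 < m / 4" using m by simp
  obtain q' where q': "0 < q'" "q' < 1" and zer: "\<forall>\<^sub>F n in sequentially. \<exists>z. z \<in> ball \<mu> (m / 4) \<and>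
      fredholm_det N (Kn n) z = 0 \<and> cmod (z - \<mu>) \<le> q' ^ n"
    by (rule zeros_converge_exponentially[OF hol _ conn \<mu>S f0 nc m4 sub F q L]) auto
  have "\<forall>\<^sub>F n in sequentially. \<exists>z. z \<noteq> 0 \<and> op_eigenvalue (Kn n) z \<and> cmod (z - \<mu>) \<le> q' ^ n"
    using zer ev
  proof eventually_elim
    case (elim n)
    then obtain z where z: "z \<in> ball \<mu> (m / 4)" "fredholm_det N (Kn n) z = 0" "cmod (z - \<mu>) \<le> q' ^ n"
      by blast
    have "op_eigenvalue (Kn n) z"
      by (rule fredholm_det_zero_imp_eigenvalue[OF Kn _ z(2)]) (use elim z in \<open>auto simp: An_def\<close>)
    moreover have "z \<noteq> 0" using far[of z] z(1) m by auto
    ultimately show ?case using z(3) by blast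
  qed
  then show ?thesis using that q' by blast
qed

text \<open>Around a regular point the resolvent bound persists under small changes of operator and
  parameter, so \<open>lams n\<close> would eventually be regular for \<open>Kn n\<close> and could
  not be an eigenvalue.\<close>

lemma limit_of_eigenvalues_in_spectrum:
  assumes lim: "lams \<longlonglongrightarrow> \<mu>" and eig: "\<forall>\<^sub>F n in sequentially. op_eigenvalue (Kn n) (lams n)"
    and conv: "(\<lambda>n. norm (Kn n - K)) \<longlonglongrightarrow> 0"
  shows "\<mu> \<in> op_spectrum K"
proof (rule ccontr)
  assume \<mu>: "\<mu> \<notin> op_spectrum K"
  have "(\<lambda>n. (cmod (lams n - \<mu>) + norm (Kn n - K)) * norm (resolvent K \<mu>)) \<longlonglongrightarrow> (cmod (\<mu> - \<mu>) + 0) * norm (resolvent K \<mu>)"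
    by (intro tendsto_intros lim conv)
  then have "\<forall>\<^sub>F n in sequentially. (cmod (lams n - \<mu>) + norm (Kn n - K)) * norm (resolvent K \<mu>) < 1 / 2"
    by (rule order_tendstoD(2)) simp
  then have "\<forall>\<^sub>F n in sequentially. lams n \<notin> op_spectrum (Kn n)"
    by (rule eventually_mono) (rule resolvent_perturb(1)[OF \<mu>], simp)
  with eig have "\<forall>\<^sub>F n in sequentially. False"
    by (rule eventually_elim2) (auto simp: op_eigenvalue_def dest: op_eigenvalue_in_spectrum)
  then show False by simp
qed

section \<open>Riesz projections\<close>

lemma bounded_linear_scalar_op: "bounded_linear scalar_op"
proof (rule bounded_linear_intro[where K = 1])
  show "scalar_op (x + y) = scalar_op x + scalar_op y" for x y
    by (intro blinfun_eqI) (simp add: blinfun.add_left cscale_simps)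
  show "scalar_op (c *\<^sub>R x) = c *\<^sub>R scalar_op x" for c x
    by (intro blinfun_eqI ell2_eqI)
      (simp add: blinfun.scaleR_left ell2_nth_simps scaleR_ell2.rep_eq scaleR_conv_of_real)
  show "norm (scalar_op x) \<le> norm x * 1" for x
    by (rule norm_blinfun_bound) (simp_all add: norm_cscale)
qed

text \<open>The derivative of \<open>circlepath \<mu> \<rho>\<close>, which does not depend on the
  centre.\<close>

definition circle_speed :: "real \<Rightarrow> real \<Rightarrow> complex" where
  "circle_speed \<rho> t = 2 * of_real pi * \<i> * of_real \<rho> * exp (2 * of_real pi * \<i> * of_real t)"

lemma has_contour_integral_circlepath_iff:
  "(f has_contour_integral I) (circlepath \<mu> \<rho>) \<longleftrightarrow>
     ((\<lambda>t. f (circlepath \<mu> \<rho> t) * circle_speed \<rho> t) has_integral I) {0..1}"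
  unfolding has_contour_integral_def
  by (intro has_integral_cong) (simp add: vector_derivative_circlepath01 circle_speed_def mult_ac)

lemma circlepath_on_sphere: "0 < \<rho> \<Longrightarrow> dist \<mu> (circlepath \<mu> \<rho> t) = \<rho>"
  by (simp add: circlepath dist_norm norm_mult norm_exp_eq_Re)

text \<open>Evaluation at a vector is pulled through the operator-valued integral. The weight is
  kept general for two uses: \<open>circle_speed \<rho>\<close> for the Riesz projection, and its
  quotient by \<open>z\<close> in the proof of finite multiplicity.\<close>

lemma has_integral_resolvent_circle:
  assumes \<rho>: "0 < \<rho>" "op_spectrum T \<inter> sphere \<mu> \<rho> = {}" and w: "continuous_on {0..1} w"
  shows "((\<lambda>t. cscale (w t) (resolvent T (circlepath \<mu> \<rho> t) x)) has_integral
      (integral {0..1} (\<lambda>t. scalar_op (w t) o\<^sub>L resolvent T (circlepath \<mu> \<rho> t))) x) {0..1}"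
proof -
  let ?f = "\<lambda>t. scalar_op (w t) o\<^sub>L resolvent T (circlepath \<mu> \<rho> t)"
  have "continuous_on {0..1} (\<lambda>t. resolvent T (circlepath \<mu> \<rho> t))"
  proof (rule continuous_on_compose2[OF continuous_on_resolvent])
    show "continuous_on {0..1} (circlepath \<mu> \<rho>)"
      using valid_path_circlepath[of \<mu> \<rho>] valid_path_imp_path path_def by blast
    show "circlepath \<mu> \<rho> ` {0..1} \<subseteq> - op_spectrum T"
      using circlepath_on_sphere[OF \<rho>(1)] \<rho>(2) by (auto simp: disjoint_iff)
  qed
  then have "continuous_on {0..1} ?f"
    by (intro bounded_bilinear.continuous_on[OF bounded_bilinear_blinfun_compose]
        linear_continuous_on_compose[OF w bounded_linear.linear[OF bounded_linear_scalar_op]]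
        bounded_linear.continuous_on[OF bounded_linear_scalar_op] w)
  then have "(?f has_integral integral {0..1} ?f) {0..1}"
    by (intro integrable_integral integrable_continuous_interval)
  from has_integral_linear[OF this blinfun.bounded_linear_left[of x]]
  show ?thesis by (simp add: o_def)
qed

text \<open>With \<open>N = \<mu> - T\<close> one has \<open>z - T = (z - \<mu>) + N\<close>. The
  Neumann series in \<open>N / (z - \<mu>)\<close> terminates on \<open>h\<close>, so it needs no
  smallness; the partial sums telescope.\<close>

lemma resolvent_gen_eigenvector:
  assumes T: "complex_linear_op T" and z: "z \<notin> op_spectrum T" "z \<noteq> \<mu>"
    and h: "(blinfun_apply (scalar_op \<mu> - T) ^^ \<nu>) h = 0"
  shows "resolvent T z h =
    (\<Sum>j<\<nu>. cscale ((-1) ^ j * inverse ((z - \<mu>) ^ Suc j)) ((blinfun_apply (scalar_op \<mu> - T) ^^ j) h))"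
proof -
  let ?N = "blinfun_apply (scalar_op \<mu> - T)"
  define c where "c j = (-1) ^ j * inverse ((z - \<mu>) ^ Suc j)" for j :: nat
  have N: "complex_linear_op (scalar_op \<mu> - T)" by (rule complex_linear_op_scalar_minus[OF T])
  have step: "cscale z (cscale (c j) y) - T (cscale (c j) y)
      = cscale ((-1) ^ j * inverse ((z - \<mu>) ^ j)) y
        - cscale ((-1) ^ Suc j * inverse ((z - \<mu>) ^ Suc j)) (?N y)" for j y
  proof -
    have "cscale z (cscale (c j) y) - T (cscale (c j) y)
        = cscale (z - \<mu>) (cscale (c j) y) + ?N (cscale (c j) y)"
      by (simp add: blinfun.diff_left cscale_simps algebra_simps)
    also have "?N (cscale (c j) y) = cscale (c j) (?N y)" using N by (simp add: complex_linear_op_def)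
    also have "cscale (z - \<mu>) (cscale (c j) y) = cscale ((-1) ^ j * inverse ((z - \<mu>) ^ j)) y"
    proof -
      have unit: "u * ((-1) ^ j * inverse (u ^ Suc j)) = (-1) ^ j * inverse (u ^ j)" if "u \<noteq> 0" for u :: complex
        using that by (simp add: field_simps)
      have "z - \<mu> \<noteq> 0" using z(2) by simp
      then have "(z - \<mu>) * c j = (-1) ^ j * inverse ((z - \<mu>) ^ j)" unfolding c_def by (rule unit)
      then show ?thesis by (simp only: cscale_simps(5))
    qed
    also have "cscale (c j) (?N y) = - cscale ((-1) ^ Suc j * inverse ((z - \<mu>) ^ Suc j)) (?N y)"
      unfolding c_def cscale_simps(10)[symmetric] by simp
    finally show ?thesis by simp
  qed
  have "cscale z (\<Sum>j<k. cscale (c j) ((?N ^^ j) h)) - T (\<Sum>j<k. cscale (c j) ((?N ^^ j) h))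
      = h - cscale ((-1) ^ k * inverse ((z - \<mu>) ^ k)) ((?N ^^ k) h)" for k
  proof (induction k)
    case 0
    show ?case by (simp add: cscale_simps blinfun.zero_right)
  next
    case (Suc k)
    let ?s = "\<Sum>j<k. cscale (c j) ((?N ^^ j) h)" and ?y = "cscale (c k) ((?N ^^ k) h)"
    have "cscale z (?s + ?y) - T (?s + ?y) = (cscale z ?s - T ?s) + (cscale z ?y - T ?y)"
      by (simp add: cscale_simps blinfun.add_right)
    then show ?case using Suc step[of k "(?N ^^ k) h"] by simp
  qed
  from this[of \<nu>] have "cscale z (\<Sum>j<\<nu>. cscale (c j) ((?N ^^ j) h)) - T (\<Sum>j<\<nu>. cscale (c j) ((?N ^^ j) h)) = h"
    using h by (simp add: cscale_simps)
  then show ?thesis using resolvent_apply(1)[OF z(1)] by (metis (no_types, lifting) c_def sum.cong)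
qed

lemma circle_integral_power:
  assumes "0 < \<rho>" "dist \<mu> \<nu> < \<rho>"
  shows "((\<lambda>t. inverse ((circlepath \<mu> \<rho> t - \<nu>) ^ Suc j) * circle_speed \<rho> t) has_integral
     (if j = 0 then 2 * of_real pi * \<i> else 0)) {0..1}"
proof -
  have "\<nu> \<in> ball \<mu> \<rho>" using assms by simp
  note C = Cauchy_has_contour_integral_higher_derivative_circlepath[where f = "\<lambda>_. 1" and k = j,
      OF continuous_on_const holomorphic_on_const this]
  show ?thesis
    using C[unfolded has_contour_integral_circlepath_iff]
    by (cases "j = 0") (simp_all add: inverse_eq_divide higher_deriv_const)
qed

text \<open>Only the simple pole of the finite expansion contributes, and its coefficient is
  \<open>h\<close> itself. The eigenvalue \<open>\<mu>'\<close> may be anywhere inside the circle,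
  since the eigenvalues of the approximations lie near the centre but not on it.\<close>

lemma circle_integral_gen_eigenvector:
  assumes T: "complex_linear_op T" and \<rho>: "0 < \<rho>" "op_spectrum T \<inter> sphere \<mu> \<rho> = {}"
    and \<mu>': "dist \<mu> \<mu>' < \<rho>" and h: "(blinfun_apply (scalar_op \<mu>' - T) ^^ \<nu>) h = 0"
  shows "((\<lambda>t. cscale (circle_speed \<rho> t) (resolvent T (circlepath \<mu> \<rho> t) h)) has_integral
    cscale (2 * of_real pi * \<i>) h) {0..1}"
proof -
  let ?N = "blinfun_apply (scalar_op \<mu>' - T)"
  let ?c = "\<lambda>j t. inverse ((circlepath \<mu> \<rho> t - \<mu>') ^ Suc j) * circle_speed \<rho> t"
  have "((\<lambda>t. \<Sum>j<\<nu>. cscale (?c j t) (cscale ((-1) ^ j) ((?N ^^ j) h))) has_integral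
      (\<Sum>j<\<nu>. cscale (if j = 0 then 2 * of_real pi * \<i> else 0) (cscale ((-1) ^ j) ((?N ^^ j) h)))) {0..1}"
    by (intro has_integral_sum finite_lessThan
        has_integral_linear[OF circle_integral_power bounded_linear_cscale_left, unfolded o_def] \<rho> \<mu>')
  moreover have "(\<Sum>j<\<nu>. cscale (if j = 0 then 2 * of_real pi * \<i> else 0) (cscale ((-1) ^ j) ((?N ^^ j) h)))
      = cscale (2 * of_real pi * \<i>) h"
  proof (cases \<nu>)
    case 0
    then show ?thesis using h by (simp add: cscale_simps)
  next
    case (Suc k)
    show ?thesis unfolding Suc sum.lessThan_Suc_shift by (simp add: cscale_simps)
  qed
  moreover have "cscale (circle_speed \<rho> t) (resolvent T (circlepath \<mu> \<rho> t) h)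
      = (\<Sum>j<\<nu>. cscale (?c j t) (cscale ((-1) ^ j) ((?N ^^ j) h)))" for t
  proof -
    let ?z = "circlepath \<mu> \<rho> t"
    have d: "dist \<mu> ?z = \<rho>" by (rule circlepath_on_sphere[OF \<rho>(1)])
    have z: "?z \<notin> op_spectrum T" using d \<rho>(2) by (auto simp: disjoint_iff)
    have z': "?z \<noteq> \<mu>'" using d \<mu>' by auto
    have "cscale a (\<Sum>j<k. f j) = (\<Sum>j<k. cscale a (f j))" for a f and k :: nat
      by (induction k) (simp_all add: cscale_simps)
    then show ?thesis
      unfolding resolvent_gen_eigenvector[OF T z z' h] by (simp add: cscale_simps mult_ac)
  qed
  ultimately show ?thesis by simp
qed

lemma disjoint_sphere_if_isolated:
  fixes \<mu> :: "'a::metric_space"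
  assumes "0 < \<rho>" "S \<inter> cball \<mu> \<rho> = {\<mu>}" shows "S \<inter> sphere \<mu> \<rho> = {}"
proof -
  have "z = \<mu>" if "z \<in> S" "dist \<mu> z = \<rho>" for z
    using assms(2) that by (metis IntI mem_cball order_refl singletonD)
  then show ?thesis using assms(1) by fastforce
qed

text \<open>The bound \<open>\<rho> < cmod \<mu>\<close> keeps zero outside the circle, so that
  \<open>1 / z\<close> can be integrated along it without a residue.\<close>

lemma isolated_spectral_point:
  assumes K: "truncation_close K" and \<mu>: "\<mu> \<in> op_spectrum K" "\<mu> \<noteq> 0"
  obtains \<rho> where "0 < \<rho>" "\<rho> < cmod \<mu>" "op_spectrum K \<inter> cball \<mu> \<rho> = {\<mu>}"
proof -
  let ?F = "{z \<in> op_spectrum K. cmod \<mu> / 2 \<le> cmod z} - {\<mu>}"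
  have "finite ?F" using finite_spectrum_away_from_zero[OF K, of "cmod \<mu> / 2"] \<mu> by simp
  then obtain d where d: "0 < d" "\<And>z. z \<in> ?F \<Longrightarrow> z \<noteq> \<mu> \<Longrightarrow> d \<le> dist \<mu> z"
    using finite_set_avoid[of ?F \<mu>] by metis
  define \<rho> where "\<rho> = min d (cmod \<mu>) / 2"
  have \<rho>: "0 < \<rho>" "\<rho> < d" "\<rho> \<le> cmod \<mu> / 2" using d \<mu> by (auto simp: \<rho>_def)
  have "z = \<mu>" if "z \<in> op_spectrum K" "dist \<mu> z \<le> \<rho>" for z
  proof (rule ccontr)
    assume "z \<noteq> \<mu>"
    moreover have "cmod \<mu> / 2 \<le> cmod z"
      using that(2) \<rho>(3) norm_triangle_ineq2[of \<mu> z] by (simp add: dist_norm)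
    ultimately show False using d(2)[of z] that \<rho>(2) by force
  qed
  then have "op_spectrum K \<inter> cball \<mu> \<rho> = {\<mu>}" using \<mu>(1) \<rho>(1) by auto
  moreover have "\<rho> < cmod \<mu>" using \<rho> \<mu> by simp
  ultimately show ?thesis using that \<rho>(1) by blast
qed

text \<open>The radius is the one chosen inside \<open>riesz_projection\<close>, of which nothing
  but the isolation of \<open>\<mu>\<close> is known; later estimates therefore work on this circle
  whatever its size.\<close>

lemma riesz_projection_has_integral:
  assumes K: "truncation_close K" and \<mu>: "\<mu> \<in> op_spectrum K" "\<mu> \<noteq> 0"
  obtains \<rho> where "0 < \<rho>" "op_spectrum K \<inter> sphere \<mu> \<rho> = {}"
    "\<And>x. \<exists>I. ((\<lambda>t. cscale (circle_speed \<rho> t) (resolvent K (circlepath \<mu> \<rho> t) x)) has_integral I) {0..1} \<and>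
       riesz_projection K \<mu> x = cscale (1 / (2 * of_real pi * \<i>)) I"
proof -
  define \<rho> where "\<rho> = (SOME \<rho>. 0 < \<rho> \<and> op_spectrum K \<inter> cball \<mu> \<rho> = {\<mu>})"
  have "\<exists>\<rho>. 0 < \<rho> \<and> op_spectrum K \<inter> cball \<mu> \<rho> = {\<mu>}"
    using isolated_spectral_point[OF assms] by metis
  from someI_ex[OF this] have \<rho>: "0 < \<rho>" "op_spectrum K \<inter> cball \<mu> \<rho> = {\<mu>}" by (simp_all add: \<rho>_def)
  have disj: "op_spectrum K \<inter> sphere \<mu> \<rho> = {}" by (rule disjoint_sphere_if_isolated[OF \<rho>])
  let ?I = "integral {0..1} (\<lambda>t. scalar_op (circle_speed \<rho> t) o\<^sub>L resolvent K (circlepath \<mu> \<rho> t))"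
  have "integral {0..1} (\<lambda>t. scalar_op (vector_derivative (circlepath \<mu> \<rho>) (at t within {0..1}))
      o\<^sub>L resolvent K (circlepath \<mu> \<rho> t)) = ?I"
    by (intro integral_cong) (simp add: vector_derivative_circlepath01 circle_speed_def)
  then have riesz: "riesz_projection K \<mu> x = cscale (1 / (2 * of_real pi * \<i>)) (?I x)" for x
    unfolding riesz_projection_def Let_def \<rho>_def[symmetric] by simp
  have cont: "continuous_on {0..1} (circle_speed \<rho>)"
    unfolding circle_speed_def by (intro continuous_intros)
  show ?thesis
    using that[OF \<rho>(1) disj] has_integral_resolvent_circle[OF \<rho>(1) disj cont] riesz by blast
qed

text \<open>The circle integral of the resolvent of \<open>Kn n\<close> reproduces
  \<open>h n\<close> exactly, so the error is the integral of a resolvent difference, of order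
  \<open>q ^ n\<close> uniformly on the circle. The order \<open>\<nu>\<close> of the generalised
  eigenvector does not enter the bound.\<close>

lemma riesz_projection_approximation:
  assumes K: "truncation_close K" and Kn: "\<And>n. complex_linear_op (Kn n)"
    and conv: "\<forall>\<^sub>F n in sequentially. norm (K - Kn n) \<le> C * q ^ n"
    and q: "0 < q" "q < 1" and \<mu>: "\<mu> \<in> op_spectrum K" "\<mu> \<noteq> 0" and lams: "lams \<longlonglongrightarrow> \<mu>"
    and h: "\<forall>\<^sub>F n in sequentially. norm (h n) = 1 \<and> (\<exists>\<nu>. (blinfun_apply (scalar_op (lams n) - Kn n) ^^ \<nu>) (h n) = 0)"
  obtains D where "\<forall>\<^sub>F n in sequentially. norm (riesz_projection K \<mu> (h n) - h n) \<le> D * q ^ n"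
proof -
  obtain \<rho> where \<rho>: "0 < \<rho>" "op_spectrum K \<inter> sphere \<mu> \<rho> = {}"
    and riesz: "\<And>x. \<exists>I. ((\<lambda>t. cscale (circle_speed \<rho> t) (resolvent K (circlepath \<mu> \<rho> t) x)) has_integral I) {0..1} \<and>
       riesz_projection K \<mu> x = cscale (1 / (2 * of_real pi * \<i>)) I"
    by (rule riesz_projection_has_integral[OF K \<mu>]) (rule that; assumption)
  have "continuous_on (sphere \<mu> \<rho>) (resolvent K)"
    by (rule continuous_on_subset[OF continuous_on_resolvent]) (use \<rho>(2) in auto)
  then have "bounded (resolvent K ` sphere \<mu> \<rho>)"
    by (intro compact_imp_bounded compact_continuous_image) auto
  then obtain B where B: "0 < B" "\<And>z. z \<in> sphere \<mu> \<rho> \<Longrightarrow> norm (resolvent K z) \<le> B"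
    unfolding bounded_pos by auto
  have ev1: "\<forall>\<^sub>F n in sequentially. norm (Kn n - K) < 1 / (2 * B)"
    by (rule eventually_norm_diff_less[OF conv q]) (use B in simp)
  have ev2: "\<forall>\<^sub>F n in sequentially. dist (lams n) \<mu> < \<rho>"
    using lams \<rho>(1) by (rule tendstoD)
  have "\<forall>\<^sub>F n in sequentially. norm (riesz_projection K \<mu> (h n) - h n) \<le> (\<rho> * (2 * B * B) * C) * q ^ n"
    using conv ev1 ev2 h
  proof eventually_elim
    case (elim n)
    define \<delta> where "\<delta> = norm (Kn n - K)"
    have \<delta>: "\<delta> * B \<le> 1 / 2" using elim(2) B by (simp add: \<delta>_def field_simps)
    have R: "z \<notin> op_spectrum (Kn n)" "norm (resolvent (Kn n) z - resolvent K z) \<le> 2 * B * B * \<delta>"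
      if z: "z \<in> sphere \<mu> \<rho>" for z
    proof -
      have zs: "z \<notin> op_spectrum K" using z \<rho>(2) by auto
      have "\<delta> * norm (resolvent K z) \<le> \<delta> * B" by (intro mult_left_mono B z) (simp add: \<delta>_def)
      then have small: "(cmod (z - z) + norm (Kn n - K)) * norm (resolvent K z) \<le> 1 / 2"
        using \<delta> by (simp add: \<delta>_def)
      note p = resolvent_perturb[OF zs small]
      show "z \<notin> op_spectrum (Kn n)" by (rule p(1))
      have "2 * norm (resolvent K z) * norm (resolvent K z) * (cmod (z - z) + norm (Kn n - K)) \<le> 2 * B * B * \<delta>"
        using B(2)[OF z] B(1) by (intro mult_mono mult_nonneg_nonneg) (auto simp: \<delta>_def)
      then show "norm (resolvent (Kn n) z - resolvent K z) \<le> 2 * B * B * \<delta>" using p(3) by linarith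
    qed
    have disj: "op_spectrum (Kn n) \<inter> sphere \<mu> \<rho> = {}" using R(1) by auto
    obtain \<nu> where \<nu>: "(blinfun_apply (scalar_op (lams n) - Kn n) ^^ \<nu>) (h n) = 0" using elim(4) by blast
    have d: "dist \<mu> (lams n) < \<rho>" using elim(3) by (simp add: dist_commute)
    obtain I where I: "((\<lambda>t. cscale (circle_speed \<rho> t) (resolvent K (circlepath \<mu> \<rho> t) (h n))) has_integral I) {0..1}"
      "riesz_projection K \<mu> (h n) = cscale (1 / (2 * of_real pi * \<i>)) I" using riesz by blast
    note J = circle_integral_gen_eigenvector[OF Kn \<rho>(1) disj d \<nu>]
    have "norm (I - cscale (2 * of_real pi * \<i>) (h n)) \<le> (2 * pi * \<rho> * (2 * B * B * \<delta>)) * measure lborel {0..1::real}"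
    proof (rule has_integral_bound[where a = 0 and b = "1::real", unfolded box_real])
      show "0 \<le> 2 * pi * \<rho> * (2 * B * B * \<delta>)" using \<rho> B by (simp add: \<delta>_def)
      show "((\<lambda>t. cscale (circle_speed \<rho> t) (resolvent K (circlepath \<mu> \<rho> t) (h n))
          - cscale (circle_speed \<rho> t) (resolvent (Kn n) (circlepath \<mu> \<rho> t) (h n))) has_integral
          I - cscale (2 * of_real pi * \<i>) (h n)) {0..1}"
        by (rule has_integral_diff[OF I(1) J])
      fix t :: real assume "t \<in> {0..1}"
      let ?z = "circlepath \<mu> \<rho> t"
      have z: "?z \<in> sphere \<mu> \<rho>" using circlepath_on_sphere[OF \<rho>(1)] by simp
      have "norm ((resolvent K ?z - resolvent (Kn n) ?z) (h n)) \<le> 2 * B * B * \<delta>"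
        using norm_blinfun[of "resolvent K ?z - resolvent (Kn n) ?z" "h n"] R(2)[OF z] elim(4)
        by (simp add: norm_minus_commute)
      moreover have "cmod (circle_speed \<rho> t) = 2 * pi * \<rho>"
        using \<rho>(1) by (simp add: circle_speed_def norm_mult norm_exp_eq_Re)
      ultimately show "norm (cscale (circle_speed \<rho> t) (resolvent K ?z (h n))
          - cscale (circle_speed \<rho> t) (resolvent (Kn n) ?z (h n))) \<le> 2 * pi * \<rho> * (2 * B * B * \<delta>)"
        using \<rho>(1) by (simp add: norm_cscale blinfun.diff_left flip: cscale_simps(2))
    qed
    then have le: "norm (I - cscale (2 * of_real pi * \<i>) (h n)) \<le> 2 * pi * \<rho> * (2 * B * B * \<delta>)" by simp
    have "riesz_projection K \<mu> (h n) - h n = cscale (1 / (2 * of_real pi * \<i>)) (I - cscale (2 * of_real pi * \<i>) (h n))"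
      unfolding I(2) by (simp add: cscale_simps)
    then have "norm (riesz_projection K \<mu> (h n) - h n) = 1 / (2 * pi) * norm (I - cscale (2 * of_real pi * \<i>) (h n))"
      by (simp add: norm_cscale norm_divide norm_mult)
    also have "\<dots> \<le> 1 / (2 * pi) * (2 * pi * \<rho> * (2 * B * B * \<delta>))"
      by (rule mult_left_mono[OF le]) simp
    also have "\<dots> = \<rho> * (2 * B * B) * \<delta>" by simp
    also have "\<dots> \<le> \<rho> * (2 * B * B) * (C * q ^ n)"
      using elim(1) \<rho>(1) B(1) by (intro mult_left_mono) (auto simp: \<delta>_def norm_minus_commute)
    finally show ?case by (simp add: mult.assoc)
  qed
  then show ?thesis by (rule that)
qed

text \<open>On the generalised eigenspace, \<open>K Q\<close> is the identity for
  \<open>Q = 1/(2 \<pi> i) \<integral> z\<^sup>-\<^sup>1 (z - K)\<^sup>-\<^sup>1 dz\<close>; since \<open>K Q\<close> is close to the finite-rank operator \<open>P K Q\<close>, the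
  eigenspace is contained in the image of the range of \<open>P\<close> under an invertible operator.\<close>

lemma finite_alg_multiplicity:
  assumes K: "truncation_close K" and \<mu>: "\<mu> \<in> op_spectrum K" "\<mu> \<noteq> 0"
  shows "finite_alg_multiplicity K \<mu>"
proof -
  have K': "complex_linear_op K" using K by (simp add: truncation_close_def)
  obtain \<rho> where \<rho>: "0 < \<rho>" "\<rho> < cmod \<mu>" "op_spectrum K \<inter> cball \<mu> \<rho> = {\<mu>}"
    by (rule isolated_spectral_point[OF K \<mu>])
  have disj: "op_spectrum K \<inter> sphere \<mu> \<rho> = {}" by (rule disjoint_sphere_if_isolated[OF \<rho>(1,3)])
  let ?\<gamma> = "circlepath \<mu> \<rho>" and ?\<pi> = "2 * of_real pi * \<i> :: complex"
  have dist: "dist \<mu> (?\<gamma> t) = \<rho>" for t by (rule circlepath_on_sphere[OF \<rho>(1)])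
  have nz: "?\<gamma> t \<noteq> 0" for t using dist[of t] \<rho>(2) by auto
  \<comment> \<open>Dividing by \<open>z\<close> builds an inverse of \<open>K\<close> on the
    eigenspace: \<open>K (z - K)^-1 / z = (z - K)^-1 - 1 / z\<close>, where the last term integrates
    to 0 because the circle does not enclose zero.\<close>
  define w where "w = (\<lambda>t. circle_speed \<rho> t / ?\<gamma> t)"
  have w: "continuous_on {0..1} w"
    unfolding w_def circle_speed_def circlepath
    by (intro continuous_intros) (use nz in \<open>auto simp: circlepath\<close>)
  define Q where "Q = scalar_op (1 / ?\<pi>) o\<^sub>L integral {0..1} (\<lambda>t. scalar_op (w t) o\<^sub>L resolvent K (?\<gamma> t))"
  have w0: "(w has_integral 0) {0..1}"
  proof -
    have "((\<lambda>z. 1 / z) has_contour_integral 0) ?\<gamma>"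
      by (rule Cauchy_theorem_disc_simple[where a = \<mu> and e = "cmod \<mu>"])
        (use \<rho> dist in \<open>auto intro!: holomorphic_intros simp: path_image_circlepath\<close>)
    then show ?thesis by (simp add: has_contour_integral_circlepath_iff w_def field_simps)
  qed
  have KQ: "K (Q x) = x" if x: "x \<in> gen_eigenspace K \<mu>" for x
  proof -
    obtain \<nu> where \<nu>: "(blinfun_apply (scalar_op \<mu> - K) ^^ \<nu>) x = 0" using x by (auto simp: gen_eigenspace_def)
    let ?J = "(integral {0..1} (\<lambda>t. scalar_op (w t) o\<^sub>L resolvent K (?\<gamma> t))) x"
    have "((\<lambda>t. K (cscale (w t) (resolvent K (?\<gamma> t) x))) has_integral K ?J) {0..1}"
      using has_integral_linear[OF has_integral_resolvent_circle[OF \<rho>(1) disj w, of x] blinfun.bounded_linear_right[of K]]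
      by (simp add: o_def)
    moreover have "K (cscale (w t) (resolvent K (?\<gamma> t) x))
        = cscale (circle_speed \<rho> t) (resolvent K (?\<gamma> t) x) - cscale (w t) x" for t
    proof -
      have z: "?\<gamma> t \<notin> op_spectrum K" using dist[of t] disj by (auto simp: disjoint_iff)
      have "K (resolvent K (?\<gamma> t) x) = cscale (?\<gamma> t) (resolvent K (?\<gamma> t) x) - x"
        using resolvent_apply(2)[OF z, of x] by (simp add: algebra_simps)
      then show ?thesis
        using K' nz[of t] by (simp add: complex_linear_op_def cscale_simps w_def)
    qed
    moreover have "((\<lambda>t. cscale (circle_speed \<rho> t) (resolvent K (?\<gamma> t) x) - cscale (w t) x)
        has_integral cscale ?\<pi> x - cscale 0 x) {0..1}"
      by (intro has_integral_diff circle_integral_gen_eigenvector[OF K' \<rho>(1) disj _ \<nu>]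
          has_integral_linear[OF w0 bounded_linear_cscale_left, unfolded o_def]) (use \<rho> in simp)
    ultimately have "K ?J = cscale ?\<pi> x"
      by (simp add: cscale_simps has_integral_unique)
    then show ?thesis using K' by (simp add: Q_def complex_linear_op_def cscale_simps)
  qed
  have "0 < 1 / (norm Q + 1)" by (simp add: add_nonneg_pos)
  then obtain N where N: "norm (K - (truncation N o\<^sub>L K)) < 1 / (norm Q + 1)"
    using K unfolding truncation_close_def by blast
  define V where "V = (K - (truncation N o\<^sub>L K)) o\<^sub>L Q"
  have "norm V \<le> norm (K - (truncation N o\<^sub>L K)) * norm Q" unfolding V_def by (rule norm_blinfun_compose)
  also have "\<dots> \<le> 1 / (norm Q + 1) * norm Q" by (intro mult_right_mono less_imp_le[OF N]) simp
  also have "\<dots> < 1" by (simp add: add_nonneg_pos)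
  finally obtain S where S: "\<And>x. blinfun_apply S (x - V x) = x" "\<And>y. S y - V (S y) = y"
    by (rule neumann_inverse) blast
  interpret vs: vector_space cscale by (rule vector_space_cscale)
  let ?e = "\<lambda>j. emb_vec N (unit_vec (2 * N - 1) j)"
  \<comment> \<open>Both \<open>?e j\<close> and its multiple by \<open>\<i>\<close> are listed
    because the Neumann inverse \<open>S\<close> is only known to be real-linear.\<close>
  define B where "B = (\<lambda>j. S (?e j)) ` {..<2 * N - 1} \<union> (\<lambda>j. S (cscale \<i> (?e j))) ` {..<2 * N - 1}"
  have scaleR: "a *\<^sub>R y = cscale (of_real a) y" for a y
    by (intro ell2_eqI) (simp add: ell2_nth_simps scaleR_ell2.rep_eq scaleR_conv_of_real)
  have "x \<in> vs.span B" if x: "x \<in> gen_eigenspace K \<mu>" for x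
  proof -
    have "x - V x = truncation N x"
      using KQ[OF x] by (simp add: V_def blinfun.diff_left)
    also have "\<dots> = emb_vec N (section_vec N x)" by (rule truncation_eq)
    also have "\<dots> = (\<Sum>j<2 * N - 1. cscale (section_vec N x $ j) (?e j))"
      by (rule emb_vec_expand[OF section_vec_carrier])
    finally have "x = S (\<Sum>j<2 * N - 1. cscale (section_vec N x $ j) (?e j))" using S(1)[of x] by simp
    also have "\<dots> = (\<Sum>j<2 * N - 1. S (cscale (section_vec N x $ j) (?e j)))" by (rule blinfun.sum_right)
    also have "\<dots> \<in> vs.span B"
    proof (rule vs.span_sum)
      fix j assume j: "j \<in> {..<2 * N - 1}"
      let ?c = "section_vec N x $ j"
      have "cscale ?c (?e j) = Re ?c *\<^sub>R ?e j + Im ?c *\<^sub>R cscale \<i> (?e j)"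
        unfolding scaleR cscale_simps(5) cscale_simps(3)[symmetric]
        by (metis complex_eq mult.commute)
      then have eq: "S (cscale ?c (?e j)) = cscale (of_real (Re ?c)) (S (?e j)) + cscale (of_real (Im ?c)) (S (cscale \<i> (?e j)))"
        by (simp add: blinfun.add_right blinfun.scaleR_right) (simp add: scaleR)
      have "S (?e j) \<in> B" "S (cscale \<i> (?e j)) \<in> B" using j by (auto simp: B_def)
      then show "S (cscale ?c (?e j)) \<in> vs.span B"
        unfolding eq by (intro vs.span_add vs.span_scale vs.span_base)
    qed
    finally show ?thesis .
  qed
  moreover have "finite B" by (simp add: B_def)
  ultimately show ?thesis unfolding finite_alg_multiplicity_def by blast
qed

section \<open>Holomorphic functions on annuli\<close>

lemma fourier_coeff_contour:
  assumes f: "continuous_on (sphere 0 1) f"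
  shows "fourier_coeff f k = contour_integral (circlepath 0 1) (\<lambda>z. f z * z powi (- k - 1)) / (2 * of_real pi * \<i>)"
proof -
  let ?g = "\<lambda>t. f (cis t) * cis (- (of_int k * t))"
  have "(?g has_integral integral {0..2 * pi} ?g) {0..2 * pi}"
    by (intro integrable_integral fourier_integrable f)
  from has_integral_stretch_real[OF this, of "2 * pi"]
  have "((\<lambda>t. ?g (2 * pi * t)) has_integral (1 / (2 * pi)) *\<^sub>R integral {0..2 * pi} ?g) {0..1}"
    by (simp add: image_divide_atLeastAtMost)
  then have "((\<lambda>t. 2 * of_real pi * \<i> * ?g (2 * pi * t)) has_integral
      2 * of_real pi * \<i> * ((1 / (2 * pi)) *\<^sub>R integral {0..2 * pi} ?g)) {0..1}"
    by (rule has_integral_mult_right)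
  moreover have "(\<lambda>t. 2 * of_real pi * \<i> * ?g (2 * pi * t)) =
      (\<lambda>t. (f (circlepath 0 1 t) * circlepath 0 1 t powi (- k - 1)) * circle_speed 1 t)"
  proof
    fix t :: real
    have c: "circlepath 0 1 t = cis (2 * pi * t)"
      by (simp add: circlepath cis_conv_exp mult_ac)
    have "cis (2 * pi * t) powi (- k - 1) * cis (2 * pi * t) = cis (- (of_int k * (2 * pi * t)))"
      by (simp add: cis_power_int cis_mult algebra_simps)
    moreover have "circle_speed 1 t = 2 * of_real pi * \<i> * cis (2 * pi * t)"
      by (simp add: circle_speed_def cis_conv_exp mult_ac)
    ultimately show "2 * of_real pi * \<i> * ?g (2 * pi * t)
        = (f (circlepath 0 1 t) * circlepath 0 1 t powi (- k - 1)) * circle_speed 1 t"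
      unfolding c by (simp add: mult_ac)
  qed
  ultimately have "((\<lambda>z. f z * z powi (- k - 1)) has_contour_integral
      2 * of_real pi * \<i> * ((1 / (2 * pi)) *\<^sub>R integral {0..2 * pi} ?g)) (circlepath 0 1)"
    by (simp add: has_contour_integral_circlepath_iff)
  then have "contour_integral (circlepath 0 1) (\<lambda>z. f z * z powi (- k - 1))
      = 2 * of_real pi * \<i> * ((1 / (2 * pi)) *\<^sub>R integral {0..2 * pi} ?g)"
    by (rule contour_integral_unique)
  then show ?thesis by (simp add: fourier_coeff_def scaleR_conv_of_real)
qed

lemma contour_integral_circle_shift:
  assumes f: "f holomorphic_on annulus s" and s: "0 < s" and a: "s < a" "a < inverse s" and b: "s < b" "b < inverse s"
  shows "contour_integral (circlepath 0 a) f = contour_integral (circlepath 0 b) f"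
proof (rule Cauchy_theorem_homotopic_loops[OF _ open_annulus f])
  show "homotopic_loops (annulus s) (circlepath 0 a) (circlepath 0 b)"
  proof (rule homotopic_loops_linear)
    fix t :: real
    let ?e = "exp (2 * of_real pi * \<i> * of_real t)"
    show "closed_segment (circlepath 0 a t) (circlepath 0 b t) \<subseteq> annulus s"
    proof
      fix z assume "z \<in> closed_segment (circlepath 0 a t) (circlepath 0 b t)"
      then obtain u where u: "0 \<le> u" "u \<le> 1" "z = (1 - u) *\<^sub>R circlepath 0 a t + u *\<^sub>R circlepath 0 b t"
        by (auto simp: closed_segment_def)
      have "z = of_real ((1 - u) * a + u * b) * ?e"
        unfolding u(3) by (simp add: circlepath scaleR_conv_of_real algebra_simps)
      moreover have "0 \<le> (1 - u) * a + u * b" using u s a b by simp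
      ultimately have z: "cmod z = (1 - u) * a + u * b"
        by (simp add: norm_mult norm_exp_eq_Re del: of_real_add of_real_mult)
      have "min a b \<le> (1 - u) * a + u * b" "(1 - u) * a + u * b \<le> max a b"
        using u convex_bound_le[of a "max a b" b "1 - u" u] convex_bound_le[of "- a" "- min a b" "- b" "1 - u" u]
        by auto
      then show "z \<in> annulus s" using a b by (auto simp: annulus_def z min_def max_def split: if_splits)
    qed
  qed (use valid_path_imp_path valid_path_circlepath in auto)
qed auto

lemma annulus_nonzero: "0 < s \<Longrightarrow> z \<in> annulus s \<Longrightarrow> z \<noteq> 0"
  by (auto simp: annulus_def)

lemma circle_in_annulus: "s < a \<Longrightarrow> a < inverse s \<Longrightarrow> sphere 0 a \<subseteq> annulus s"
  by (auto simp: annulus_def)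

lemma has_contour_integral_circle:
  assumes f: "f holomorphic_on annulus s" and s: "0 < s" and a: "s < a" "a < inverse s"
    and h: "continuous_on (sphere 0 a) h"
  shows "((\<lambda>z. f z * h z) has_contour_integral contour_integral (circlepath 0 a) (\<lambda>z. f z * h z)) (circlepath 0 a)"
proof (intro has_contour_integral_integral contour_integrable_continuous_circlepath)
  have "path_image (circlepath 0 a) = sphere 0 a"
    using s a by (simp add: path_image_circlepath)
  then show "continuous_on (path_image (circlepath 0 a)) (\<lambda>z. f z * h z)"
    using h holomorphic_on_imp_continuous_on[OF f] circle_in_annulus[OF a]
    by (auto intro!: continuous_intros intro: continuous_on_subset)
qed

text \<open>Moving the contour from the unit circle to radius \<open>a\<close> trades a bound of
  \<open>f\<close> there for the factor \<open>a powi (- k)\<close>.\<close>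

lemma fourier_coeff_bound:
  assumes f: "f holomorphic_on annulus s" and s: "0 < s" "s < 1" and a: "s < a" "a < inverse s"
    and B: "\<And>z. cmod z = a \<Longrightarrow> cmod (f z) \<le> B"
  shows "cmod (fourier_coeff f k) \<le> B * a powi (- k)"
proof -
  let ?F = "\<lambda>z. f z * z powi (- k - 1)"
  have a0: "0 < a" using s a by simp
  have "(\<lambda>z. z powi (- k - 1)) holomorphic_on annulus s"
    using annulus_nonzero[OF s(1)] by (intro holomorphic_intros) auto
  then have hol: "?F holomorphic_on annulus s" by (rule holomorphic_on_mult[OF f])
  have "continuous_on (sphere 0 1) f"
    by (rule continuous_on_subset[OF holomorphic_on_imp_continuous_on[OF f] sphere_subset_annulus[OF s]])
  then have eq: "fourier_coeff f k = contour_integral (circlepath 0 a) ?F / (2 * of_real pi * \<i>)"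
    using fourier_coeff_contour[of f k] contour_integral_circle_shift[OF hol s(1) a, of 1] s
    by (simp add: one_less_inverse_iff)
  have "cmod (f (of_real a)) \<le> B" by (rule B) (use a0 in simp)
  then have B0: "0 \<le> B" by (rule order_trans[OF norm_ge_zero])
  have "cmod (contour_integral (circlepath 0 a) ?F) \<le> (B * a powi (- k - 1)) * (2 * pi * a)"
  proof (rule has_contour_integral_bound_circlepath)
    show "(?F has_contour_integral contour_integral (circlepath 0 a) ?F) (circlepath 0 a)"
      by (rule has_contour_integral_circle[OF f s(1) a]) (use a0 in \<open>auto intro!: continuous_intros\<close>)
    show "cmod (?F z) \<le> B * a powi (- k - 1)" if "cmod (z - 0) = a" for z
      using B[of z] that a0 by (simp add: norm_mult norm_power_int mult_right_mono)
  qed (use a0 B0 in auto)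
  also have "\<dots> = (B * a powi (- k)) * (2 * pi)"
    using a0 power_int_add[of a "- k - 1" 1] by (simp add: mult_ac)
  finally show ?thesis unfolding eq by (simp add: norm_divide norm_mult field_simps)
qed

text \<open>The difference quotient of \<open>f\<close> at \<open>z\<close> extends holomorphically
  over \<open>z\<close>, so its integrals over the two circles agree. The remaining integral of
  \<open>1 / (w - z)\<close> is \<open>2 \<pi> \<i>\<close> on the outer circle and 0 on the inner
  one.\<close>

lemma Cauchy_integral_annulus:
  assumes f: "f holomorphic_on annulus s" and s: "0 < s" "s < 1" and R: "1 < R" "R < inverse s"
    and z: "cmod z = 1"
  shows "2 * of_real pi * \<i> * f z = contour_integral (circlepath 0 R) (\<lambda>w. f w * (1 / (w - z)))
     - contour_integral (circlepath 0 (inverse R)) (\<lambda>w. f w * (1 / (w - z)))"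
proof -
  let ?\<psi> = "\<lambda>w. if w = z then deriv f z else (f w - f z) / (w - z)"
  have hol: "?\<psi> holomorphic_on annulus s" by (rule pole_lemma_open[OF f open_annulus])
  have R': "s < inverse R" "inverse R < inverse s" "inverse R < 1" "s < R"
    using R s less_imp_inverse_less[of R "inverse s"] less_imp_inverse_less[of s R]
    by (auto simp: inverse_less_1_iff)
  have eq: "contour_integral (circlepath 0 a) ?\<psi> = contour_integral (circlepath 0 a) (\<lambda>w. f w * (1 / (w - z))) - f z * I"
    if a: "s < a" "a < inverse s" "a \<noteq> 1" and I: "((\<lambda>w. 1 / (w - z)) has_contour_integral I) (circlepath 0 a)" for a I
  proof -
    have nz: "w \<noteq> z" if "w \<in> sphere 0 a" for w using that z a by auto
    have "((\<lambda>w. f w * (1 / (w - z)) - f z * (1 / (w - z))) has_contour_integral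
        (contour_integral (circlepath 0 a) (\<lambda>w. f w * (1 / (w - z))) - f z * I)) (circlepath 0 a)"
      using nz
      by (intro has_contour_integral_diff has_contour_integral_circle[OF f s(1) a(1,2)]
          has_contour_integral_lmul I continuous_intros) auto
    then have "(?\<psi> has_contour_integral
        (contour_integral (circlepath 0 a) (\<lambda>w. f w * (1 / (w - z))) - f z * I)) (circlepath 0 a)"
    proof (rule has_contour_integral_eq)
      fix w assume "w \<in> path_image (circlepath 0 a)"
      then have "w \<noteq> z" using nz s a by (simp add: path_image_circlepath)
      then show "f w * (1 / (w - z)) - f z * (1 / (w - z)) = ?\<psi> w" by (simp add: diff_divide_distrib)
    qed
    then show ?thesis by (rule contour_integral_unique)
  qed
  have I1: "((\<lambda>w. 1 / (w - z)) has_contour_integral 2 * of_real pi * \<i>) (circlepath 0 R)"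
    using Cauchy_integral_circlepath_simple[of "\<lambda>_. 1" 0 R z] z R by simp
  have I2: "((\<lambda>w. 1 / (w - z)) has_contour_integral 0) (circlepath 0 (inverse R))"
    by (rule Cauchy_theorem_disc_simple[where a = 0 and e = 1])
      (use z R R' in \<open>auto intro!: holomorphic_intros simp: path_image_circlepath\<close>)
  have "contour_integral (circlepath 0 R) ?\<psi> = contour_integral (circlepath 0 (inverse R)) ?\<psi>"
    by (rule contour_integral_circle_shift[OF hol s(1)]) (use R R' in auto)
  then show ?thesis
    using eq[OF R'(4) R(2) _ I1] eq[OF R'(1,2) _ I2] R R' by (simp add: algebra_simps)
qed

text \<open>All points are roots of \<open>w ^ m = A\<close>, so \<open>w - z j\<close> divides
  \<open>w ^ m - A\<close> with quotient a polynomial in \<open>z j\<close>. Summation over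
  \<open>j\<close> kills every power of \<open>z j\<close> except the zeroth.\<close>

lemma sum_inverse_minus_points:
  fixes z :: "nat \<Rightarrow> complex"
  assumes m: "0 < m" and pow: "\<And>j. j < m \<Longrightarrow> z j ^ m = A" and orth: "\<And>i. 0 < i \<Longrightarrow> i < m \<Longrightarrow> (\<Sum>j<m. z j ^ i) = 0"
    and w: "w ^ m \<noteq> A"
  shows "(\<Sum>j<m. 1 / (w - z j)) = of_nat m * (w ^ (m - 1) / (w ^ m - A))"
proof -
  have kernel: "1 / (w - z j) = (\<Sum>i<m. w ^ (m - Suc i) * z j ^ i) / (w ^ m - A)" if j: "j < m" for j
  proof -
    have "w - z j \<noteq> 0" using pow[OF j] w by auto
    moreover have "w ^ m - A = (w - z j) * (\<Sum>i<m. w ^ (m - Suc i) * z j ^ i)"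
      using power_diff_sumr2[of "z j" m w] unfolding pow[OF j] by (metis minus_diff_eq mult_minus_left)
    ultimately show ?thesis using w by (simp add: field_simps)
  qed
  have "(\<Sum>j<m. 1 / (w - z j)) = (\<Sum>j<m. \<Sum>i<m. w ^ (m - Suc i) * z j ^ i) / (w ^ m - A)"
    unfolding sum_divide_distrib by (intro sum.cong refl) (simp add: kernel sum_divide_distrib)
  also have "(\<Sum>j<m. \<Sum>i<m. w ^ (m - Suc i) * z j ^ i) = (\<Sum>i<m. w ^ (m - Suc i) * (\<Sum>j<m. z j ^ i))"
    by (subst sum.swap) (simp add: sum_distrib_left)
  also have "\<dots> = (\<Sum>i<m. if i = 0 then w ^ (m - 1) * of_nat m else 0)"
    by (intro sum.cong refl) (use orth in auto)
  also have "\<dots> = w ^ (m - 1) * of_nat m" using m by simp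
  finally show ?thesis by simp
qed

text \<open>Both terms come from the Cauchy formula on the annulus: averaging the kernels \<open>1 / (w - z j)\<close> gives
  \<open>w ^ (m - 1) / (w ^ m - A)\<close>, which is close to \<open>1 / w\<close> on the outer circle and to \<open>0\<close> on the inner one.\<close>

lemma trapezoidal_error:
  fixes z :: "nat \<Rightarrow> complex"
  assumes f: "f holomorphic_on annulus s" and s: "0 < s" "s < 1" and R: "1 < R" "R < inverse s"
    and m: "0 < m" and pow: "\<And>j. j < m \<Longrightarrow> z j ^ m = A" and z: "\<And>j. cmod (z j) = 1"
    and orth: "\<And>i. 0 < i \<Longrightarrow> i < m \<Longrightarrow> (\<Sum>j<m. z j ^ i) = 0"
    and B: "\<And>w. cmod w = R \<or> cmod w = inverse R \<Longrightarrow> cmod (f w) \<le> B"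
  shows "cmod ((\<Sum>j<m. f (z j)) / of_nat m - fourier_coeff f 0) \<le> 2 * B / (R ^ m - 1)"
proof -
  let ?\<pi> = "2 * of_real pi * \<i> :: complex"
  let ?k = "\<lambda>w. w ^ (m - 1) / (w ^ m - A)"
  have R': "s < inverse R" "inverse R < inverse s" "inverse R < 1" "s < R" "0 < inverse R"
    using R s less_imp_inverse_less[of R "inverse s"] less_imp_inverse_less[of s R]
    by (auto simp: inverse_less_1_iff)
  have A: "cmod A = 1" using pow[OF m] z[of 0] by (metis norm_power power_one)
  have Rm: "1 < R ^ m" using R m by (simp add: one_less_power)
  have "cmod (f (of_real R)) \<le> B" by (rule B) (use R in simp)
  then have B0: "0 \<le> B" by (rule order_trans[OF norm_ge_zero])
  \<comment> \<open>The poles of the averaged kernel lie on the unit circle, off both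
    contours.\<close>
  have ne: "w ^ m \<noteq> A" if "w \<in> sphere 0 a" "a = R \<or> a = inverse R" for w a
  proof
    assume "w ^ m = A"
    then have "a ^ m = 1" using A that by (metis dist_0_norm mem_sphere norm_power)
    moreover have "inverse R ^ m < 1" using Rm by (simp add: power_inverse inverse_less_1_iff)
    ultimately show False using that(2) Rm by auto
  qed
  have avg: "(\<Sum>j<m. contour_integral (circlepath 0 a) (\<lambda>w. f w * (1 / (w - z j)))) / of_nat m
      = contour_integral (circlepath 0 a) (\<lambda>w. f w * ?k w)"
    if a: "a = R \<or> a = inverse R" for a
  proof -
    have a': "s < a" "a < inverse s" "0 < a" "a \<noteq> 1" using a R R' by auto
    have nz: "w \<noteq> z j" if "w \<in> sphere 0 a" for w j using that z[of j] a' by auto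
    have "((\<lambda>w. \<Sum>j<m. f w * (1 / (w - z j))) has_contour_integral
        (\<Sum>j<m. contour_integral (circlepath 0 a) (\<lambda>w. f w * (1 / (w - z j))))) (circlepath 0 a)"
      using nz by (intro has_contour_integral_sum has_contour_integral_circle[OF f s(1) a'(1,2)] continuous_intros) auto
    then have "((\<lambda>w. (1 / of_nat m) * (\<Sum>j<m. f w * (1 / (w - z j)))) has_contour_integral
        (1 / of_nat m) * (\<Sum>j<m. contour_integral (circlepath 0 a) (\<lambda>w. f w * (1 / (w - z j))))) (circlepath 0 a)"
      by (rule has_contour_integral_lmul)
    then have "((\<lambda>w. f w * ?k w) has_contour_integral
        (1 / of_nat m) * (\<Sum>j<m. contour_integral (circlepath 0 a) (\<lambda>w. f w * (1 / (w - z j))))) (circlepath 0 a)"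
    proof (rule has_contour_integral_eq)
      fix w assume "w \<in> path_image (circlepath 0 a)"
      then have w: "w ^ m \<noteq> A" using ne a a' by (auto simp: path_image_circlepath)
      have "(\<Sum>j<m. f w * (1 / (w - z j))) = f w * (of_nat m * ?k w)"
        unfolding sum_distrib_left[symmetric]
        by (rule arg_cong[where f = "(*) (f w)"], rule sum_inverse_minus_points[OF m])
          (use pow orth w in auto)
      then show "(1 / of_nat m) * (\<Sum>j<m. f w * (1 / (w - z j))) = f w * ?k w" using m by simp
    qed
    then show ?thesis by (simp add: contour_integral_unique)
  qed
  have "?\<pi> * ((\<Sum>j<m. f (z j)) / of_nat m) = (\<Sum>j<m. ?\<pi> * f (z j)) / of_nat m"
    by (simp add: sum_distrib_left)
  also have "\<dots> = contour_integral (circlepath 0 R) (\<lambda>w. f w * ?k w)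
      - contour_integral (circlepath 0 (inverse R)) (\<lambda>w. f w * ?k w)"
    unfolding Cauchy_integral_annulus[OF f s R z] sum_subtractf diff_divide_distrib
    using avg[of R] avg[of "inverse R"] by simp
  finally have sum_eq: "?\<pi> * ((\<Sum>j<m. f (z j)) / of_nat m) = contour_integral (circlepath 0 R) (\<lambda>w. f w * ?k w)
      - contour_integral (circlepath 0 (inverse R)) (\<lambda>w. f w * ?k w)" .
  have holz: "(\<lambda>w. f w * (1 / w)) holomorphic_on annulus s"
    using annulus_nonzero[OF s(1)] by (intro holomorphic_intros f) auto
  have "continuous_on (sphere 0 1) f"
    by (rule continuous_on_subset[OF holomorphic_on_imp_continuous_on[OF f] sphere_subset_annulus[OF s]])
  then have c0: "?\<pi> * fourier_coeff f 0 = contour_integral (circlepath 0 R) (\<lambda>w. f w * (1 / w))"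
    using fourier_coeff_contour[of f 0] contour_integral_circle_shift[OF holz s(1) R'(4) R(2), of 1] s
    by (simp add: one_less_inverse_iff power_int_minus inverse_eq_divide)
  have contk: "continuous_on (sphere 0 a) ?k" if "a = R \<or> a = inverse R" for a
    using ne[OF _ that] by (intro continuous_intros) auto
  have E1: "cmod (contour_integral (circlepath 0 R) (\<lambda>w. f w * ?k w) - contour_integral (circlepath 0 R) (\<lambda>w. f w * (1 / w)))
      \<le> (B / (R * (R ^ m - 1))) * (2 * pi * R)"
  proof (rule has_contour_integral_bound_circlepath)
    show "((\<lambda>w. f w * ?k w - f w * (1 / w)) has_contour_integral
        contour_integral (circlepath 0 R) (\<lambda>w. f w * ?k w) - contour_integral (circlepath 0 R) (\<lambda>w. f w * (1 / w))) (circlepath 0 R)"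
      by (intro has_contour_integral_diff has_contour_integral_circle[OF f s(1) R'(4) R(2)] contk continuous_intros)
        (use R in auto)
    fix w assume "cmod (w - 0) = R"
    then have w: "cmod w = R" by simp
    have wA: "w ^ m - A \<noteq> 0" "w \<noteq> 0" using ne[of w R] w R by auto
    have "w * w ^ (m - 1) = w ^ m" using m by (simp add: power_eq_if)
    then have "f w * ?k w - f w * (1 / w) = f w * (A / (w * (w ^ m - A)))"
      using wA by (simp add: field_simps)
    moreover have "R ^ m - 1 \<le> cmod (w ^ m - A)"
      using norm_triangle_ineq2[of "w ^ m" A] A w by (simp add: norm_power)
    moreover have "cmod (f w) \<le> B" using B w by simp
    ultimately show "cmod (f w * ?k w - f w * (1 / w)) \<le> B / (R * (R ^ m - 1))"
      using Rm R A w B0 frac_le[of B "cmod (f w)" "R * (R ^ m - 1)" "R * cmod (w ^ m - A)"]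
      by (simp add: norm_mult norm_divide)
  qed (use Rm R B0 in auto)
  have E2: "cmod (contour_integral (circlepath 0 (inverse R)) (\<lambda>w. f w * ?k w))
      \<le> (B * R / (R ^ m - 1)) * (2 * pi * inverse R)"
  proof (rule has_contour_integral_bound_circlepath)
    show "((\<lambda>w. f w * ?k w) has_contour_integral contour_integral (circlepath 0 (inverse R)) (\<lambda>w. f w * ?k w)) (circlepath 0 (inverse R))"
      by (intro has_contour_integral_circle[OF f s(1) R'(1,2)] contk) simp
    fix w assume "cmod (w - 0) = inverse R"
    then have w: "cmod w = inverse R" by simp
    have "1 - inverse R ^ m \<le> cmod (w ^ m - A)"
      using norm_triangle_ineq2[of A "w ^ m"] A w by (simp add: norm_power norm_minus_commute)
    moreover have pos: "0 < 1 - inverse R ^ m" using Rm by (simp add: power_inverse inverse_less_1_iff)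
    moreover have "cmod (f w) \<le> B" using B w by simp
    ultimately have "cmod (f w * ?k w) \<le> B * (inverse R ^ (m - 1) / (1 - inverse R ^ m))"
      unfolding norm_mult norm_divide norm_power w
      by (intro mult_mono divide_left_mono mult_pos_pos) (use R B0 in auto)
    \<comment> \<open>Rewritten so that the inner circle has the same denominator as the outer one;
      each of them then contributes \<open>2 * pi * B / (R ^ m - 1)\<close>.\<close>
    also have "inverse R ^ (m - 1) / (1 - inverse R ^ m) = R / (R ^ m - 1)"
    proof -
      have shift: "R * inverse R ^ m = inverse R ^ (m - 1)" using m R by (cases m) auto
      have "inverse R ^ m * R ^ m = 1" using R by (simp flip: power_mult_distrib)
      then have "inverse R ^ m * (R ^ m - 1) = 1 - inverse R ^ m" by (simp only: right_diff_distrib mult_1_right)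
      then have "inverse R ^ (m - 1) * (R ^ m - 1) = R * (1 - inverse R ^ m)"
        unfolding shift[symmetric] by (simp only: mult.assoc)
      then show ?thesis using pos Rm by (simp add: frac_eq_eq)
    qed
    finally show "cmod (f w * ?k w) \<le> B * R / (R ^ m - 1)" by simp
  qed (use Rm R B0 in auto)
  have "?\<pi> * ((\<Sum>j<m. f (z j)) / of_nat m - fourier_coeff f 0)
      = (contour_integral (circlepath 0 R) (\<lambda>w. f w * ?k w) - contour_integral (circlepath 0 R) (\<lambda>w. f w * (1 / w)))
        - contour_integral (circlepath 0 (inverse R)) (\<lambda>w. f w * ?k w)"
    unfolding right_diff_distrib sum_eq c0 by simp
  then have "2 * pi * cmod ((\<Sum>j<m. f (z j)) / of_nat m - fourier_coeff f 0)
      = cmod ((contour_integral (circlepath 0 R) (\<lambda>w. f w * ?k w) - contour_integral (circlepath 0 R) (\<lambda>w. f w * (1 / w)))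
        - contour_integral (circlepath 0 (inverse R)) (\<lambda>w. f w * ?k w))"
    by (metis (no_types, lifting) norm_mult norm_ii norm_of_real abs_of_nonneg pi_ge_zero mult.right_neutral norm_numeral)
  also have "\<dots> \<le> (B / (R * (R ^ m - 1))) * (2 * pi * R) + (B * R / (R ^ m - 1)) * (2 * pi * inverse R)"
    by (rule order_trans[OF norm_triangle_ineq4 add_mono[OF E1 E2]])
  also have "\<dots> = 2 * pi * (2 * B / (R ^ m - 1))"
  proof -
    have "(B / (R * u)) * (2 * pi * R) + (B * R / u) * (2 * pi * inverse R) = 2 * pi * (2 * B / u)"
      if "u \<noteq> 0" for u :: real
      using that R by (simp add: field_simps)
    then show ?thesis using Rm by simp
  qed
  finally show ?thesis by (rule mult_left_le_imp_le) simp
qed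

section \<open>Growth of expanding circle maps\<close>

text \<open>The direction \<open>v\<close> is a parameter because two are needed:
  \<open>v = \<i>\<close> moves along circles, \<open>v = 1\<close> moves radially. Both derivatives
  come from the one quantity \<open>z * deriv g z / g z\<close>.\<close>

lemma ln_norm_DERIV:
  assumes g: "g holomorphic_on S" "open S" and nz: "\<And>z. z \<in> S \<Longrightarrow> g z \<noteq> 0"
    and inS: "exp (of_real x0 * v) * w \<in> S"
  shows "((\<lambda>x. ln (cmod (g (exp (of_real x * v) * w)))) has_real_derivative
    Re (v * (exp (of_real x0 * v) * w * deriv g (exp (of_real x0 * v) * w) / g (exp (of_real x0 * v) * w)))) (at x0)"
proof -
  define z where zw: "z = exp (of_real x0 * v) * w"
  have z: "z \<in> S" "g z \<noteq> 0" using inS nz unfolding zw by auto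
  let ?c = "\<lambda>s. exp (s * v) * w"
  \<comment> \<open>Division by \<open>g z\<close> places the argument at 1, away from the branch
    cut of \<open>Ln\<close>.\<close>
  let ?L = "\<lambda>s. Ln (g (?c s) / g z)"
  define h where "h x = ln (cmod (g z)) + Re (?L (of_real x))" for x :: real
  have c: "(?c has_field_derivative v * z) (at (of_real x0))"
    unfolding zw by (auto intro!: derivative_eq_intros)
  have "(g has_field_derivative deriv g z) (at (?c (of_real x0)))"
    using holomorphic_derivI[OF g(1,2) z(1)] zw by simp
  from DERIV_chain2[OF this c]
  have gc: "((\<lambda>s. g (?c s) / g z) has_field_derivative deriv g z * (v * z) / g z) (at (of_real x0))"
    by (rule DERIV_cdivide)
  have one: "g (?c (of_real x0)) / g z = 1" using z(2) zw by simp
  have "(Ln has_field_derivative inverse 1) (at (g (?c (of_real x0)) / g z))"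
    unfolding one by (rule has_field_derivative_Ln) simp
  from DERIV_chain2[OF this gc]
  have "(?L has_field_derivative v * (z * deriv g z / g z)) (at (of_real x0))" by (simp add: mult_ac)
  from has_vector_derivative_real_field[OF this, of UNIV]
  have "((\<lambda>x. ?L (of_real x)) has_vector_derivative v * (z * deriv g z / g z)) (at x0)" .
  from bounded_linear.has_vector_derivative[OF bounded_linear_Re this]
  have "((\<lambda>x. Re (?L (of_real x))) has_real_derivative Re (v * (z * deriv g z / g z))) (at x0)"
    unfolding has_real_derivative_iff_has_vector_derivative .
  from DERIV_add[OF DERIV_const[of "ln (cmod (g z))"] this]
  have "(h has_real_derivative Re (v * (z * deriv g z / g z))) (at x0)"
    unfolding h_def by (simp only: add_0)
  moreover have ev: "\<forall>\<^sub>F x in nhds x0. h x = ln (cmod (g (?c (of_real x))))"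
  proof -
    have "((\<lambda>x. ?c (of_real x)) \<longlongrightarrow> z) (at x0)" unfolding zw by (intro tendsto_intros)
    from topological_tendstoD[OF this g(2) z(1)]
    have "\<forall>\<^sub>F x in at x0. ?c (of_real x) \<in> S" .
    then have "\<forall>\<^sub>F x in nhds x0. ?c (of_real x) \<in> S"
      using z(1) zw by (simp add: eventually_nhds_conv_at)
    then show ?thesis
    proof eventually_elim
      case (elim x)
      then have "g (?c (of_real x)) \<noteq> 0" using nz by blast
      then show ?case using z(2) by (simp add: h_def norm_divide ln_div)
    qed
  qed
  ultimately show ?thesis unfolding zw[symmetric] using DERIV_cong_ev[OF refl ev refl] by blast
qed

text \<open>On the unit circle \<open>ln (cmod (g z))\<close> is constantly 0, so its tangential
  derivative, minus the imaginary part in question, vanishes.\<close>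

lemma circle_log_derivative_real:
  assumes g: "g holomorphic_on S" "open S" and nz: "\<And>z. z \<in> S \<Longrightarrow> g z \<noteq> 0"
    and S: "sphere 0 1 \<subseteq> S" and circ: "\<And>z. cmod z = 1 \<Longrightarrow> cmod (g z) = 1" and z: "cmod z = 1"
  shows "Im (z * deriv g z / g z) = 0"
proof -
  have on: "cmod (exp (of_real x * \<i>) * z) = 1" for x
    using z by (simp add: norm_mult norm_exp_eq_Re)
  have "((\<lambda>x. ln (cmod (g (exp (of_real x * \<i>) * z)))) has_real_derivative Re (\<i> * (z * deriv g z / g z))) (at 0)"
    using ln_norm_DERIV[OF g nz, of 0 \<i> z] S z by auto
  moreover have "(\<lambda>x. ln (cmod (g (exp (of_real x * \<i>) * z)))) = (\<lambda>_. 0)"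
    using circ[OF on] by simp
  ultimately have "Re (\<i> * (z * deriv g z / g z)) = 0"
    using DERIV_unique[OF _ DERIV_const[of 0 "at (0::real)"]] by metis
  then show ?thesis unfolding Re_i_times by simp
qed

lemma circle_deriv_bounds:
  assumes r: "0 < r" "r < 1" and g: "g holomorphic_on annulus r"
    and eq: "\<And>z. z \<in> sphere 0 1 \<Longrightarrow> g z = \<tau> z" and z: "cmod z = 1"
  shows "circle_deriv_min \<tau> \<le> cmod (deriv g z)" "cmod (deriv g z) \<le> circle_deriv_max \<tau>"
proof -
  have cd: "circle_deriv \<tau> z = deriv g z" if "z \<in> sphere 0 1" for z
    by (rule circle_deriv_eq[OF r g eq that])
  have "continuous_on (sphere 0 1) (deriv g)"
    by (rule continuous_on_subset[OF holomorphic_on_imp_continuous_on[OF holomorphic_deriv[OF g open_annulus]]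
          sphere_subset_annulus[OF r]])
  then have "bounded (deriv g ` sphere 0 1)"
    by (intro compact_imp_bounded compact_continuous_image) auto
  then obtain b where "\<forall>x\<in>deriv g ` sphere 0 1. cmod x \<le> b" unfolding bounded_iff ..
  then have b: "cmod (deriv g z) \<le> b" if "z \<in> sphere 0 1" for z using that by blast
  have z: "z \<in> sphere 0 1" using z by simp
  show "circle_deriv_min \<tau> \<le> cmod (deriv g z)"
    unfolding circle_deriv_min_def cd[OF z, symmetric] by (rule cINF_lower[OF _ z]) (rule bdd_belowI2[of _ 0], simp)
  show "cmod (deriv g z) \<le> circle_deriv_max \<tau>"
    unfolding circle_deriv_max_def cd[OF z, symmetric]
    by (rule cSUP_upper[OF z]) (rule bdd_aboveI2[of _ _ b], simp only: cd b)
qed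

lemma open_contains_thin_annulus:
  assumes U: "open U" "sphere 0 1 \<subseteq> U"
  obtains s :: real where "0 < s" "s < 1" "annulus s \<subseteq> U"
proof -
  obtain d where d: "0 < d" "(\<Union>x\<in>sphere 0 1. ball x d) \<subseteq> U"
    using compact_subset_open_imp_ball_epsilon_subset[OF compact_sphere U] by blast
  \<comment> \<open>Chosen so that the inner radius \<open>1 - e = 1 / (1 + d)\<close> has inverse
    exactly \<open>1 + d\<close>.\<close>
  define e where "e = d / (1 + d)"
  have e: "0 < e" "e < 1" "e < d" using d(1) by (auto simp: e_def field_simps)
  have inv: "inverse (1 - e) = 1 + d" using d(1) by (simp add: e_def field_simps)
  have "annulus (1 - e) \<subseteq> U"
  proof
    fix z assume "z \<in> annulus (1 - e)"
    then have z: "1 - e < cmod z" "cmod z < 1 + d" unfolding annulus_def inv by auto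
    then have z0: "z \<noteq> 0" using e by auto
    have "z - sgn z = of_real (cmod z - 1) * sgn z"
      using z0 by (simp add: sgn_eq field_simps)
    then have "dist (sgn z) z = \<bar>cmod z - 1\<bar>"
      using z0 by (metis (no_types, lifting) dist_commute dist_norm mult.right_neutral norm_mult norm_of_real norm_sgn)
    also have "\<dots> < d" using z e by auto
    finally have "z \<in> (\<Union>x\<in>sphere 0 1. ball x d)" using z0 by (auto simp: norm_sgn intro!: bexI[of _ "sgn z"])
    then show "z \<in> U" using d(2) by blast
  qed
  then show ?thesis using that[of "1 - e"] e by simp
qed

text \<open>On the circle \<open>z * deriv g z / g z\<close> is real with modulus
  \<open>cmod (deriv g z)\<close>, and its real part is the radial derivative of
  \<open>ln (cmod g)\<close> in the variable \<open>ln (cmod z)\<close>. In a thin annulus it stays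
  within \<open>\<epsilon>\<close> of its range, and the mean value theorem is applied along a ray
  from the circle, where \<open>ln (cmod g)\<close> is 0.\<close>

lemma expanding_circle_map_growth:
  assumes \<tau>: "expanding_circle_map \<tau>" and \<epsilon>: "0 < \<epsilon>"
  obtains s g \<sigma> where "0 < s" "s < 1" "g holomorphic_on annulus s" "\<And>z. z \<in> sphere 0 1 \<Longrightarrow> g z = \<tau> z"
    "\<And>z. z \<in> annulus s \<Longrightarrow> g z \<noteq> 0" "\<sigma> = 1 \<or> \<sigma> = (-1::real)"
    "\<And>z. z \<in> annulus s \<Longrightarrow> \<exists>y. circle_deriv_min \<tau> - \<epsilon> \<le> y \<and> y \<le> circle_deriv_max \<tau> + \<epsilon> \<and>
       ln (cmod (g z)) = \<sigma> * y * ln (cmod z)"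
proof -
  obtain r g where r: "0 < r" "r < 1" and g: "g holomorphic_on annulus r"
    and eq: "\<And>z. z \<in> sphere 0 1 \<Longrightarrow> g z = \<tau> z" and exp: "1 < circle_deriv_min \<tau>"
    using \<tau> unfolding expanding_circle_map_def by blast
  have circ: "cmod (g z) = 1" if "cmod z = 1" for z
    using \<tau> eq[of z] that unfolding expanding_circle_map_def by auto
  let ?S = "annulus r \<inter> g -` (- {0})"
  have S: "open ?S"
    by (rule continuous_open_preimage[OF holomorphic_on_imp_continuous_on[OF g] open_annulus]) auto
  have gS: "g holomorphic_on ?S" by (rule holomorphic_on_subset[OF g]) auto
  have nzS: "g z \<noteq> 0" if "z \<in> ?S" for z using that by auto
  have sph: "sphere 0 1 \<subseteq> ?S"
    using sphere_subset_annulus[OF r] circ by force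
  define \<Lambda> where "\<Lambda> z = z * deriv g z / g z" for z
  have real: "Im (\<Lambda> z) = 0" if "cmod z = 1" for z
    unfolding \<Lambda>_def by (rule circle_log_derivative_real[OF gS S nzS sph circ that])
  have abs: "\<bar>Re (\<Lambda> z)\<bar> = cmod (deriv g z)" if "cmod z = 1" for z
  proof -
    have "\<bar>Re (\<Lambda> z)\<bar> = cmod (\<Lambda> z)" using real[OF that] by (simp add: cmod_eq_Re)
    then show ?thesis using circ[OF that] that by (simp add: \<Lambda>_def norm_divide norm_mult)
  qed
  have "\<Lambda> holomorphic_on ?S"
    unfolding \<Lambda>_def
    by (intro holomorphic_on_divide holomorphic_on_mult holomorphic_on_ident gS nzS holomorphic_deriv[OF gS S])
  then have contS: "continuous_on ?S (\<lambda>z. Re (\<Lambda> z))"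
    by (intro continuous_intros holomorphic_on_imp_continuous_on)
  have "connected ((\<lambda>z. Re (\<Lambda> z)) ` sphere 0 1)"
    by (rule connected_continuous_image[OF continuous_on_subset[OF contS sph]]) (rule connected_sphere, simp)
  then have int: "is_interval ((\<lambda>z. Re (\<Lambda> z)) ` sphere 0 1)" by (simp add: is_interval_connected_1)
  have ge: "1 < \<bar>Re (\<Lambda> z)\<bar>" if "cmod z = 1" for z
    using circle_deriv_bounds(1)[OF r g eq that] exp abs[OF that] by simp
  \<comment> \<open>The orientation of the map. It is the same at all points, since a change of sign
    on the connected circle would force a zero, against expansion.\<close>
  define \<sigma> :: real where "\<sigma> = (if 0 < Re (\<Lambda> 1) then 1 else -1)"
  have \<sigma>: "\<sigma> = 1 \<or> \<sigma> = -1" by (simp add: \<sigma>_def)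
  have same: "\<sigma> * Re (\<Lambda> z) = \<bar>Re (\<Lambda> z)\<bar>" if z: "cmod z = 1" for z
  proof (rule ccontr)
    assume neq: "\<sigma> * Re (\<Lambda> z) \<noteq> \<bar>Re (\<Lambda> z)\<bar>"
    then have opp: "(Re (\<Lambda> z) < 0 \<and> 0 < Re (\<Lambda> 1)) \<or> (Re (\<Lambda> 1) < 0 \<and> 0 < Re (\<Lambda> z))"
      using ge[of 1] ge[OF z] by (auto simp: \<sigma>_def split: if_splits)
    have mem: "Re (\<Lambda> z) \<in> (\<lambda>z. Re (\<Lambda> z)) ` sphere 0 1" "Re (\<Lambda> 1) \<in> (\<lambda>z. Re (\<Lambda> z)) ` sphere 0 1"
      using z by auto
    have "0 \<in> (\<lambda>z. Re (\<Lambda> z)) ` sphere 0 1"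
      using opp mem_is_interval_1_I[OF int mem(1) mem(2), of 0] mem_is_interval_1_I[OF int mem(2) mem(1), of 0] by auto
    then obtain u where u: "cmod u = 1" "Re (\<Lambda> u) = 0" by auto
    show False using ge[OF u(1)] u(2) by simp
  qed
  let ?p = "circle_deriv_min \<tau> - \<epsilon>" and ?q = "circle_deriv_max \<tau> + \<epsilon>"
  let ?U = "?S \<inter> (\<lambda>z. \<sigma> * Re (\<Lambda> z)) -` {?p<..<?q}"
  have U: "open ?U"
    by (rule continuous_open_preimage[OF _ S]) (auto intro!: continuous_on_mult_left contS)
  have sU: "sphere 0 1 \<subseteq> ?U"
  proof
    fix z :: complex assume z: "z \<in> sphere 0 1"
    then have c: "cmod z = 1" by simp
    show "z \<in> ?U"
      using same[OF c] abs[OF c] circle_deriv_bounds[OF r g eq c] \<epsilon> sph z by auto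
  qed
  obtain s where s: "0 < s" "s < 1" "annulus s \<subseteq> ?U"
    by (rule open_contains_thin_annulus[OF U sU])
  have "\<exists>y. ?p \<le> y \<and> y \<le> ?q \<and> ln (cmod (g z)) = \<sigma> * y * ln (cmod z)" if z: "z \<in> annulus s" for z
  proof -
    have z0: "z \<noteq> 0" using z s(1) by (auto simp: annulus_def)
    define w where "w = sgn z"
    have w: "cmod w = 1" using z0 by (simp add: w_def norm_sgn)
    define \<phi> where "\<phi> x = \<sigma> * ln (cmod (g (exp (of_real x * 1) * w)))" for x
    define \<phi>' where "\<phi>' x = \<sigma> * Re (\<Lambda> (exp (of_real x) * w))" for x
    have zw: "exp (of_real (ln (cmod z)) * 1) * w = z"
      using z0 by (simp add: w_def sgn_eq exp_of_real)
    have inA: "exp (of_real x * 1) * w \<in> annulus s" if "x \<in> closed_segment 0 (ln (cmod z))" for x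
    proof -
      have "ln s < ln (cmod z)" "ln (cmod z) < ln (inverse s)" using z s z0 by (auto simp: annulus_def)
      moreover have "ln s < 0" "0 < ln (inverse s)" using s by (auto simp: ln_inverse)
      ultimately have "ln s < x" "x < ln (inverse s)" using that by (auto simp: closed_segment_eq_real_ivl split: if_splits)
      then have "exp (ln s) < exp x" "exp x < exp (ln (inverse s))" by simp_all
      then have "s < exp x" "exp x < inverse s" using s by simp_all
      then show ?thesis using w by (simp add: annulus_def norm_mult)
    qed
    have der: "(\<phi> has_real_derivative \<phi>' x) (at x)" if "x \<in> closed_segment 0 (ln (cmod z))" for x
    proof -
      have "exp (of_real x * 1) * w \<in> ?S" using inA[OF that] s(3) by blast
      from ln_norm_DERIV[OF gS S nzS this] show ?thesis
        unfolding \<phi>_def \<phi>'_def \<Lambda>_def by (intro DERIV_cmult) simp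
    qed
    have \<phi>0: "\<phi> 0 = 0" using circ[OF w] by (simp add: \<phi>_def)
    have \<phi>1: "\<phi> (ln (cmod z)) = \<sigma> * ln (cmod (g z))" unfolding \<phi>_def zw ..
    have "\<exists>x\<in>closed_segment 0 (ln (cmod z)). \<phi> (ln (cmod z)) = ln (cmod z) * \<phi>' x"
    proof (cases "ln (cmod z)" "0::real" rule: linorder_cases)
      case less
      then obtain x where "ln (cmod z) < x" "x < 0" "\<phi> 0 - \<phi> (ln (cmod z)) = (0 - ln (cmod z)) * \<phi>' x"
        using MVT2[of "ln (cmod z)" 0 \<phi> \<phi>'] der by (auto simp: closed_segment_eq_real_ivl)
      then show ?thesis using \<phi>0 by (intro bexI[of _ x]) (auto simp: closed_segment_eq_real_ivl)
    next
      case equal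
      then show ?thesis using \<phi>0 by (intro bexI[of _ 0]) auto
    next
      case greater
      then obtain x where "0 < x" "x < ln (cmod z)" "\<phi> (ln (cmod z)) - \<phi> 0 = (ln (cmod z) - 0) * \<phi>' x"
        using MVT2[of 0 "ln (cmod z)" \<phi> \<phi>'] der by (auto simp: closed_segment_eq_real_ivl)
      then show ?thesis using \<phi>0 by (intro bexI[of _ x]) (auto simp: closed_segment_eq_real_ivl)
    qed
    then obtain x where x: "x \<in> closed_segment 0 (ln (cmod z))" "\<phi> (ln (cmod z)) = ln (cmod z) * \<phi>' x" by blast
    have "exp (of_real x * 1) * w \<in> ?U" using inA[OF x(1)] s(3) by blast
    then have "?p < \<phi>' x" "\<phi>' x < ?q" by (auto simp: \<phi>'_def)
    moreover have "ln (cmod (g z)) = \<sigma> * \<phi>' x * ln (cmod z)"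
      using x(2) \<sigma> unfolding \<phi>1 by (auto simp: mult.commute)
    ultimately show ?thesis by (intro exI[of _ "\<phi>' x"]) auto
  qed
  moreover have "g holomorphic_on annulus s" by (rule holomorphic_on_subset[OF gS]) (use s in blast)
  moreover have "g z \<noteq> 0" if "z \<in> annulus s" for z using that s(3) by blast
  ultimately show ?thesis using that[of s g \<sigma>] s(1,2) eq \<sigma> by blast
qed

section \<open>Fourier coefficients of powers\<close>

lemma powr_real_of_int_abs: "0 < R \<Longrightarrow> inverse R ^ nat \<bar>k\<bar> = R powr (- real_of_int \<bar>k\<bar>)" for R :: real
  using powr_realpow[of R "nat \<bar>k\<bar>"] by (simp add: powr_minus power_inverse)

lemma power_int_le_powr_abs:
  fixes R :: real
  assumes "1 < R" "c = R \<or> c = inverse R"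
  shows "c powi k \<le> R powr real_of_int \<bar>k\<bar>"
proof -
  have "c powi k = R powr real_of_int k \<or> c powi k = R powr real_of_int (- k)"
    using assms powr_real_of_int'[of R k] powr_real_of_int'[of R "- k"]
    by (auto simp: power_int_inverse power_int_minus)
  then show ?thesis using assms(1) by (auto intro!: powr_mono)
qed

text \<open>An orientation-free form of the growth estimate, with \<open>p\<close> slightly below
  the minimal and \<open>q\<close> slightly above the maximal derivative. On one of the two circles,
  depending on orientation and on the sign of \<open>l\<close>, the power is small: this gives decay
  of Fourier coefficients. The bound valid on both circles controls the trapezoidal error.\<close>

definition thin_extension :: "(complex \<Rightarrow> complex) \<Rightarrow> (complex \<Rightarrow> complex) \<Rightarrow> real \<Rightarrow> real \<Rightarrow> real \<Rightarrow> bool" where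
  "thin_extension \<tau> g s p q \<longleftrightarrow> 0 < s \<and> s < 1 \<and> g holomorphic_on annulus s \<and>
     (\<forall>z\<in>sphere 0 1. g z = \<tau> z) \<and> (\<forall>z\<in>annulus s. g z \<noteq> 0) \<and>
     (\<forall>R l. 1 < R \<longrightarrow> R < inverse s \<longrightarrow>
       (\<forall>z. cmod z = R \<or> cmod z = inverse R \<longrightarrow> cmod (g z powi l) \<le> R powr (q * real_of_int \<bar>l\<bar>)) \<and>
       (\<exists>c. (c = R \<or> c = inverse R) \<and> (\<forall>z. cmod z = c \<longrightarrow> cmod (g z powi l) \<le> R powr (- p * real_of_int \<bar>l\<bar>))))"

lemma expanding_circle_map_thin_extension:
  assumes \<tau>: "expanding_circle_map \<tau>" and \<epsilon>: "0 < \<epsilon>" "\<epsilon> \<le> circle_deriv_min \<tau>"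
  obtains g s where "thin_extension \<tau> g s (circle_deriv_min \<tau> - \<epsilon>) (circle_deriv_max \<tau> + \<epsilon>)"
proof -
  let ?p = "circle_deriv_min \<tau> - \<epsilon>" and ?q = "circle_deriv_max \<tau> + \<epsilon>"
  obtain s g \<sigma> where s: "0 < s" "s < 1" and g: "g holomorphic_on annulus s" "\<And>z. z \<in> sphere 0 1 \<Longrightarrow> g z = \<tau> z"
    "\<And>z. z \<in> annulus s \<Longrightarrow> g z \<noteq> 0" and \<sigma>: "\<sigma> = 1 \<or> \<sigma> = (-1::real)"
    and grow: "\<And>z. z \<in> annulus s \<Longrightarrow> \<exists>y. ?p \<le> y \<and> y \<le> ?q \<and> ln (cmod (g z)) = \<sigma> * y * ln (cmod z)"
    by (rule expanding_circle_map_growth[OF \<tau> \<epsilon>(1)]) (rule that; assumption)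
  have p0: "0 \<le> ?p" using \<epsilon> by simp
  have *: "\<exists>y. ?p \<le> y \<and> y \<le> ?q \<and> cmod (g z powi l) = R powr (\<sigma> * \<kappa> * y * real_of_int l)"
    if R: "1 < R" "R < inverse s" and z: "cmod z = R powr \<kappa>" and \<kappa>: "\<kappa> = 1 \<or> \<kappa> = -1" for R \<kappa> z l
  proof -
    have "s < inverse R" "inverse R < inverse s" "s < R"
      using R s less_imp_inverse_less[of R "inverse s"] less_imp_inverse_less[of s R] by auto
    then have zA: "z \<in> annulus s"
      using z \<kappa> R by (auto simp: annulus_def powr_minus)
    then obtain y where y: "?p \<le> y" "y \<le> ?q" "ln (cmod (g z)) = \<sigma> * y * ln (cmod z)" using grow by blast
    have lz: "ln (cmod z) = \<kappa> * ln R" using z R by (simp add: ln_powr)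
    have "cmod (g z) = exp (\<sigma> * y * (\<kappa> * ln R))"
      using y(3) g(3)[OF zA] unfolding lz by (metis exp_ln zero_less_norm_iff)
    then have "cmod (g z powi l) = exp (real_of_int l * (\<sigma> * y * (\<kappa> * ln R)))"
      by (simp add: norm_power_int exp_power_int)
    also have "\<dots> = R powr (\<sigma> * \<kappa> * y * real_of_int l)" using R by (simp add: powr_def mult_ac)
    finally show ?thesis using y by blast
  qed
  have "thin_extension \<tau> g s ?p ?q"
    unfolding thin_extension_def
  proof (intro conjI allI impI ballI)
    fix R :: real and l :: int assume R: "1 < R" "R < inverse s"
    {
      fix z assume "cmod z = R \<or> cmod z = inverse R"
      then have "cmod z = R powr 1 \<or> cmod z = R powr -1" using R by (simp add: powr_minus)
      then obtain \<kappa> :: real where \<kappa>: "\<kappa> = 1 \<or> \<kappa> = -1" "cmod z = R powr \<kappa>" by blast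
      obtain y where y: "?p \<le> y" "y \<le> ?q" "cmod (g z powi l) = R powr (\<sigma> * \<kappa> * y * real_of_int l)"
        using *[OF R \<kappa>(2,1)] by blast
      have "\<sigma> * \<kappa> * y * real_of_int l \<le> y * \<bar>real_of_int l\<bar>"
        using \<sigma> \<kappa>(1) p0 y(1) by (auto simp: abs_if mult_le_0_iff mult_nonneg_nonpos)
      also have "\<dots> \<le> ?q * \<bar>real_of_int l\<bar>" by (intro mult_right_mono y) auto
      finally show "cmod (g z powi l) \<le> R powr (?q * real_of_int \<bar>l\<bar>)"
        unfolding y(3) using R by (intro powr_mono) auto
    }
    \<comment> \<open>The sign is picked so that \<open>\<sigma> * \<kappa> * l = - |l|\<close>,
      which selects the circle on which the power decays.\<close>
    define \<kappa> :: real where "\<kappa> = - \<sigma> * (if 0 \<le> l then 1 else -1)"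
    have \<kappa>: "\<kappa> = 1 \<or> \<kappa> = -1" using \<sigma> by (auto simp: \<kappa>_def)
    show "\<exists>c. (c = R \<or> c = inverse R) \<and> (\<forall>z. cmod z = c \<longrightarrow> cmod (g z powi l) \<le> R powr (- ?p * real_of_int \<bar>l\<bar>))"
    proof (intro exI[of _ "R powr \<kappa>"] conjI allI impI)
      show "R powr \<kappa> = R \<or> R powr \<kappa> = inverse R" using \<kappa> R by (auto simp: powr_minus)
      fix z assume z: "cmod z = R powr \<kappa>"
      obtain y where y: "?p \<le> y" "y \<le> ?q" "cmod (g z powi l) = R powr (\<sigma> * \<kappa> * y * real_of_int l)"
        using *[OF R z \<kappa>] by blast
      have "\<sigma> * \<kappa> * y * real_of_int l = - (y * \<bar>real_of_int l\<bar>)"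
        using \<sigma> by (auto simp: \<kappa>_def abs_if)
      moreover have "?p * \<bar>real_of_int l\<bar> \<le> y * \<bar>real_of_int l\<bar>" by (intro mult_right_mono y) auto
      ultimately have "\<sigma> * \<kappa> * y * real_of_int l \<le> - ?p * real_of_int \<bar>l\<bar>"
        unfolding of_int_abs mult_minus_left by linarith
      then show "cmod (g z powi l) \<le> R powr (- ?p * real_of_int \<bar>l\<bar>)"
        unfolding y(3) using R by (intro powr_mono) simp_all
    qed
  qed (use s g in auto)
  then show ?thesis by (rule that)
qed

lemma fourier_coeff_cong: "(\<And>z. z \<in> sphere 0 1 \<Longrightarrow> f z = f' z) \<Longrightarrow> fourier_coeff f k = fourier_coeff f' k"
  by (simp add: fourier_coeff_def)

lemma thin_extension_continuous:
  assumes "thin_extension \<tau> g s p q" shows "continuous_on (sphere 0 1) (\<lambda>z. \<tau> z powi l)"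
proof -
  note g = assms[unfolded thin_extension_def]
  have sub: "sphere 0 1 \<subseteq> annulus s" using g by (intro sphere_subset_annulus) auto
  have "continuous_on (sphere 0 1) g"
    using g by (intro continuous_on_subset[OF holomorphic_on_imp_continuous_on sub]) blast
  moreover have "\<forall>z\<in>sphere 0 1. g z \<noteq> 0" using g sub by blast
  ultimately have "continuous_on (sphere 0 1) (\<lambda>z. g z powi l)"
    by (intro continuous_on_power_int) auto
  then show ?thesis by (rule continuous_on_eq) (use g in simp)
qed

lemma thin_extension_holomorphic_power:
  assumes "thin_extension \<tau> g s p q" shows "(\<lambda>z. g z powi l) holomorphic_on annulus s"
  using assms unfolding thin_extension_def by (intro holomorphic_intros) auto

lemma thin_extension_fourier_power:
  assumes "thin_extension \<tau> g s p q"
  shows "fourier_coeff (\<lambda>z. \<tau> z powi l) k = fourier_coeff (\<lambda>z. g z powi l) k"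
  by (rule fourier_coeff_cong) (use assms in \<open>simp add: thin_extension_def\<close>)

lemma thin_extension_circle:
  assumes "thin_extension \<tau> g s p q" "1 < R" "R < inverse s" "c = R \<or> c = inverse R"
  shows "s < c" "c < inverse s"
  using assms less_imp_inverse_less[of R "inverse s"] less_imp_inverse_less[of s R]
  unfolding thin_extension_def by auto

text \<open>The side to which the contour moves is dictated by the power of \<open>\<tau>\<close>,
  so it may be the wrong one for \<open>k\<close>; the price is at most
  \<open>R powr |k|\<close>.\<close>

lemma fourier_power_decay:
  assumes g: "thin_extension \<tau> g s p q" and R: "1 < R" "R < inverse s"
  shows "cmod (fourier_coeff (\<lambda>z. \<tau> z powi l) k) \<le> R powr (real_of_int \<bar>k\<bar> - p * real_of_int \<bar>l\<bar>)"
proof -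
  obtain c where c: "c = R \<or> c = inverse R"
    "\<And>z. cmod z = c \<Longrightarrow> cmod (g z powi l) \<le> R powr (- p * real_of_int \<bar>l\<bar>)"
    using g R unfolding thin_extension_def by meson
  have "cmod (fourier_coeff (\<lambda>z. \<tau> z powi l) k) \<le> R powr (- p * real_of_int \<bar>l\<bar>) * c powi (- k)"
    unfolding thin_extension_fourier_power[OF g]
    by (rule fourier_coeff_bound[OF thin_extension_holomorphic_power[OF g] _ _ thin_extension_circle[OF g R c(1)] c(2)])
      (use g in \<open>auto simp: thin_extension_def\<close>)
  also have "\<dots> \<le> R powr (- p * real_of_int \<bar>l\<bar>) * R powr real_of_int \<bar>k\<bar>"
    using power_int_le_powr_abs[OF R(1) c(1), of "- k"] by (intro mult_left_mono) auto
  also have "\<dots> = R powr (real_of_int \<bar>k\<bar> - p * real_of_int \<bar>l\<bar>)" by (simp flip: powr_add)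
  finally show ?thesis .
qed

section \<open>The Koopman operator as a matrix in the weighted monomial basis\<close>

definition koopman_matrix :: "real \<Rightarrow> (complex \<Rightarrow> complex) \<Rightarrow> int \<Rightarrow> int \<Rightarrow> complex" where
  "koopman_matrix r \<tau> k l = fourier_coeff (\<lambda>z. \<tau> z powi l) k * of_real (r ^ nat \<bar>k\<bar> / r ^ nat \<bar>l\<bar>)"

lemma weight_quotient_powr:
  "0 < R \<Longrightarrow> inverse R ^ nat \<bar>k\<bar> / inverse R ^ nat \<bar>l\<bar> = R powr (real_of_int \<bar>l\<bar> - real_of_int \<bar>k\<bar>)" for R :: real
  by (simp add: powr_real_of_int_abs flip: powr_diff)

text \<open>Shifting to a circle of radius \<open>R powr u\<close> with \<open>1 / p < u < 1\<close>, strictly inside the annulus on which the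
  weights live, gives decay in both indices.\<close>

lemma koopman_matrix_exp_bounded:
  assumes g: "thin_extension \<tau> g s p q" and p: "1 < p" and R: "1 < R" "R < inverse s"
  shows "\<exists>\<theta>. exp_bounded 1 \<theta> (koopman_matrix (inverse R) \<tau>)"
proof -
  define u where "u = (1 + 1 / p) / 2"
  have u: "0 < u" "u < 1" "1 < u * p" using p by (auto simp: u_def field_simps)
  \<comment> \<open>On the circle of radius \<open>R powr u\<close> the entries carry the exponent
    \<open>- ((1 - u) |k| + (u p - 1) |l|)\<close>; \<open>c\<close> is the smaller of the two
    positive coefficients.\<close>
  define c where "c = min (1 - u) (u * p - 1)"
  have c: "0 < c" "c \<le> 1 - u" "c \<le> u * p - 1" using u by (auto simp: c_def)
  define \<theta> where "\<theta> = R powr (- c)"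
  have \<theta>: "0 < \<theta>" "\<theta> < 1" using R c(1) by (auto simp: \<theta>_def powr_less_one)
  have Ru: "1 < R powr u" "R powr u < inverse s"
    using R u powr_less_mono[of u 1 R] powr_less_mono[of 0 u R] by auto
  have "cmod (koopman_matrix (inverse R) \<tau> k l) \<le> 1 * \<theta> ^ (nat \<bar>k\<bar> + nat \<bar>l\<bar>)" for k l
  proof -
    let ?k = "real_of_int \<bar>k\<bar>" and ?l = "real_of_int \<bar>l\<bar>"
    have "cmod (koopman_matrix (inverse R) \<tau> k l)
        = cmod (fourier_coeff (\<lambda>z. \<tau> z powi l) k) * R powr (?l - ?k)"
      using R by (simp only: koopman_matrix_def weight_quotient_powr norm_mult norm_of_real) simp
    also have "\<dots> \<le> (R powr u) powr (?k - p * ?l) * R powr (?l - ?k)"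
      by (intro mult_right_mono fourier_power_decay[OF g Ru]) simp
    also have "\<dots> = R powr (- ((1 - u) * ?k + (u * p - 1) * ?l))"
      using R by (simp add: powr_powr algebra_simps flip: powr_add)
    also have "\<dots> \<le> R powr (- (c * ?k + c * ?l))"
    proof (rule powr_mono)
      have "c * ?k \<le> (1 - u) * ?k" "c * ?l \<le> (u * p - 1) * ?l" using c by (auto intro!: mult_right_mono)
      then show "- ((1 - u) * ?k + (u * p - 1) * ?l) \<le> - (c * ?k + c * ?l)" by linarith
    qed (use R in simp)
    also have "\<dots> = \<theta> powr real (nat \<bar>k\<bar> + nat \<bar>l\<bar>)"
      by (simp add: \<theta>_def powr_powr algebra_simps)
    also have "\<dots> = \<theta> ^ (nat \<bar>k\<bar> + nat \<bar>l\<bar>)" by (rule powr_realpow[OF \<theta>(1)])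
    finally show ?thesis by simp
  qed
  then show ?thesis using \<theta> unfolding exp_bounded_def by blast
qed

lemma fourier_coeff_sum_cmult:
  assumes "finite S" "\<And>l. l \<in> S \<Longrightarrow> continuous_on (sphere 0 1) (f l)"
  shows "fourier_coeff (\<lambda>z. \<Sum>l\<in>S. c l * f l z) k = (\<Sum>l\<in>S. c l * fourier_coeff (f l) k)"
  using assms
proof (induction S)
  case empty
  show ?case by (simp add: fourier_coeff_def)
next
  case (insert a S)
  have "fourier_coeff (\<lambda>z. c a * f a z + (\<Sum>l\<in>S. c l * f l z)) k
      = fourier_coeff (\<lambda>z. c a * f a z) k + fourier_coeff (\<lambda>z. \<Sum>l\<in>S. c l * f l z) k"
    using insert.prems by (intro fourier_coeff_add) (auto intro!: continuous_intros)
  then show ?case using insert by (simp add: fourier_coeff_cmult)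
qed

lemma is_koopman_op_matrix_op:
  assumes r: "0 < r" "r < 1" and a: "exp_bounded C \<theta> (koopman_matrix r \<tau>)"
    and cont: "\<And>l. continuous_on (sphere 0 1) (\<lambda>z. \<tau> z powi l)"
  shows "is_koopman_op r \<tau> (matrix_op (koopman_matrix r \<tau>))"
  unfolding is_koopman_op_def
proof (intro conjI ballI)
  show "complex_linear_op (matrix_op (koopman_matrix r \<tau>))" by (rule complex_linear_matrix_op[OF a])
  fix f assume f: "f \<in> laurent_polys"
  then obtain S c where S: "finite S" and f_eq: "f = (\<lambda>z. \<Sum>l\<in>S. c l * z powi l)"
    by (auto simp: laurent_polys_def)
  have f\<tau>: "f \<circ> \<tau> = (\<lambda>z. \<Sum>l\<in>S. c l * \<tau> z powi l)" by (simp add: f_eq fun_eq_iff)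
  have "continuous_on (sphere 0 1) (f \<circ> \<tau>)" unfolding f\<tau> by (intro continuous_intros cont)
  note nth = hardy_embed_nth[OF r this] hardy_embed_nth[OF r continuous_on_laurent_poly[OF f]]
  have fx: "ell2_nth (hardy_embed r f) l = (if l \<in> S then c l else 0) * of_real (r ^ nat \<bar>l\<bar>)" for l
    unfolding nth(2) unfolding f_eq fourier_coeff_laurent_poly[OF S] ..
  show "matrix_op (koopman_matrix r \<tau>) (hardy_embed r f) = hardy_embed r (f \<circ> \<tau>)"
  proof (rule ell2_eqI)
    fix k
    have "ell2_nth (matrix_op (koopman_matrix r \<tau>) (hardy_embed r f)) k
        = (\<Sum>\<^sub>\<infinity>l. koopman_matrix r \<tau> k l * ell2_nth (hardy_embed r f) l)"
      by (rule matrix_op_nth[OF a])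
    also have "\<dots> = (\<Sum>\<^sub>\<infinity>l\<in>S. koopman_matrix r \<tau> k l * ell2_nth (hardy_embed r f) l)"
      by (rule infsum_cong_neutral) (auto simp: fx)
    also have "\<dots> = (\<Sum>l\<in>S. koopman_matrix r \<tau> k l * ell2_nth (hardy_embed r f) l)"
      by (rule infsum_finite[OF S])
    also have "\<dots> = (\<Sum>l\<in>S. c l * fourier_coeff (\<lambda>z. \<tau> z powi l) k * of_real (r ^ nat \<bar>k\<bar>))"
      by (intro sum.cong)
        (use r in \<open>auto simp: fx koopman_matrix_def field_simps\<close>)
    also have "\<dots> = ell2_nth (hardy_embed r (f \<circ> \<tau>)) k"
      unfolding nth(1) unfolding f\<tau> fourier_coeff_sum_cmult[OF S cont] sum_distrib_right ..
    finally show "ell2_nth (matrix_op (koopman_matrix r \<tau>) (hardy_embed r f)) k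
        = ell2_nth (hardy_embed r (f \<circ> \<tau>)) k" .
  qed
qed


section \<open>EDMD matrices at equidistant points\<close>

definition edmd_points :: "real \<Rightarrow> nat \<Rightarrow> nat \<Rightarrow> complex" where
  "edmd_points \<alpha> m j = exp (2 * of_real pi * \<i> * of_nat j / of_nat m + \<i> * of_real \<alpha>)"

lemma norm_edmd_points: "cmod (edmd_points \<alpha> m j) = 1"
  by (simp add: edmd_points_def norm_exp_eq_Re)

lemma edmd_points_power:
  assumes "0 < m" shows "edmd_points \<alpha> m j ^ m = exp (of_nat m * (\<i> * of_real \<alpha>))"
proof -
  have "edmd_points \<alpha> m j ^ m = exp (of_nat m * (2 * of_real pi * \<i> * of_nat j / of_nat m + \<i> * of_real \<alpha>))"
    unfolding edmd_points_def by (rule exp_of_nat_mult[symmetric])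
  also have "of_nat m * (2 * of_real pi * \<i> * of_nat j / of_nat m + \<i> * of_real \<alpha>)
      = of_nat m * (\<i> * of_real \<alpha>) + of_int (2 * int j) * (of_real pi * \<i>)"
    using assms by (simp add: field_simps)
  also have "exp \<dots> = exp (of_nat m * (\<i> * of_real \<alpha>))"
    unfolding exp_add by (simp add: exp_integer_2pi_plus1 exp_eq_1 mult_ac)
  finally show ?thesis .
qed

lemma edmd_points_orthogonal:
  assumes m: "0 < m" and d: "\<not> int m dvd d"
  shows "(\<Sum>j<m. edmd_points \<alpha> m j powi d) = 0"
proof -
  define x where "x = exp (2 * of_real pi * \<i> * (of_int d / of_nat m))"
  have xm: "x ^ m = 1"
    using m unfolding x_def exp_of_nat_mult[symmetric] exp_eq_1 by (auto intro!: exI[of _ d])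
  have x1: "x \<noteq> 1"
  proof
    assume "x = 1"
    then obtain k :: int where "2 * pi * (real_of_int d / real m) = of_int (2 * k) * pi"
      unfolding x_def exp_eq_1 by auto
    then have "real_of_int d = real_of_int (k * int m)" using m by (simp add: field_simps)
    then have "d = k * int m" by (simp only: of_int_eq_iff)
    then show False using d by simp
  qed
  have "edmd_points \<alpha> m j powi d = exp (of_int d * (\<i> * of_real \<alpha>)) * x ^ j" for j
    unfolding edmd_points_def x_def exp_power_int exp_of_nat_mult[symmetric] exp_add[symmetric]
    by (simp add: algebra_simps)
  then have "(\<Sum>j<m. edmd_points \<alpha> m j powi d) = exp (of_int d * (\<i> * of_real \<alpha>)) * (\<Sum>j<m. x ^ j)"
    by (simp add: sum_distrib_left)
  also have "(\<Sum>j<m. x ^ j) = 0" using geometric_sum[OF x1, of m] xm by simp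
  finally show ?thesis by simp
qed

lemma cnj_power_int_unit:
  assumes "cmod z = 1" shows "cnj z powi l = z powi (- l)"
proof -
  have "cmod (z powi l) = 1" using assms by (simp add: norm_power_int)
  then have "z powi l * cnj (z powi l) = 1" by (metis complex_norm_square of_real_1 power_one)
  then show ?thesis unfolding complex_cnj_power_int by (metis inverse_unique power_int_minus)
qed

text \<open>Indices of two observables differ by at most \<open>2 n - 2 < m\<close>, so
  \<open>m\<close> divides their difference only if they coincide, and no aliasing occurs in the
  Gram matrix.\<close>

lemma edmd_H_equidistant:
  assumes m: "2 * n \<le> m" "0 < n"
  shows "edmd_H (\<lambda>l z. z powi l) n m (edmd_points \<alpha> m) = 1\<^sub>m (2 * n - 1)"
proof (rule eq_matI)
  fix i j assume "i < dim_row (1\<^sub>m (2 * n - 1))" "j < dim_col (1\<^sub>m (2 * n - 1))"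
  then have ij: "i < 2 * n - 1" "j < 2 * n - 1" by auto
  let ?k = "obs_index n i" and ?l = "obs_index n j"
  have "edmd_points \<alpha> m t powi ?k * cnj (edmd_points \<alpha> m t powi ?l) = edmd_points \<alpha> m t powi (?k - ?l)" for t
  proof -
    have "edmd_points \<alpha> m t \<noteq> 0" by (simp add: edmd_points_def)
    then show ?thesis
      by (simp add: cnj_power_int_unit[OF norm_edmd_points] power_int_add[symmetric])
  qed
  then have eq: "edmd_H (\<lambda>l z. z powi l) n m (edmd_points \<alpha> m) $$ (i, j)
      = (1 / of_nat m) * (\<Sum>t<m. edmd_points \<alpha> m t powi (?k - ?l))"
    using ij by (simp add: edmd_H_def)
  show "edmd_H (\<lambda>l z. z powi l) n m (edmd_points \<alpha> m) $$ (i, j) = 1\<^sub>m (2 * n - 1) $$ (i, j)"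
  proof (cases "i = j")
    case True
    then show ?thesis unfolding eq using m ij by simp
  next
    case False
    have "\<not> int m dvd (?k - ?l)"
    proof
      assume "int m dvd (?k - ?l)"
      moreover have "?k - ?l \<noteq> 0" using False by (auto simp: obs_index_def)
      ultimately have "int m \<le> \<bar>?k - ?l\<bar>" using dvd_imp_le_int[of "?k - ?l" "int m"] by simp
      then show False using ij m by (auto simp: obs_index_def)
    qed
    then show ?thesis unfolding eq using edmd_points_orthogonal[of m "?k - ?l" \<alpha>] m ij False by simp
  qed
qed (auto simp: edmd_H_def)

lemma mat_inverse_one: "mat_inverse (1\<^sub>m n :: 'a :: field mat) = Some (1\<^sub>m n)"
proof (cases "mat_inverse (1\<^sub>m n :: 'a mat)")
  case None
  have "1\<^sub>m n \<in> Units (ring_mat TYPE('a) n ())" by (rule det_non_zero_imp_unit) auto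
  then show ?thesis using mat_inverse(1)[OF one_carrier_mat None, where b = "()"] by blast
next
  case (Some B)
  then have "1\<^sub>m n * B = 1\<^sub>m n" "B \<in> carrier_mat n n" using mat_inverse(2)[OF one_carrier_mat Some] by auto
  then show ?thesis using Some by simp
qed

lemma edmd_matrix_equidistant:
  assumes m: "2 * n \<le> m" "0 < n"
  shows "edmd_matrix \<tau> (\<lambda>l z. z powi l) n m (edmd_points \<alpha> m) = edmd_G \<tau> (\<lambda>l z. z powi l) n m (edmd_points \<alpha> m)"
  unfolding edmd_matrix_def edmd_H_equidistant[OF m] mat_inverse_one option.sel
  by (rule right_mult_one_mat[where nr = "2 * n - 1"]) (simp add: edmd_G_def)

text \<open>The EDMD entry is the trapezoidal sum of \<open>g^l z^(-k)\<close>, whose mean over the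
  circle is the Fourier coefficient. The row of the EDMD matrix is the observable composed with
  \<open>\<tau>\<close>, hence the order \<open>(j, i)\<close>.\<close>

lemma edmd_aliasing_error:
  assumes g: "thin_extension \<tau> g s p q" and R: "1 < R" "R < inverse s"
    and m: "2 * n \<le> m" "0 < n" and ij: "i < 2 * n - 1" "j < 2 * n - 1"
  shows "cmod (edmd_matrix \<tau> (\<lambda>l z. z powi l) n m (edmd_points \<alpha> m) $$ (j, i)
      - fourier_coeff (\<lambda>z. \<tau> z powi obs_index n j) (obs_index n i))
    \<le> 2 * R powr (q * real_of_int \<bar>obs_index n j\<bar> + real_of_int \<bar>obs_index n i\<bar>) / (R ^ m - 1)"
proof -
  let ?k = "obs_index n i" and ?l = "obs_index n j"
  let ?f = "\<lambda>z. g z powi ?l * z powi (- ?k)"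
  have s: "0 < s" "s < 1" using g by (auto simp: thin_extension_def)
  have hol: "?f holomorphic_on annulus s"
    using annulus_nonzero[OF s(1)]
    by (intro holomorphic_on_mult thin_extension_holomorphic_power[OF g] holomorphic_on_power_int holomorphic_on_ident) auto
  have "cmod ((\<Sum>t<m. ?f (edmd_points \<alpha> m t)) / of_nat m - fourier_coeff ?f 0)
      \<le> 2 * (R powr (q * real_of_int \<bar>?l\<bar>) * R powr real_of_int \<bar>?k\<bar>) / (R ^ m - 1)"
  proof (rule trapezoidal_error[OF hol s R])
    show "edmd_points \<alpha> m t ^ m = exp (of_nat m * (\<i> * of_real \<alpha>))" for t
      by (rule edmd_points_power) (use m in simp)
    show "(\<Sum>t<m. edmd_points \<alpha> m t ^ d) = 0" if "0 < d" "d < m" for d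
    proof -
      have "\<not> int m dvd int d" using that by (auto dest: dvd_imp_le)
      then show ?thesis using edmd_points_orthogonal[of m "int d" \<alpha>] m by simp
    qed
    fix w assume w: "cmod w = R \<or> cmod w = inverse R"
    have "cmod (?f w) = cmod (g w powi ?l) * cmod w powi (- ?k)" by (simp add: norm_mult norm_power_int)
    also have "\<dots> \<le> R powr (q * real_of_int \<bar>?l\<bar>) * R powr real_of_int \<bar>- ?k\<bar>"
      using g R w by (intro mult_mono power_int_le_powr_abs) (auto simp: thin_extension_def)
    finally show "cmod (?f w) \<le> R powr (q * real_of_int \<bar>?l\<bar>) * R powr real_of_int \<bar>?k\<bar>" by simp
  qed (use m norm_edmd_points in auto)
  moreover have "edmd_matrix \<tau> (\<lambda>l z. z powi l) n m (edmd_points \<alpha> m) $$ (j, i)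
      = (\<Sum>t<m. ?f (edmd_points \<alpha> m t)) / of_nat m"
  proof -
    have "\<tau> (edmd_points \<alpha> m t) = g (edmd_points \<alpha> m t)" for t
      using g norm_edmd_points[of \<alpha> m t] by (simp add: thin_extension_def)
    then show ?thesis
      unfolding edmd_matrix_equidistant[OF m] using ij
      by (simp add: edmd_G_def cnj_power_int_unit[OF norm_edmd_points])
  qed
  moreover have "fourier_coeff ?f 0 = fourier_coeff (\<lambda>z. \<tau> z powi ?l) ?k"
    unfolding thin_extension_fourier_power[OF g]
    by (simp add: fourier_coeff_def cis_power_int mult.commute)
  ultimately show ?thesis by (simp add: powr_add)
qed

text \<open>The transpose of \<open>A\<close> conjugated by the diagonal matrix with entries
  \<open>r ^ |k|\<close>: since EDMD rows belong to the composed observables, it is the transpose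
  that acts on Laurent coefficients, and the conjugation passes to the coordinates of
  \<open>hardy_embed\<close>.\<close>

definition weighted_mat :: "real \<Rightarrow> nat \<Rightarrow> complex mat \<Rightarrow> complex mat" where
  "weighted_mat r n A = Matrix.mat (2 * n - 1) (2 * n - 1)
     (\<lambda>(i, j). A $$ (j, i) * of_real (r ^ nat \<bar>obs_index n i\<bar> / r ^ nat \<bar>obs_index n j\<bar>))"

definition weighted_vec :: "real \<Rightarrow> nat \<Rightarrow> complex Matrix.vec \<Rightarrow> complex Matrix.vec" where
  "weighted_vec r n v = Matrix.vec (2 * n - 1) (\<lambda>i. v $ i * of_real (r ^ nat \<bar>obs_index n i\<bar>))"

text \<open>The transpose of \<open>A\<close> acting on Laurent polynomials of degree less than \<open>n\<close>, extended by zero to the whole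
  Hilbert space.\<close>

definition laurent_section_op :: "real \<Rightarrow> nat \<Rightarrow> complex mat \<Rightarrow> ell2 \<Rightarrow>\<^sub>L ell2" where
  "laurent_section_op r n A = matrix_op (block_matrix n (weighted_mat r n A))"

text \<open>Inside the block the difference is the aliasing error; outside it is an entry of the
  Koopman matrix with \<open>|k| + |l| \<ge> n\<close>, small by decay alone. \<open>C\<close> and
  \<open>\<theta>\<close> are chosen before \<open>n\<close>, \<open>m\<close> and
  \<open>\<alpha>\<close>. In the application \<open>D\<close> is the sum of the extreme
  derivatives.\<close>

lemma edmd_approximation:
  assumes g: "thin_extension \<tau> g s p q" and p: "1 < p" and q: "0 \<le> q" and R: "1 < R" "R < inverse s"
    and \<epsilon>: "0 < \<epsilon>" "1 + q + \<epsilon> \<le> D"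
  shows "\<exists>C \<theta>. exp_bounded C \<theta> (koopman_matrix (inverse R) \<tau>) \<and>
    (\<forall>n m \<alpha>. 1 \<le> n \<longrightarrow> 2 * n \<le> m \<longrightarrow> D * real n \<le> real m \<longrightarrow>
      exp_bounded (C * \<theta> ^ n) \<theta> (\<lambda>k l. koopman_matrix (inverse R) \<tau> k l
        - block_matrix n (weighted_mat (inverse R) n
            (edmd_matrix \<tau> (\<lambda>l z. z powi l) n m (edmd_points \<alpha> m))) k l))"
proof -
  obtain \<theta>0 where \<theta>0: "exp_bounded 1 \<theta>0 (koopman_matrix (inverse R) \<tau>)"
    using koopman_matrix_exp_bounded[OF g p R] by blast
  have t0: "0 < \<theta>0" "\<theta>0 < 1" using \<theta>0 by (auto simp: exp_bounded_def)
  \<comment> \<open>The error \<open>R powr (- \<epsilon> n)\<close> equals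
    \<open>\<eta> ^ (4 n)\<close>, which covers both the rate \<open>n\<close> and the entry decay,
    as \<open>|k| + |l| < 2 n\<close> in the block.\<close>
  define \<eta> where "\<eta> = R powr (- \<epsilon> / 4)"
  have \<eta>: "0 < \<eta>" "\<eta> < 1" using R \<epsilon> by (auto simp: \<eta>_def powr_less_one)
  \<comment> \<open>The square root splits the decay outside the block: one half yields
    \<open>\<theta> ^ n\<close>, the other remains as decay of the entries.\<close>
  define \<theta> where "\<theta> = max (sqrt \<theta>0) \<eta>"
  have \<theta>: "0 < \<theta>" "\<theta> < 1" "sqrt \<theta>0 \<le> \<theta>" "\<eta> \<le> \<theta>" using t0 \<eta> by (auto simp: \<theta>_def less_max_iff_disj)
  have "\<theta>0 \<le> sqrt \<theta>0" using t0 by (intro real_le_rsqrt) (simp add: power2_eq_square mult_left_le)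
  then have "\<theta>0 \<le> \<theta>" using \<theta>(3) by linarith
  \<comment> \<open>The constant absorbs
    \<open>R ^ m - 1 \<ge> (1 - inverse R) * R ^ m\<close>.\<close>
  define C1 where "C1 = 2 / (1 - inverse R)"
  have R1: "inverse R < 1" using R by (simp add: inverse_less_1_iff)
  then have C1: "0 < C1" by (simp add: C1_def)
  have koop: "exp_bounded (1 + C1) \<theta> (koopman_matrix (inverse R) \<tau>)"
    by (rule exp_bounded_mono[OF \<theta>0]) (use C1 \<open>\<theta>0 \<le> \<theta>\<close> \<theta> in auto)
  have "exp_bounded ((1 + C1) * \<theta> ^ n) \<theta> (\<lambda>k l. koopman_matrix (inverse R) \<tau> k l
        - block_matrix n (weighted_mat (inverse R) n
            (edmd_matrix \<tau> (\<lambda>l z. z powi l) n m (edmd_points \<alpha> m))) k l)"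
    if n: "1 \<le> n" "2 * n \<le> m" "D * real n \<le> real m" for n m \<alpha>
    unfolding exp_bounded_def
  proof (intro conjI allI \<theta>(1,2))
    fix k l
    let ?M = "edmd_matrix \<tau> (\<lambda>l z. z powi l) n m (edmd_points \<alpha> m)"
    let ?d = "koopman_matrix (inverse R) \<tau> k l - block_matrix n (weighted_mat (inverse R) n ?M) k l"
    have le: "cmod ?d \<le> (1 + C1) * (\<theta> ^ n * \<theta> ^ (nat \<bar>k\<bar> + nat \<bar>l\<bar>))"
    proof (cases "\<bar>k\<bar> < int n \<and> \<bar>l\<bar> < int n")
      case True
      let ?i = "nat (k + (int n - 1))" and ?j = "nat (l + (int n - 1))"
      let ?k = "real_of_int \<bar>k\<bar>" and ?l = "real_of_int \<bar>l\<bar>"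
      have ij: "?i < 2 * n - 1" "?j < 2 * n - 1" and kl: "obs_index n ?i = k" "obs_index n ?j = l"
        using True obs_index_nat(1,2) by auto
      have Rm: "1 < R ^ m" using R n by (intro one_less_power) auto
      have Rm': "(1 - inverse R) * R powr (D * real n) \<le> R ^ m - 1"
      proof -
        have "R \<le> R ^ m" using self_le_power[of R m] R n by simp
        then have "1 \<le> inverse R * R ^ m" using R by (simp add: field_simps)
        then have "(1 - inverse R) * R ^ m \<le> R ^ m - 1" by (simp add: algebra_simps)
        moreover have "R powr (D * real n) \<le> R ^ m"
          using powr_mono[OF n(3), of R] R by (simp add: powr_realpow)
        ultimately show ?thesis using mult_left_mono[of "R powr (D * real n)" "R ^ m" "1 - inverse R"] R1 by linarith
      qed
      have "?d = (fourier_coeff (\<lambda>z. \<tau> z powi l) k - ?M $$ (?j, ?i)) * of_real (inverse R ^ nat \<bar>k\<bar> / inverse R ^ nat \<bar>l\<bar>)"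
        using True ij kl by (simp add: koopman_matrix_def block_matrix_def weighted_mat_def left_diff_distrib diff_divide_distrib)
      then have "cmod ?d = cmod (?M $$ (?j, ?i) - fourier_coeff (\<lambda>z. \<tau> z powi l) k) * R powr (?l - ?k)"
        using R by (simp only: weight_quotient_powr norm_mult norm_of_real norm_minus_commute) simp
      also have "\<dots> \<le> (2 * R powr (q * ?l + ?k) / (R ^ m - 1)) * R powr (?l - ?k)"
        using edmd_aliasing_error[OF g R n(2) _ ij, of \<alpha>] n(1) unfolding kl
        by (intro mult_right_mono) auto
      also have "\<dots> = 2 * (R powr (q * ?l + ?k) * R powr (?l - ?k)) / (R ^ m - 1)" by simp
      \<comment> \<open>The weights cancel the dependence on \<open>k\<close>; what is left grows
        only with \<open>|l| < n\<close>.\<close>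
      also have "R powr (q * ?l + ?k) * R powr (?l - ?k) = R powr ((q + 1) * ?l)"
        by (simp add: algebra_simps flip: powr_add)
      also have "2 * R powr ((q + 1) * ?l) / (R ^ m - 1)
          \<le> 2 * R powr ((q + 1) * real n) / ((1 - inverse R) * R powr (D * real n))"
        using R True q R1 Rm' by (intro frac_le mult_left_mono powr_mono mult_pos_pos) auto
      also have "\<dots> = C1 * R powr ((q + 1) * real n - D * real n)"
        by (simp add: C1_def powr_diff)
      also have "\<dots> \<le> C1 * R powr (- \<epsilon> * real n)"
      proof -
        have "(q + 1) * real n - D * real n \<le> - \<epsilon> * real n"
          using mult_right_mono[OF \<epsilon>(2), of "real n"] by (simp add: algebra_simps)
        then show ?thesis using C1 R by (intro mult_left_mono powr_mono) auto
      qed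
      also have "R powr (- \<epsilon> * real n) = \<eta> ^ (4 * n)"
        using R by (simp add: \<eta>_def powr_powr flip: powr_realpow)
      also have "C1 * \<eta> ^ (4 * n) \<le> C1 * \<theta> ^ (4 * n)"
        using C1 \<eta> \<theta> by (intro mult_left_mono power_mono) auto
      also have "\<dots> \<le> C1 * \<theta> ^ (n + (nat \<bar>k\<bar> + nat \<bar>l\<bar>))"
        using C1 \<theta> True by (intro mult_left_mono power_decreasing) auto
      also have "\<dots> \<le> (1 + C1) * \<theta> ^ (n + (nat \<bar>k\<bar> + nat \<bar>l\<bar>))"
        using \<theta> by (intro mult_right_mono) auto
      finally show ?thesis by (simp only: power_add)
    next
      case False
      then have "block_matrix n (weighted_mat (inverse R) n ?M) k l = 0" by (auto simp: block_matrix_def)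
      then have "cmod ?d \<le> \<theta>0 ^ (nat \<bar>k\<bar> + nat \<bar>l\<bar>)" using \<theta>0 by (simp add: exp_bounded_def)
      also have "\<dots> = sqrt \<theta>0 ^ (2 * (nat \<bar>k\<bar> + nat \<bar>l\<bar>))" unfolding power_mult using t0 by simp
      also have "\<dots> \<le> \<theta> ^ (2 * (nat \<bar>k\<bar> + nat \<bar>l\<bar>))" using \<theta> t0 by (intro power_mono) auto
      also have "\<dots> \<le> \<theta> ^ (n + (nat \<bar>k\<bar> + nat \<bar>l\<bar>))" using \<theta> False by (intro power_decreasing) auto
      also have "\<dots> \<le> (1 + C1) * \<theta> ^ (n + (nat \<bar>k\<bar> + nat \<bar>l\<bar>))" using \<theta> C1 by simp
      finally show ?thesis by (simp only: power_add)
    qed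
    then show "cmod ?d \<le> (1 + C1) * \<theta> ^ n * \<theta> ^ (nat \<bar>k\<bar> + nat \<bar>l\<bar>)" by (simp only: mult.assoc)
  qed
  then show ?thesis using koop by blast
qed


section \<open>Finite matrices as operators on Laurent polynomials\<close>

lemma weighted_mat_carrier: "weighted_mat r n A \<in> carrier_mat (2 * n - 1) (2 * n - 1)"
  by (simp add: weighted_mat_def)

lemma weighted_vec_carrier: "weighted_vec r n v \<in> carrier_vec (2 * n - 1)"
  by (simp add: weighted_vec_def)

lemma hardy_embed_laurent_of_vec:
  assumes r: "0 < r" "r < 1"
  shows "hardy_embed r (laurent_of_vec n v) = emb_vec n (weighted_vec r n v)"
    and "laurent_of_vec n v \<in> laurent_polys"
proof -
  let ?S = "{k. \<bar>k\<bar> < int n}" and ?c = "\<lambda>k. v $ nat (k + (int n - 1))"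
  have eq: "laurent_of_vec n v = (\<lambda>z. \<Sum>k\<in>?S. ?c k * z powi k)"
    by (simp add: laurent_of_vec_def fun_eq_iff)
  show poly: "laurent_of_vec n v \<in> laurent_polys"
    unfolding laurent_polys_def mem_Collect_eq
    by (rule exI[of _ ?S], rule exI[of _ ?c]) (rule conjI[OF finite_section eq])
  show "hardy_embed r (laurent_of_vec n v) = emb_vec n (weighted_vec r n v)"
  proof (rule ell2_eqI)
    fix k
    show "ell2_nth (hardy_embed r (laurent_of_vec n v)) k = ell2_nth (emb_vec n (weighted_vec r n v)) k"
      unfolding hardy_embed_nth[OF r continuous_on_laurent_poly[OF poly]]
      unfolding eq fourier_coeff_laurent_poly[OF finite_section]
      by (auto simp: emb_vec.rep_eq weighted_vec_def obs_index_nat)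
  qed
qed

lemma complex_linear_laurent_section_op: "complex_linear_op (laurent_section_op r n A)"
  unfolding laurent_section_op_def using exp_bounded_block_matrix complex_linear_matrix_op by blast

lemma laurent_section_op_emb:
  assumes r: "0 < r" and A: "A \<in> carrier_mat (2 * n - 1) (2 * n - 1)" and v: "v \<in> carrier_vec (2 * n - 1)"
  shows "laurent_section_op r n A (emb_vec n (weighted_vec r n v)) = emb_vec n (weighted_vec r n (transpose_mat A *\<^sub>v v))"
proof -
  have "weighted_mat r n A *\<^sub>v weighted_vec r n v = weighted_vec r n (transpose_mat A *\<^sub>v v)"
  proof (rule eq_vecI)
    fix i assume "i < dim_vec (weighted_vec r n (transpose_mat A *\<^sub>v v))"
    then have i: "i < 2 * n - 1" by (simp add: weighted_vec_def)
    have "(weighted_mat r n A *\<^sub>v weighted_vec r n v) $ i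
        = (\<Sum>j = 0..<2 * n - 1. A $$ (j, i) * v $ j * of_real (r ^ nat \<bar>obs_index n i\<bar>))"
      using i r by (auto simp: weighted_mat_def weighted_vec_def scalar_prod_def intro!: sum.cong)
    also have "\<dots> = weighted_vec r n (transpose_mat A *\<^sub>v v) $ i"
      using i A v by (auto simp: weighted_vec_def scalar_prod_def sum_distrib_right)
    finally show "(weighted_mat r n A *\<^sub>v weighted_vec r n v) $ i = weighted_vec r n (transpose_mat A *\<^sub>v v) $ i" .
  qed (simp add: weighted_mat_def weighted_vec_def)
  then show ?thesis
    unfolding laurent_section_op_def block_op_eq[OF weighted_mat_carrier]
    by (simp only: section_vec_emb_vec[OF weighted_vec_carrier])
qed

lemma emb_weighted_vec_nonzero:
  assumes r: "0 < r" and v: "v \<in> carrier_vec (2 * n - 1)" "v \<noteq> 0\<^sub>v (2 * n - 1)"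
  shows "emb_vec n (weighted_vec r n v) \<noteq> 0"
proof
  assume "emb_vec n (weighted_vec r n v) = 0"
  then have "weighted_vec r n v = section_vec n 0"
    using section_vec_emb_vec[OF weighted_vec_carrier] by metis
  then have "v $ i = 0" if "i < 2 * n - 1" for i
    using that r by (auto simp: weighted_vec_def section_vec_def vec_eq_iff ell2_nth_simps)
  then show False using v by (auto intro!: eq_vecI)
qed

lemma emb_weighted_vec_smult:
  assumes "v \<in> carrier_vec (2 * n - 1)"
  shows "emb_vec n (weighted_vec r n (c \<cdot>\<^sub>v v)) = cscale c (emb_vec n (weighted_vec r n v))"
proof -
  have "weighted_vec r n (c \<cdot>\<^sub>v v) = c \<cdot>\<^sub>v weighted_vec r n v"
    using assms by (intro eq_vecI) (auto simp: weighted_vec_def)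
  then show ?thesis by (simp only: emb_vec_smult[OF weighted_vec_carrier])
qed

lemma emb_weighted_vec_minus:
  assumes "v \<in> carrier_vec (2 * n - 1)" "w \<in> carrier_vec (2 * n - 1)"
  shows "emb_vec n (weighted_vec r n (v - w)) = emb_vec n (weighted_vec r n v) - emb_vec n (weighted_vec r n w)"
proof -
  have "weighted_vec r n (v - w) = weighted_vec r n v - weighted_vec r n w"
    using assms by (intro eq_vecI) (auto simp: weighted_vec_def left_diff_distrib)
  then show ?thesis by (simp only: emb_vec_minus[OF weighted_vec_carrier weighted_vec_carrier])
qed

lemma spectrum_transpose:
  fixes A :: "complex mat"
  assumes "A \<in> carrier_mat n n" shows "spectrum (transpose_mat A) = spectrum A"
  using assms by (simp add: spectrum_root_char_poly)

lemma spectrum_imp_op_eigenvalue: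
  assumes r: "0 < r" and A: "A \<in> carrier_mat (2 * n - 1) (2 * n - 1)" and z: "z \<in> spectrum A"
  shows "op_eigenvalue (laurent_section_op r n A) z"
proof -
  have "z \<in> spectrum (transpose_mat A)" using z spectrum_transpose[OF A] by simp
  then obtain v where "eigenvector (transpose_mat A) v z" by (auto simp: spectrum_def eigenvalue_def)
  then have v: "v \<in> carrier_vec (2 * n - 1)" "v \<noteq> 0\<^sub>v (2 * n - 1)" "transpose_mat A *\<^sub>v v = z \<cdot>\<^sub>v v"
    using A by (auto simp: eigenvector_def)
  show ?thesis
    unfolding op_eigenvalue_def
    using laurent_section_op_emb[OF r A v(1)] emb_weighted_vec_nonzero[OF r v(1,2)]
    unfolding v(3) emb_weighted_vec_smult[OF v(1)] by blast
qed

text \<open>For \<open>z \<noteq> 0\<close> the eigenvector is \<open>1 / z\<close> times an element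
  of the range, so it is supported in the block. For \<open>z = 0\<close> it might live entirely on
  the coordinates outside.\<close>

lemma op_eigenvalue_imp_spectrum:
  assumes r: "0 < r" and A: "A \<in> carrier_mat (2 * n - 1) (2 * n - 1)"
    and z: "op_eigenvalue (laurent_section_op r n A) z" "z \<noteq> 0"
  shows "z \<in> spectrum A"
proof -
  obtain x where x: "x \<noteq> 0" "laurent_section_op r n A x = cscale z x" using z by (auto simp: op_eigenvalue_def)
  define u where "u = weighted_mat r n A *\<^sub>v section_vec n x"
  have u: "u \<in> carrier_vec (2 * n - 1)"
    unfolding u_def by (rule mult_mat_vec_carrier[OF weighted_mat_carrier section_vec_carrier])
  have xu: "cscale z x = emb_vec n u"
    using x(2) unfolding laurent_section_op_def block_op_eq[OF weighted_mat_carrier] u_def by simp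
  define v where "v = Matrix.vec (2 * n - 1) (\<lambda>i. u $ i / (z * of_real (r ^ nat \<bar>obs_index n i\<bar>)))"
  have v: "v \<in> carrier_vec (2 * n - 1)" by (simp add: v_def)
  have "weighted_vec r n (z \<cdot>\<^sub>v v) = u"
    using u r z by (intro eq_vecI) (auto simp: weighted_vec_def v_def)
  then have "cscale z (emb_vec n (weighted_vec r n v)) = cscale z x"
    using emb_weighted_vec_smult[OF v] xu by metis
  then have xv: "x = emb_vec n (weighted_vec r n v)"
    using z(2) by (metis cscale_simps(5,6) left_inverse)
  have At: "transpose_mat A *\<^sub>v v \<in> carrier_vec (2 * n - 1)" using A v by simp
  have zv: "z \<cdot>\<^sub>v v \<in> carrier_vec (2 * n - 1)" using v by simp
  have "emb_vec n (weighted_vec r n (transpose_mat A *\<^sub>v v - z \<cdot>\<^sub>v v)) = 0"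
    using x(2) unfolding emb_weighted_vec_minus[OF At zv] xv laurent_section_op_emb[OF r A v] emb_weighted_vec_smult[OF v]
    by simp
  then have "transpose_mat A *\<^sub>v v - z \<cdot>\<^sub>v v = 0\<^sub>v (2 * n - 1)"
    using emb_weighted_vec_nonzero[OF r minus_carrier_vec[OF At zv]] by blast
  then have "(transpose_mat A *\<^sub>v v) $ i - (z \<cdot>\<^sub>v v) $ i = 0" if "i < 2 * n - 1" for i
    using that At zv by (metis carrier_vecD index_minus_vec(1) index_zero_vec(1))
  then have "transpose_mat A *\<^sub>v v = z \<cdot>\<^sub>v v"
    using carrier_vecD[OF At] carrier_vecD[OF zv] by (intro eq_vecI) (metis right_minus_eq, metis)
  moreover have "v \<noteq> 0\<^sub>v (2 * n - 1)"
  proof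
    assume "v = 0\<^sub>v (2 * n - 1)"
    then have "weighted_vec r n v = 0\<^sub>v (2 * n - 1)" by (intro eq_vecI) (auto simp: weighted_vec_def)
    then show False using x(1) xv emb_vec_zero by simp
  qed
  ultimately have "eigenvector (transpose_mat A) v z" using A v by (simp add: eigenvector_def)
  then have "z \<in> spectrum (transpose_mat A)" by (auto simp: spectrum_def eigenvalue_def)
  then show ?thesis using spectrum_transpose[OF A] by simp
qed

lemma laurent_section_op_gen_eigenvector:
  assumes r: "0 < r" and A: "A \<in> carrier_mat (2 * n - 1) (2 * n - 1)" and v: "v \<in> carrier_vec (2 * n - 1)"
  shows "(blinfun_apply (scalar_op z - laurent_section_op r n A) ^^ \<nu>) (emb_vec n (weighted_vec r n v))
    = emb_vec n (weighted_vec r n (((z \<cdot>\<^sub>m 1\<^sub>m (2 * n - 1) - transpose_mat A) ^\<^sub>m \<nu>) *\<^sub>v v))"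
  using v
proof (induction \<nu> arbitrary: v)
  case 0
  have "dim_row (z \<cdot>\<^sub>m 1\<^sub>m (2 * n - 1) - transpose_mat A) = 2 * n - 1" using A by simp
  then show ?case unfolding pow_mat.simps using one_mult_mat_vec[OF 0] by simp
next
  case (Suc \<nu>)
  let ?B = "z \<cdot>\<^sub>m 1\<^sub>m (2 * n - 1) - transpose_mat A"
  have tA: "transpose_mat A \<in> carrier_mat (2 * n - 1) (2 * n - 1)" using A by simp
  then have B: "?B \<in> carrier_mat (2 * n - 1) (2 * n - 1)" by (rule minus_carrier_mat)
  then have Bv: "?B *\<^sub>v v \<in> carrier_vec (2 * n - 1)" using Suc.prems by simp
  have z1: "z \<cdot>\<^sub>m 1\<^sub>m (2 * n - 1) \<in> carrier_mat (2 * n - 1) (2 * n - 1)" by simp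
  have "(z \<cdot>\<^sub>m 1\<^sub>m (2 * n - 1)) *\<^sub>v v = z \<cdot>\<^sub>v v"
    using Suc.prems by (intro eq_vecI) auto
  then have Bv_eq: "?B *\<^sub>v v = z \<cdot>\<^sub>v v - transpose_mat A *\<^sub>v v"
    using minus_mult_distrib_mat_vec[OF z1 tA Suc.prems] by simp
  have zv: "z \<cdot>\<^sub>v v \<in> carrier_vec (2 * n - 1)" and Av: "transpose_mat A *\<^sub>v v \<in> carrier_vec (2 * n - 1)"
    using Suc.prems A by auto
  have step: "(scalar_op z - laurent_section_op r n A) (emb_vec n (weighted_vec r n v))
      = emb_vec n (weighted_vec r n (?B *\<^sub>v v))"
    unfolding Bv_eq emb_weighted_vec_minus[OF zv Av] emb_weighted_vec_smult[OF Suc.prems]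
    by (simp add: blinfun.diff_left laurent_section_op_emb[OF r A Suc.prems])
  have pow: "(?B ^\<^sub>m \<nu>) *\<^sub>v (?B *\<^sub>v v) = (?B ^\<^sub>m Suc \<nu>) *\<^sub>v v"
    using assoc_mult_mat_vec[OF pow_carrier_mat[OF B, of \<nu>] B Suc.prems] by simp
  show ?case
    unfolding funpow_Suc_right o_def step Suc.IH[OF Bv] pow ..
qed


section \<open>Small eigenvalues\<close>

lemma sum_obs_index: "(\<Sum>j<2 * n - 1. nat \<bar>obs_index n j\<bar>) = n * (n - 1)"
proof -
  have sum: "(\<Sum>k | \<bar>k\<bar> < int n. nat \<bar>k\<bar>) = n * (n - 1)"
  proof (induction n)
    case (Suc n)
    show ?case
    proof (cases "n = 0")
      case True
      then have "{k. \<bar>k\<bar> < int (Suc n)} = {0}" by auto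
      then show ?thesis using True by simp
    next
      case False
      have "{k. \<bar>k\<bar> < int (Suc n)} = insert (int n) (insert (- int n) {k. \<bar>k\<bar> < int n})"
        using False by auto
      then have "(\<Sum>k | \<bar>k\<bar> < int (Suc n). nat \<bar>k\<bar>) = n + (n + (\<Sum>k | \<bar>k\<bar> < int n. nat \<bar>k\<bar>))"
        using False finite_section[of n] by simp
      then show ?thesis using Suc False by (cases n) auto
    qed
  qed simp
  show ?thesis
    using sum.reindex_bij_betw[OF bij_betw_obs_index[of n], of "\<lambda>k. nat \<bar>k\<bar>"] sum
    by (simp add: lessThan_atLeast0)
qed

text \<open>The modulus of the determinant is the product of the moduli of all eigenvalues with
  multiplicity; the smallest of them is selected.\<close>

lemma norm_det_le_eigenvalue_power:
  fixes A :: "complex mat"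
  assumes A: "A \<in> carrier_mat N N" and N: "0 < N"
  obtains z where "z \<in> spectrum A" "cmod z ^ N \<le> cmod (det A)"
proof -
  obtain as where as: "char_poly A = (\<Prod>a\<leftarrow>as. [:- a, 1:])" "length as = N"
    using char_poly_factorized[OF A] by blast
  have spec: "spectrum A = set as"
    unfolding spectrum_root_char_poly[OF A] as(1) poly_prod_list by (auto simp: prod_list_zero_iff)
  have neg: "- A = (-1) \<cdot>\<^sub>m A" by (intro eq_matI) auto
  have "char_matrix A 0 = A" using A by (intro eq_matI) (auto simp: char_matrix_def)
  then have "cmod (poly (char_poly A) 0) = cmod (det A)"
    using char_poly_matrix[OF A, of 0] neg by (simp add: norm_mult norm_power)
  moreover have norm_list: "cmod (\<Prod>a\<leftarrow>xs. f a) = (\<Prod>a\<leftarrow>xs. cmod (f a))" for f :: "complex \<Rightarrow> complex" and xs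
    by (induction xs) (auto simp: norm_mult)
  ultimately have det: "cmod (det A) = (\<Prod>a\<leftarrow>as. cmod a)"
    unfolding as(1) poly_prod_list by (simp add: o_def norm_list)
  have "as \<noteq> []" using as(2) N by auto
  then obtain z where z: "z \<in> set as" "\<And>a. a \<in> set as \<Longrightarrow> cmod z \<le> cmod a"
    using finite_set[of as] by (metis arg_min_if_finite(1) arg_min_least set_empty)
  have "cmod z ^ length xs \<le> (\<Prod>a\<leftarrow>xs. cmod a)" if "set xs \<subseteq> set as" for xs
    using that by (induction xs) (auto intro!: mult_mono z(2))
  then show ?thesis using that[of z] z(1) spec det as(2) by auto
qed

text \<open>In each Leibniz product the weights \<open>w\<close> cancel, since a permutation only
  reorders them, and the decay factors multiply to \<open>\<theta> ^ (2 * (n * (n - 1)))\<close>.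
  Estimating the number of terms by \<open>N ^ N\<close> leaves a perfect \<open>N\<close>-th power
  as a bound for the determinant.\<close>

lemma small_eigenvalue:
  assumes r: "0 < r" and n: "1 \<le> n" and A: "A \<in> carrier_mat (2 * n - 1) (2 * n - 1)"
    and b: "exp_bounded C \<theta> (block_matrix n (weighted_mat r n A))"
  obtains z where "z \<in> spectrum A" "cmod z \<le> real (2 * n - 1) * C * \<theta> ^ (n - 1)"
proof -
  define N where "N = 2 * n - 1"
  have A: "A \<in> carrier_mat N N" using A by (simp add: N_def)
  have N: "0 < N" using n by (simp add: N_def)
  have \<theta>: "0 < \<theta>" "\<theta> < 1" using b by (auto simp: exp_bounded_def)
  have C: "0 \<le> C" by (rule exp_bounded_nonneg[OF b])
  define u where "u j = \<theta> ^ nat \<bar>obs_index n j\<bar>" for j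
  define w where "w j = r ^ nat \<bar>obs_index n j\<bar>" for j
  have u: "0 < u j" for j using \<theta> by (simp add: u_def)
  have w: "0 < w j" for j using r by (simp add: w_def)
  have ent: "cmod (A $$ (j, i)) \<le> C * u j * u i * w j / w i" if "i < N" "j < N" for i j
  proof -
    have "\<bar>obs_index n i\<bar> < int n" "\<bar>obs_index n j\<bar> < int n"
      using that obs_index_nat(3)[of i n] obs_index_nat(3)[of j n] by (auto simp: N_def)
    moreover have "nat (obs_index n i + (int n - 1)) = i" "nat (obs_index n j + (int n - 1)) = j"
      using that obs_index_nat(4)[of i n] obs_index_nat(4)[of j n] by (auto simp: N_def)
    ultimately have "block_matrix n (weighted_mat r n A) (obs_index n i) (obs_index n j)
        = A $$ (j, i) * of_real (w i / w j)"
      using that by (simp add: block_matrix_def weighted_mat_def w_def N_def)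
    then have "cmod (A $$ (j, i)) * (w i / w j) \<le> C * (u i * u j)"
      using b w[of i] w[of j] unfolding exp_bounded_def u_def power_add[symmetric]
      by (metis (no_types, lifting) abs_of_pos divide_pos_pos norm_mult norm_of_real)
    then show ?thesis using w[of i] w[of j] by (simp add: field_simps)
  qed
  have prod_u: "(\<Prod>j = 0..<N. u j) = \<theta> ^ (n * (n - 1))"
    unfolding u_def power_sum[symmetric] using sum_obs_index[of n] by (simp add: N_def lessThan_atLeast0)
  have prod_w: "0 < (\<Prod>j = 0..<N. w j)" using w by (intro prod_pos) auto
  have "cmod (det A) \<le> (\<Sum>p | p permutes {0..<N}. C ^ N * \<theta> ^ (2 * (n * (n - 1))))"
    unfolding det_def'[OF A]
  proof (rule sum_norm_le)
    fix p assume "p \<in> {p. p permutes {0..<N}}"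
    then have p: "p permutes {0..<N}" by simp
    then have lt: "p j < N" if "j < N" for j using permutes_in_image[OF p, of j] that by auto
    have "cmod (\<Prod>j = 0..<N. A $$ (j, p j)) \<le> (\<Prod>j = 0..<N. C * u j * u (p j) * w j / w (p j))"
      unfolding prod_norm[symmetric] by (intro prod_mono conjI norm_ge_zero ent) (auto intro: lt)
    also have "\<dots> = C ^ N * (\<Prod>j = 0..<N. u j) * (\<Prod>j = 0..<N. u (p j)) * (\<Prod>j = 0..<N. w j) / (\<Prod>j = 0..<N. w (p j))"
      by (simp add: prod.distrib prod_dividef)
    also have "(\<Prod>j = 0..<N. u (p j)) = (\<Prod>j = 0..<N. u j)"
      using prod.permute[OF p, of u] by (simp add: o_def)
    also have "(\<Prod>j = 0..<N. w (p j)) = (\<Prod>j = 0..<N. w j)"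
      using prod.permute[OF p, of w] by (simp add: o_def)
    also have "C ^ N * (\<Prod>j = 0..<N. u j) * (\<Prod>j = 0..<N. u j) * (\<Prod>j = 0..<N. w j) / (\<Prod>j = 0..<N. w j)
        = C ^ N * \<theta> ^ (2 * (n * (n - 1)))"
      unfolding prod_u mult_2 power_add nonzero_mult_div_cancel_right[OF less_imp_neq[OF prod_w, symmetric]]
      by (rule mult.assoc)
    finally show "cmod (signof p * (\<Prod>j = 0..<N. A $$ (j, p j))) \<le> C ^ N * \<theta> ^ (2 * (n * (n - 1)))"
      by (simp add: norm_mult sign_def)
  qed
  also have "\<dots> = fact N * (C ^ N * \<theta> ^ (2 * (n * (n - 1))))"
    by (simp add: card_permutations[OF refl])
  also have "\<dots> \<le> real N ^ N * (C ^ N * \<theta> ^ ((n - 1) * N))"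
  proof (rule mult_mono)
    show "fact N \<le> real N ^ N" using fact_le_power[of N, where 'a = real] by simp
    \<comment> \<open>Some decay is given up here so that the exponent becomes a multiple of
      \<open>N = 2 n - 1\<close> and the root can be taken.\<close>
    have "(n - 1) * N \<le> (n - 1) * (2 * n)" by (intro mult_le_mono) (auto simp: N_def)
    then have "(n - 1) * N \<le> 2 * (n * (n - 1))" by (simp add: mult_ac)
    then show "C ^ N * \<theta> ^ (2 * (n * (n - 1))) \<le> C ^ N * \<theta> ^ ((n - 1) * N)"
      using C \<theta> by (intro mult_left_mono power_decreasing) auto
  qed (use C \<theta> in auto)
  also have "\<dots> = (real N * C * \<theta> ^ (n - 1)) ^ N" by (simp only: power_mult_distrib power_mult mult.assoc)
  finally have det: "cmod (det A) \<le> (real N * C * \<theta> ^ (n - 1)) ^ N" .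
  obtain z where z: "z \<in> spectrum A" "cmod z ^ N \<le> cmod (det A)"
    by (rule norm_det_le_eigenvalue_power[OF A N])
  have "cmod z ^ N \<le> (real N * C * \<theta> ^ (n - 1)) ^ N" using z(2) det by linarith
  then have "cmod z \<le> real N * C * \<theta> ^ (n - 1)"
    using power_mono_iff[of "cmod z" "real N * C * \<theta> ^ (n - 1)" N] N C \<theta> by simp
  then show ?thesis using that z(1) by (simp add: N_def)
qed


section \<open>Spectral approximation by EDMD\<close>

lemma exponential_approximation:
  fixes lams :: "nat \<Rightarrow> complex"
  assumes q: "0 < q" "q < 1" and le: "\<forall>\<^sub>F n in sequentially. cmod (lams n - lam) \<le> C * q ^ n"
  shows "lams \<longlonglongrightarrow> lam" "\<exists>a>0. (\<lambda>n. cmod (lam - lams n)) \<in> O(\<lambda>n. exp (- a * real n))"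
proof -
  have "(\<lambda>n. C * q ^ n) \<longlonglongrightarrow> C * 0"
    by (intro tendsto_mult_left LIMSEQ_realpow_zero) (use q in auto)
  then have "(\<lambda>n. lams n - lam) \<longlonglongrightarrow> 0"
    using le by (intro Lim_null_comparison[OF le]) simp
  then show "lams \<longlonglongrightarrow> lam" by (simp add: LIM_zero_iff)
  have e: "q ^ n = exp (- (- ln q) * real n)" for n
    using q by (simp add: exp_of_nat2_mult)
  have "(\<lambda>n. cmod (lam - lams n)) \<in> O(\<lambda>n. exp (- (- ln q) * real n))"
    unfolding e[symmetric]
    by (rule bigoI[of _ C]) (use le q in \<open>auto simp: norm_minus_commute elim: eventually_mono\<close>)
  then show "\<exists>a>0. (\<lambda>n. cmod (lam - lams n)) \<in> O(\<lambda>n. exp (- a * real n))"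
    using q by (intro exI[of _ "- ln q"]) (auto simp: ln_less_zero)
qed

text \<open>Half of the decay absorbs the linear factor; the division by \<open>\<theta>\<close>
  corrects the exponent \<open>n - 1\<close>.\<close>

lemma linear_times_exponential:
  fixes \<theta> :: real
  assumes \<theta>: "0 < \<theta>" "\<theta> < 1" and C: "0 \<le> C"
  shows "\<forall>\<^sub>F n in sequentially. real (2 * n - 1) * C * \<theta> ^ (n - 1) \<le> 2 * C / \<theta> * sqrt \<theta> ^ n"
proof -
  have "(\<lambda>n. real n * sqrt \<theta> ^ n) \<longlonglongrightarrow> 0"
    using powser_times_n_limit_0[of "sqrt \<theta>"] \<theta> by simp
  then have "\<forall>\<^sub>F n in sequentially. real n * sqrt \<theta> ^ n < 1" by (rule order_tendstoD(2)) simp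
  then show ?thesis using eventually_ge_at_top[of 1]
  proof eventually_elim
    case (elim n)
    have "\<theta> ^ (n - 1) = \<theta> ^ n / \<theta>" using elim(2) \<theta> by (cases n) auto
    moreover have "real (2 * n - 1) * C * (\<theta> ^ n / \<theta>) \<le> real (2 * n) * C * (\<theta> ^ n / \<theta>)"
      using \<theta> C by (intro mult_right_mono) auto
    ultimately have "real (2 * n - 1) * C * \<theta> ^ (n - 1) \<le> real (2 * n) * C * (\<theta> ^ n / \<theta>)" by simp
    also have "\<theta> ^ n = sqrt \<theta> ^ n * sqrt \<theta> ^ n" using \<theta> by (simp flip: power_mult_distrib)
    also have "real (2 * n) * C * (sqrt \<theta> ^ n * sqrt \<theta> ^ n / \<theta>) = (2 * C / \<theta> * sqrt \<theta> ^ n) * (real n * sqrt \<theta> ^ n)"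
      by simp
    also have "\<dots> \<le> (2 * C / \<theta> * sqrt \<theta> ^ n) * 1"
      using elim(1) \<theta> C by (intro mult_left_mono) auto
    finally show ?case by simp
  qed
qed

text \<open>No dynamics is left at this point: the three spectral claims follow from exponential
  closeness of the weighted matrix entries alone.\<close>

lemma laurent_section_spectral_approximation:
  fixes M :: "nat \<Rightarrow> complex mat"
  assumes r: "0 < r" "r < 1" and a: "exp_bounded C \<theta> a" and K: "K = matrix_op a"
    and M: "\<And>n. 1 \<le> n \<Longrightarrow> M n \<in> carrier_mat (2 * n - 1) (2 * n - 1)"
    and close: "\<And>n. 1 \<le> n \<Longrightarrow>
      exp_bounded (C * \<theta> ^ n) \<theta> (\<lambda>k l. a k l - block_matrix n (weighted_mat r n (M n)) k l)"
  defines "approximates \<equiv> \<lambda>lam lams. (\<forall>n\<ge>1. lams n \<in> spectrum (M n)) \<and> lams \<longlonglongrightarrow> lam \<and>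
      (\<exists>a>0. (\<lambda>n. cmod (lam - lams n)) \<in> O(\<lambda>n. exp (- a * real n)))"
  shows "\<lbrakk>\<And>n. 1 \<le> n \<Longrightarrow> lams n \<in> spectrum (M n); lams \<longlonglongrightarrow> lam\<rbrakk> \<Longrightarrow> lam \<in> op_spectrum K"
    and "lam \<in> op_spectrum K \<Longrightarrow> \<exists>lams. approximates lam lams"
    and "\<lbrakk>lam \<in> op_spectrum K; lam \<noteq> 0; lams \<longlonglongrightarrow> lam;
      \<And>n. 1 \<le> n \<Longrightarrow> gen_eigenvector (transpose_mat (M n)) (\<xi> n) (lams n);
      \<And>n. 1 \<le> n \<Longrightarrow> h n = (\<lambda>z. c n * laurent_of_vec n (\<xi> n) z) \<and> norm (hardy_embed r (h n)) = 1\<rbrakk> \<Longrightarrow>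
      \<exists>b>0. (\<lambda>n. norm (riesz_projection K lam (hardy_embed r (h n)) - hardy_embed r (h n)))
        \<in> O(\<lambda>n. exp (- b * real n))"
proof -
  define Kn where "Kn n = laurent_section_op r n (M n)" for n
  have \<theta>: "0 < \<theta>" "\<theta> < 1" using a by (auto simp: exp_bounded_def)
  have C: "0 \<le> C" by (rule exp_bounded_nonneg[OF a])
  have tc: "truncation_close K" unfolding K by (rule truncation_close_matrix_op[OF a])
  have cl: "complex_linear_op (Kn n)" for n unfolding Kn_def by (rule complex_linear_laurent_section_op)
  define W where "W = C * weight_const \<theta>"
  have near: "norm (K - Kn n) \<le> W * \<theta> ^ n" if n: "1 \<le> n" for n
  proof -
    obtain D where D: "exp_bounded D (1 / 2) (block_matrix n (weighted_mat r n (M n)))"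
      using exp_bounded_block_matrix by blast
    have "K - Kn n = matrix_op (\<lambda>k l. a k l - block_matrix n (weighted_mat r n (M n)) k l)"
      unfolding K Kn_def laurent_section_op_def by (rule matrix_op_diff[OF a D])
    then show ?thesis using norm_matrix_op[OF close[OF n]] by (simp add: W_def mult_ac)
  qed
  have conv: "\<forall>\<^sub>F n in sequentially. norm (K - Kn n) \<le> W * \<theta> ^ n"
    using eventually_ge_at_top[of 1] by (rule eventually_mono) (rule near)
  have lim: "(\<lambda>n. norm (Kn n - K)) \<longlonglongrightarrow> 0"
  proof (rule tendsto_sandwich[of "\<lambda>_. 0"])
    show "\<forall>\<^sub>F n in sequentially. norm (Kn n - K) \<le> W * \<theta> ^ n"
      using conv by (simp add: norm_minus_commute)
    show "(\<lambda>n. W * \<theta> ^ n) \<longlonglongrightarrow> 0"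
      using tendsto_mult_left[OF LIMSEQ_realpow_zero[of \<theta>], of W] \<theta> by simp
  qed auto
  show "lam \<in> op_spectrum K" if lams: "\<And>n. 1 \<le> n \<Longrightarrow> lams n \<in> spectrum (M n)" "lams \<longlonglongrightarrow> lam" for lam lams
  proof (rule limit_of_eigenvalues_in_spectrum[OF lams(2) _ lim])
    show "\<forall>\<^sub>F n in sequentially. op_eigenvalue (Kn n) (lams n)"
      using eventually_ge_at_top[of 1]
      by (rule eventually_mono) (unfold Kn_def, intro spectrum_imp_op_eigenvalue r M lams)
  qed
  show "\<exists>lams. approximates lam lams" if lam: "lam \<in> op_spectrum K" for lam
  proof -
    obtain q D where q: "0 < q" "q < 1" and ev: "\<forall>\<^sub>F n in sequentially. \<exists>z\<in>spectrum (M n). cmod (z - lam) \<le> D * q ^ n"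
    \<comment> \<open>Zero is an eigenvalue of every \<open>Kn n\<close> through the coordinates
      outside the block, so operator convergence does not locate small eigenvalues of
      \<open>M n\<close>; the determinant estimate does.\<close>
    proof (cases "lam = 0")
      case False
      obtain q where q: "0 < q" "q < 1"
        and zs: "\<forall>\<^sub>F n in sequentially. \<exists>z. z \<noteq> 0 \<and> op_eigenvalue (Kn n) z \<and> cmod (z - lam) \<le> q ^ n"
        by (rule spectral_approximation[OF tc cl conv \<theta> lam False])
      have "\<forall>\<^sub>F n in sequentially. \<exists>z\<in>spectrum (M n). cmod (z - lam) \<le> 1 * q ^ n"
        using zs eventually_ge_at_top[of 1]
      proof eventually_elim
        case (elim n)
        then obtain z where z: "z \<noteq> 0" "op_eigenvalue (Kn n) z" "cmod (z - lam) \<le> q ^ n" by blast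
        have "z \<in> spectrum (M n)"
          by (rule op_eigenvalue_imp_spectrum[OF r(1) M[OF elim(2)] z(2)[unfolded Kn_def] z(1)])
        then show ?case using z(3) by auto
      qed
      then show ?thesis using that q by blast
    next
      case True
      have ev: "\<forall>\<^sub>F n in sequentially. \<exists>z\<in>spectrum (M n). cmod (z - lam) \<le> 2 * (C + C) / \<theta> * sqrt \<theta> ^ n"
        using linear_times_exponential[OF \<theta> add_nonneg_nonneg[OF C C]] eventually_ge_at_top[of 1]
      proof eventually_elim
        case (elim n)
        have "exp_bounded (C + C * \<theta> ^ n) \<theta> (block_matrix n (weighted_mat r n (M n)))"
          using exp_bounded_diff[OF a close[OF elim(2)]] by simp
        moreover have "C * \<theta> ^ n \<le> C" using C \<theta> by (simp add: mult_left_le power_le_one)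
        ultimately have "exp_bounded (C + C) \<theta> (block_matrix n (weighted_mat r n (M n)))"
          using \<theta> by (auto elim!: exp_bounded_mono)
        then obtain z where "z \<in> spectrum (M n)" "cmod z \<le> real (2 * n - 1) * (C + C) * \<theta> ^ (n - 1)"
          by (rule small_eigenvalue[OF r(1) elim(2) M[OF elim(2)]])
        then show ?case using elim(1) True by force
      qed
      have "0 < sqrt \<theta>" "sqrt \<theta> < 1" using \<theta> by auto
      then show ?thesis using that ev by blast
    qed
    define good where "good n z \<longleftrightarrow> z \<in> spectrum (M n) \<and> cmod (z - lam) \<le> D * q ^ n" for n z
    \<comment> \<open>The estimate holds only for large \<open>n\<close>; for the other
      \<open>n\<close> an arbitrary eigenvalue keeps the sequence inside the spectra.\<close>
    define lams where "lams n = (if \<exists>z. good n z then SOME z. good n z else SOME z. z \<in> spectrum (M n))" for n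
    have good: "good n (lams n)" if "\<exists>z. good n z" for n
      using that someI_ex[OF that] by (simp add: lams_def)
    have "lams n \<in> spectrum (M n)" if n: "1 \<le> n" for n
    proof (cases "\<exists>z. good n z")
      case True
      then show ?thesis using good by (auto simp: good_def)
    next
      case False
      have "\<exists>z. z \<in> spectrum (M n)" using spectrum_non_empty[OF M[OF n]] n by auto
      from someI_ex[OF this] show ?thesis using False by (simp add: lams_def)
    qed
    moreover have le: "\<forall>\<^sub>F n in sequentially. cmod (lams n - lam) \<le> D * q ^ n"
      using ev
    proof (rule eventually_mono)
      fix n assume "\<exists>z\<in>spectrum (M n). cmod (z - lam) \<le> D * q ^ n"
      then have "\<exists>z. good n z" by (auto simp: good_def)
      then show "cmod (lams n - lam) \<le> D * q ^ n" using good by (auto simp: good_def)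
    qed
    ultimately show ?thesis
      using exponential_approximation[OF q le] unfolding approximates_def by blast
  qed
  show "\<exists>b>0. (\<lambda>n. norm (riesz_projection K lam (hardy_embed r (h n)) - hardy_embed r (h n)))
        \<in> O(\<lambda>n. exp (- b * real n))"
    if lam: "lam \<in> op_spectrum K" "lam \<noteq> 0" "lams \<longlonglongrightarrow> lam"
      and \<xi>: "\<And>n. 1 \<le> n \<Longrightarrow> gen_eigenvector (transpose_mat (M n)) (\<xi> n) (lams n)"
      and h: "\<And>n. 1 \<le> n \<Longrightarrow> h n = (\<lambda>z. c n * laurent_of_vec n (\<xi> n) z) \<and> norm (hardy_embed r (h n)) = 1"
    for lam lams \<xi> h c
  proof -
    have gen: "\<exists>\<nu>. (blinfun_apply (scalar_op (lams n) - Kn n) ^^ \<nu>) (hardy_embed r (h n)) = 0" if n: "1 \<le> n" for n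
    proof -
      have dim: "dim_row (transpose_mat (M n)) = 2 * n - 1" using M[OF n] by simp
      obtain \<nu> where v: "\<xi> n \<in> carrier_vec (2 * n - 1)"
        and \<nu>: "((lams n \<cdot>\<^sub>m 1\<^sub>m (2 * n - 1) - transpose_mat (M n)) ^\<^sub>m \<nu>) *\<^sub>v \<xi> n = 0\<^sub>v (2 * n - 1)"
        using \<xi>[OF n] unfolding gen_eigenvector_def dim by blast
      have emb: "hardy_embed r (h n) = cscale (c n) (emb_vec n (weighted_vec r n (\<xi> n)))"
        using h[OF n] hardy_embed_laurent_of_vec[OF r, of n "\<xi> n"]
          hardy_embed_cmult[OF r continuous_on_laurent_poly[of "laurent_of_vec n (\<xi> n)"], of "c n"] by simp
      have "weighted_vec r n (0\<^sub>v (2 * n - 1)) = 0\<^sub>v (2 * n - 1)"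
        by (intro eq_vecI) (auto simp: weighted_vec_def)
      then have zero: "(blinfun_apply (scalar_op (lams n) - Kn n) ^^ \<nu>) (emb_vec n (weighted_vec r n (\<xi> n))) = 0"
        unfolding Kn_def laurent_section_op_gen_eigenvector[OF r(1) M[OF n] v] \<nu> by (simp only: emb_vec_zero)
      have lin: "(blinfun_apply (scalar_op (lams n) - Kn n) ^^ j) (cscale d x)
          = cscale d ((blinfun_apply (scalar_op (lams n) - Kn n) ^^ j) x)" for j d x
        using complex_linear_op_scalar_minus[OF cl[of n], of "lams n"]
        by (induction j) (auto simp: complex_linear_op_def)
      show ?thesis unfolding emb lin by (rule exI[of _ \<nu>]) (simp add: zero cscale_simps)
    qed
    have "\<forall>\<^sub>F n in sequentially. norm (hardy_embed r (h n)) = 1 \<and>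
        (\<exists>\<nu>. (blinfun_apply (scalar_op (lams n) - Kn n) ^^ \<nu>) (hardy_embed r (h n)) = 0)"
      using eventually_ge_at_top[of 1] by (rule eventually_mono) (use gen h in blast)
    then obtain D where D: "\<forall>\<^sub>F n in sequentially.
        norm (riesz_projection K lam (hardy_embed r (h n)) - hardy_embed r (h n)) \<le> D * \<theta> ^ n"
      by (rule riesz_projection_approximation[OF tc cl conv \<theta> lam])
    define f where "f n = complex_of_real (norm (riesz_projection K lam (hardy_embed r (h n)) - hardy_embed r (h n)))" for n
    have "\<forall>\<^sub>F n in sequentially. cmod (f n - 0) \<le> D * \<theta> ^ n" using D by (simp add: f_def)
    from exponential_approximation(2)[OF \<theta> this] show ?thesis by (simp add: f_def)
  qed
qed

theorem theorem1p1:
  fixes \<tau> :: "complex \<Rightarrow> complex"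
  assumes "expanding_circle_map \<tau>"
  shows "\<exists>r K. 0 < r \<and> r < 1 \<and> is_koopman_op r \<tau> K \<and> compact_operator K \<and>
    (finite (op_spectrum K) \<or> (\<exists>s :: nat \<Rightarrow> complex. s \<longlonglongrightarrow> 0 \<and> op_spectrum K = insert 0 (range s))) \<and>
    (\<forall>\<mu>\<in>op_spectrum K. \<mu> \<noteq> 0 \<longrightarrow> op_eigenvalue K \<mu> \<and> finite_alg_multiplicity K \<mu>) \<and>
    (\<forall>(\<alpha>::real) (m :: nat \<Rightarrow> nat).
      (\<forall>n\<ge>1. real (m n) \<ge> (circle_deriv_min \<tau> + circle_deriv_max \<tau>) * real n) \<longrightarrow>
      (let M = (\<lambda>n. edmd_matrix \<tau> (\<lambda>l z. z powi l) n (m n)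
                      (\<lambda>j. exp (2 * of_real pi * \<i> * of_nat j / of_nat (m n) + \<i> * of_real \<alpha>)));
           approximates = (\<lambda>lam lams. (\<forall>n\<ge>1. lams n \<in> spectrum (M n)) \<and> lams \<longlonglongrightarrow> lam \<and>
                      (\<exists>a>0. (\<lambda>n. cmod (lam - lams n)) \<in> O(\<lambda>n. exp (- a * real n))))
       in
        (\<forall>lams lam. (\<forall>n\<ge>1. lams n \<in> spectrum (M n)) \<and> lams \<longlonglongrightarrow> lam \<longrightarrow> lam \<in> op_spectrum K) \<and>
        (\<forall>lam\<in>op_spectrum K. \<exists>lams. approximates lam lams) \<and>
        (\<forall>lam\<in>op_spectrum K. lam \<noteq> 0 \<longrightarrow>
          (\<forall>lams \<xi> C h. approximates lam lams \<longrightarrow>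
            (\<forall>n\<ge>1. gen_eigenvector (transpose_mat (M n)) (\<xi> n) (lams n)) \<longrightarrow>
            (\<forall>n\<ge>1. h n = (\<lambda>z. C n * laurent_of_vec n (\<xi> n) z) \<and>
                    norm (hardy_embed r (h n)) = 1) \<longrightarrow>
            (\<exists>b>0. (\<lambda>n. norm (blinfun_apply (riesz_projection K lam) (hardy_embed r (h n))
                              - hardy_embed r (h n)))
                   \<in> O(\<lambda>n. exp (- b * real n)))))))"
proof -
  let ?min = "circle_deriv_min \<tau>" and ?max = "circle_deriv_max \<tau>"
  obtain r0 g0 where g0: "0 < r0" "r0 < 1" "g0 holomorphic_on annulus r0"
    "\<And>z. z \<in> sphere 0 1 \<Longrightarrow> g0 z = \<tau> z" and min: "1 < ?min"
    using assms unfolding expanding_circle_map_def by blast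
  have max: "?min \<le> ?max"
    using circle_deriv_bounds[OF g0, of 1] by simp
  \<comment> \<open>One third of the excess over 1 leaves \<open>?min - \<epsilon> > 1\<close> for
    the decay and pays for both copies of \<open>\<epsilon>\<close> in
    \<open>1 + (?max + \<epsilon>) + \<epsilon> \<le> ?min + ?max\<close>.\<close>
  define \<epsilon> where "\<epsilon> = (?min - 1) / 3"
  have \<epsilon>: "0 < \<epsilon>" "\<epsilon> \<le> ?min" "1 < ?min - \<epsilon>" "0 \<le> ?max + \<epsilon>" "1 + (?max + \<epsilon>) + \<epsilon> \<le> ?min + ?max"
    using min max by (auto simp: \<epsilon>_def field_simps)
  obtain g s where g: "thin_extension \<tau> g s (?min - \<epsilon>) (?max + \<epsilon>)"
    by (rule expanding_circle_map_thin_extension[OF assms \<epsilon>(1,2)])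
  have "1 < inverse s" using g by (auto simp: thin_extension_def one_less_inverse_iff)
  \<comment> \<open>Any circle inside the annulus will do; it fixes the space, and it is chosen
    before \<open>\<alpha>\<close> and \<open>m\<close>.\<close>
  then obtain R where R: "1 < R" "R < inverse s" using dense by blast
  define r where "r = inverse R"
  have r: "0 < r" "r < 1" using R by (auto simp: r_def inverse_less_1_iff)
  obtain C \<theta> where koop: "exp_bounded C \<theta> (koopman_matrix r \<tau>)"
    and close: "\<And>n m \<alpha>. 1 \<le> n \<Longrightarrow> 2 * n \<le> m \<Longrightarrow> (?min + ?max) * real n \<le> real m \<Longrightarrow>
      exp_bounded (C * \<theta> ^ n) \<theta> (\<lambda>k l. koopman_matrix r \<tau> k l
        - block_matrix n (weighted_mat r n (edmd_matrix \<tau> (\<lambda>l z. z powi l) n m (edmd_points \<alpha> m))) k l)"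
    using edmd_approximation[OF g \<epsilon>(3,4) R \<epsilon>(1,5)] unfolding r_def by blast
  define K where "K = matrix_op (koopman_matrix r \<tau>)"
  have tc: "truncation_close K" unfolding K_def by (rule truncation_close_matrix_op[OF koop])
  have koopman: "is_koopman_op r \<tau> K"
    unfolding K_def by (rule is_koopman_op_matrix_op[OF r koop thin_extension_continuous[OF g]])
  have comp: "compact_operator K"
    using tc unfolding truncation_close_def by (intro compact_operator_if_truncation_close) blast
  have eig: "\<forall>\<mu>\<in>op_spectrum K. \<mu> \<noteq> 0 \<longrightarrow> op_eigenvalue K \<mu> \<and> finite_alg_multiplicity K \<mu>"
    using op_eigenvalue_nonzero_spectrum[OF tc] finite_alg_multiplicity[OF tc] by blast
  show ?thesis
  proof (rule exI[of _ r], rule exI[of _ K], intro conjI allI impI r koopman comp eig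
      spectrum_finite_or_null_sequence[OF tc])
    fix \<alpha> :: real and m :: "nat \<Rightarrow> nat"
    assume m: "\<forall>n\<ge>1. real (m n) \<ge> (?min + ?max) * real n"
    define M where "M n = edmd_matrix \<tau> (\<lambda>l z. z powi l) n (m n) (edmd_points \<alpha> (m n))" for n
    have M_eq: "edmd_matrix \<tau> (\<lambda>l z. z powi l) n (m n)
        (\<lambda>j. exp (2 * of_real pi * \<i> * of_nat j / of_nat (m n) + \<i> * of_real \<alpha>)) = M n" for n
      unfolding M_def edmd_points_def ..
    \<comment> \<open>Both extreme derivatives exceed 1, so the bound on \<open>m\<close> already
      contains the sampling condition that makes the Gram matrix the identity.\<close>
    have m2: "2 * n \<le> m n" if n: "1 \<le> n" for n
    proof -
      have "2 * real n \<le> (?min + ?max) * real n" using min max by (intro mult_right_mono) auto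
      also have "\<dots> \<le> real (m n)" using m n by blast
      finally show ?thesis by linarith
    qed
    have carrier: "M n \<in> carrier_mat (2 * n - 1) (2 * n - 1)" if n: "1 \<le> n" for n
      unfolding M_def using edmd_matrix_equidistant[OF m2[OF n]] n by (simp add: edmd_G_def)
    have close_M: "exp_bounded (C * \<theta> ^ n) \<theta> (\<lambda>k l. koopman_matrix r \<tau> k l
        - block_matrix n (weighted_mat r n (M n)) k l)" if n: "1 \<le> n" for n
      unfolding M_def by (rule close[OF n m2[OF n]]) (use m n in blast)
    note approx = laurent_section_spectral_approximation[OF r koop K_def carrier close_M]
    show "let M = (\<lambda>n. edmd_matrix \<tau> (\<lambda>l z. z powi l) n (m n)
                      (\<lambda>j. exp (2 * of_real pi * \<i> * of_nat j / of_nat (m n) + \<i> * of_real \<alpha>)));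
           approximates = (\<lambda>lam lams. (\<forall>n\<ge>1. lams n \<in> spectrum (M n)) \<and> lams \<longlonglongrightarrow> lam \<and>
                      (\<exists>a>0. (\<lambda>n. cmod (lam - lams n)) \<in> O(\<lambda>n. exp (- a * real n))))
       in
        (\<forall>lams lam. (\<forall>n\<ge>1. lams n \<in> spectrum (M n)) \<and> lams \<longlonglongrightarrow> lam \<longrightarrow> lam \<in> op_spectrum K) \<and>
        (\<forall>lam\<in>op_spectrum K. \<exists>lams. approximates lam lams) \<and>
        (\<forall>lam\<in>op_spectrum K. lam \<noteq> 0 \<longrightarrow>
          (\<forall>lams \<xi> C h. approximates lam lams \<longrightarrow>
            (\<forall>n\<ge>1. gen_eigenvector (transpose_mat (M n)) (\<xi> n) (lams n)) \<longrightarrow>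
            (\<forall>n\<ge>1. h n = (\<lambda>z. C n * laurent_of_vec n (\<xi> n) z) \<and>
                    norm (hardy_embed r (h n)) = 1) \<longrightarrow>
            (\<exists>b>0. (\<lambda>n. norm (blinfun_apply (riesz_projection K lam) (hardy_embed r (h n))
                              - hardy_embed r (h n)))
                   \<in> O(\<lambda>n. exp (- b * real n)))))"
      unfolding M_eq Let_def
      using approx(1) approx(2) by (intro conjI allI ballI impI) (blast, blast, rule approx(3), auto)
  qed
qed

end
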